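(* Let $\alpha\in(-\tfrac12,\infty)^d$, $\beta>0$ and $\lambda>0$. Then the Bessel Laguerre potential $\mathcal{J}_\lambda^\alpha$ is bounded from $Lip_\beta(\mu_\alpha)$ to $Lip_{\beta+\lambda}(\mu_\alpha)$.
   Context: Let $\mathbb{R}_+^d=(0,\infty)^d$ and, for $\alpha=(\alpha_1,\dots,\alpha_d)\in(-1,\infty)^d$, let $\mathrm{d}\mu_\alpha(x)=\prod_{i=1}^d\frac{x_i^{\alpha_i}e^{-x_i}}{\Gamma(\alpha_i+1)}\,\mathrm{d}x$ be the Laguerre measure on $\mathbb{R}_+^d$. The Laguerre operator $\mathcal{L}^\alpha=-\sum_{i=1}^d\big[x_i\partial_{x_i}^2+(\alpha_i+1-x_i)\partial_{x_i}\big]$ is positive and symmetric in $L^2(\mathbb{R}_+^d,\mathrm{d}\mu_\alpha)$, and its self-adjoint closure is denoted by the same symbol. The Laguerre polynomials of type $\alpha$ are $L_k^\alpha(x)=\prod_{i=1}^dL_{k_i}^{\alpha_i}(x_i)$, $k\in\mathbb{N}^d$ with $\mathbb{N}=\{0,1,2,\dots\}$, where in one dimension $L_k^{\alpha}(x)=\frac1{k!}e^xx^{-\alpha}\frac{\mathrm{d}^k}{\mathrm{d}x^k}(e^{-x}x^{k+\alpha})$. They satisfy $\mathcal{L}^\alpha L_k^\alpha=|k|L_k^\alpha$, with $|k|=k_1+\dots+k_d$, and form an orthogonal basis of $L^2(\mathbb{R}_+^d,\mathrm{d}\mu_\alpha)$. Laguerre semigroup: $T_t^\alpha=e^{-t\mathcal{L}^\alpha}$,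 given for $t>0$ by $T_t^\alpha f(x)=\int_{\mathbb{R}_+^d}G_t^\alpha(x,y)f(y)\,\mathrm{d}\mu_\alpha(y)$ with $$G_t^\alpha(x,y)=\prod_{j=1}^d\frac{\Gamma(\alpha_j+1)}{1-e^{-t}}\,e^{-\frac{e^{-t}}{1-e^{-t}}(x_j+y_j)}\big(\sqrt{e^{-t}x_jy_j}\big)^{-\alpha_j}I_{\alpha_j}\Big(\frac{2\sqrt{e^{-t}x_jy_j}}{1-e^{-t}}\Big),$$ where $I_\nu$ is the modified Bessel function of the first kind of order $\nu$. Poisson-Laguerre semigroup: $P_t^\alpha=e^{-t\sqrt{\mathcal{L}^\alpha}}$, given for $t>0$ by $$P_t^\alpha f(x)=\int_0^\infty T_s^\alpha f(x)\,\frac{t}{2\sqrt\pi}\,\frac{e^{-t^2/(4s)}}{s^{3/2}}\,\mathrm{d}s .$$ Laguerre Lipschitz space: for $\beta>0$ let $n$ be the smallest integer greater than $\beta$. An $L^\infty$ function $f$ on $\mathbb{R}_+^d$ belongs to $Lip_\beta(\mu_\alpha)$ if there is a constant $A_\beta(f)$ with $\big\|\frac{\partial^nP_t^\alpha f}{\partial t^n}\big\|_\infty\le A_\beta(f)t^{-n+\beta}$ for $t>0$. The norm is $\|f\|_{Lip_\beta(\mu_\alpha)}=\|f\|_\infty+A_\beta(f)$, with $A_\beta(f)$ the smallest such constant. Bessel Laguerre potential of order $\lambda>0$: it is defined formally as $$\mathcal{J}_\lambda^\alpha=(I+\mathcal{L}^\alpha)^{-\lambda/2},$$ so that $\mathcal{J}_\lambda^\alpha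 L_k^\alpha=(1+|k|)^{-\lambda/2}L_k^\alpha$ for every Laguerre polynomial. It is extended by linearity to all polynomials and then, by P.A. Meyer's multiplier theorem, to a continuous operator on $L^p(\mathbb{R}_+^d,\mathrm{d}\mu_\alpha)$, $1<p<\infty$. The source also gives, as an alternative integral representation of this potential, $\mathcal{J}_\lambda^\alpha f(x)=\frac{1}{\Gamma(\lambda)}\int_0^\infty s^{\lambda-1}e^{-s}P_s^\alpha f(x)\,\mathrm{d}s$ for $f\in L^p(\mathbb{R}_+^d,\mathrm{d}\mu_\alpha)$. *)

theory Defs
  imports "HOL-Probability.Probability"
begin

definition orthant :: "(real ^ 'd) set" where
  "orthant = {x. \<forall>i. 0 < x $ i}"

definition laguerre_measure :: "real ^ 'd \<Rightarrow> (real ^ 'd) measure" where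
  "laguerre_measure \<alpha> = density (restrict_space lborel orthant)
     (\<lambda>x. ennreal (\<Prod>i\<in>UNIV. x $ i powr \<alpha> $ i * exp (- x $ i) / Gamma (\<alpha> $ i + 1)))"

text \<open>Modified Bessel function of the first kind, for a positive argument.\<close>

definition bessel_I :: "real \<Rightarrow> real \<Rightarrow> real" where
  "bessel_I \<nu> z = (\<Sum>m. (z / 2) powr (2 * real m + \<nu>) / (fact m * Gamma (real m + \<nu> + 1)))"

definition laguerre_kernel ::
  "real ^ 'd \<Rightarrow> real \<Rightarrow> real ^ 'd \<Rightarrow> real ^ 'd \<Rightarrow> real" where
  "laguerre_kernel \<alpha> t x y = (\<Prod>j\<in>UNIV.
     Gamma (\<alpha> $ j + 1) / (1 - exp (- t))
     * exp (- (exp (- t) / (1 - exp (- t))) * (x $ j + y $ j))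
     * sqrt (exp (- t) * x $ j * y $ j) powr (- \<alpha> $ j)
     * bessel_I (\<alpha> $ j) (2 * sqrt (exp (- t) * x $ j * y $ j) / (1 - exp (- t))))"

definition laguerre_semigroup ::
  "real ^ 'd \<Rightarrow> real \<Rightarrow> (real ^ 'd \<Rightarrow> real) \<Rightarrow> real ^ 'd \<Rightarrow> real" where
  "laguerre_semigroup \<alpha> t f x = (LINT y|laguerre_measure \<alpha>. laguerre_kernel \<alpha> t x y * f y)"

definition poisson_laguerre ::
  "real ^ 'd \<Rightarrow> real \<Rightarrow> (real ^ 'd \<Rightarrow> real) \<Rightarrow> real ^ 'd \<Rightarrow> real" where
  "poisson_laguerre \<alpha> t f x = (LINT s:{0<..}|lborel.
     laguerre_semigroup \<alpha> s f x
     * (t / (2 * sqrt pi) * (exp (- (t\<^sup>2) / (4 * s)) / s powr (3 / 2))))"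

definition Linf_norm :: "real ^ 'd \<Rightarrow> (real ^ 'd \<Rightarrow> real) \<Rightarrow> ereal" where
  "Linf_norm \<alpha> f = esssup (laguerre_measure \<alpha>) (\<lambda>x. ereal \<bar>f x\<bar>)"

definition Linf :: "real ^ 'd \<Rightarrow> (real ^ 'd \<Rightarrow> real) set" where
  "Linf \<alpha> = {f. f \<in> borel_measurable (laguerre_measure \<alpha>) \<and> Linf_norm \<alpha> f < \<infinity>}"

definition lip_order :: "real \<Rightarrow> nat" where
  "lip_order \<beta> = (LEAST n. \<beta> < real n)"

definition lip_bound :: "real ^ 'd \<Rightarrow> real \<Rightarrow> (real ^ 'd \<Rightarrow> real) \<Rightarrow> real \<Rightarrow> bool" where
  "lip_bound \<alpha> \<beta> f A \<longleftrightarrow>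
     (\<forall>t>0. Linf_norm \<alpha> (\<lambda>x. (deriv ^^ lip_order \<beta>) (\<lambda>s. poisson_laguerre \<alpha> s f x) t)
            \<le> ereal (A * t powr (- real (lip_order \<beta>) + \<beta>)))"

definition Lip :: "real ^ 'd \<Rightarrow> real \<Rightarrow> (real ^ 'd \<Rightarrow> real) set" where
  "Lip \<alpha> \<beta> = {f \<in> Linf \<alpha>. \<exists>A. lip_bound \<alpha> \<beta> f A}"

definition lip_norm :: "real ^ 'd \<Rightarrow> real \<Rightarrow> (real ^ 'd \<Rightarrow> real) \<Rightarrow> real" where
  "lip_norm \<alpha> \<beta> f = real_of_ereal (Linf_norm \<alpha> f) + Inf {A. lip_bound \<alpha> \<beta> f A}"

definition laguerre_poly1 :: "real \<Rightarrow> nat \<Rightarrow> real \<Rightarrow> real" where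
  "laguerre_poly1 a k x = 1 / fact k * exp x * x powr (- a)
     * (deriv ^^ k) (\<lambda>u. exp (- u) * u powr (real k + a)) x"

definition laguerre_poly :: "real ^ 'd \<Rightarrow> nat ^ 'd \<Rightarrow> real ^ 'd \<Rightarrow> real" where
  "laguerre_poly \<alpha> k x = (\<Prod>i\<in>UNIV. laguerre_poly1 (\<alpha> $ i) (k $ i) (x $ i))"

definition laguerre_comb ::
  "real ^ 'd \<Rightarrow> (nat ^ 'd) set \<Rightarrow> (nat ^ 'd \<Rightarrow> real) \<Rightarrow> real ^ 'd \<Rightarrow> real" where
  "laguerre_comb \<alpha> K c x = (\<Sum>k\<in>K. c k * laguerre_poly \<alpha> k x)"

definition bessel_multiplier :: "real \<Rightarrow> nat ^ 'd \<Rightarrow> real" where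
  "bessel_multiplier l k = (1 + real (\<Sum>i\<in>UNIV. k $ i)) powr (- l / 2)"

definition Lp :: "real ^ 'd \<Rightarrow> real \<Rightarrow> (real ^ 'd \<Rightarrow> real) set" where
  "Lp \<alpha> p = {f \<in> borel_measurable (laguerre_measure \<alpha>).
     (\<integral>\<^sup>+x. ennreal (\<bar>f x\<bar> powr p) \<partial>laguerre_measure \<alpha>) < \<infinity>}"

definition Lp_tendsto ::
  "real ^ 'd \<Rightarrow> real \<Rightarrow> (nat \<Rightarrow> real ^ 'd \<Rightarrow> real) \<Rightarrow> (real ^ 'd \<Rightarrow> real) \<Rightarrow> bool" where
  "Lp_tendsto \<alpha> p q f \<longleftrightarrow>
     (\<lambda>n. \<integral>\<^sup>+x. ennreal (\<bar>q n x - f x\<bar> powr p) \<partial>laguerre_measure \<alpha>) \<longlonglongrightarrow> 0"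

text \<open>
  The continuous extension to $L^p$ of the operator acting on the polynomials (the finite
  linear combinations of Laguerre polynomials) by $L_k \mapsto (1+|k|)^{-l/2} L_k$, as a relation:
  \<open>g\<close> is a value of the extension at \<open>f\<close> if some sequence of polynomials tends to \<open>f\<close> in $L^p$
  while the images of its members tend to \<open>g\<close> in $L^p$.
\<close>

definition bessel_extension ::
  "real ^ 'd \<Rightarrow> real \<Rightarrow> real \<Rightarrow> (real ^ 'd \<Rightarrow> real) \<Rightarrow> (real ^ 'd \<Rightarrow> real) \<Rightarrow> bool" where
  "bessel_extension \<alpha> l p f g \<longleftrightarrow> f \<in> Lp \<alpha> p \<and> g \<in> Lp \<alpha> p \<and>
     (\<exists>K c. (\<forall>n. finite (K n)) \<and>
        Lp_tendsto \<alpha> p (\<lambda>n. laguerre_comb \<alpha> (K n) (c n)) f \<and>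
        Lp_tendsto \<alpha> p (\<lambda>n. laguerre_comb \<alpha> (K n) (\<lambda>k. bessel_multiplier l k * c n k)) g)"

text \<open>
  The Bessel Laguerre potential $(I + \mathcal{L}^\alpha)^{-l/2}$, determined up to equality almost
  everywhere: the common value at \<open>f\<close> of the extensions for all $p \in (1,\infty)$ with
  $f \in L^p$. Since $(I + \mathcal{L}^\alpha)^{-l/2}$ and $(I + \sqrt{\mathcal{L}^\alpha})^{-l}$
  have different eigenvalues, an integral over the Poisson semigroup with weight
  $s^{l-1} e^{-s} / \Gamma(l)$ yields the latter operator, not the one defined here.
\<close>

definition bessel_potential ::
  "real ^ 'd \<Rightarrow> real \<Rightarrow> (real ^ 'd \<Rightarrow> real) \<Rightarrow> real ^ 'd \<Rightarrow> real" where
  "bessel_potential \<alpha> l f =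
     (SOME g. \<forall>p>1. f \<in> Lp \<alpha> p \<longrightarrow> bessel_extension \<alpha> l p f g)"

end

theory Submission
  imports Defs
begin

text \<open>For every point \<open>x\<close> the orbit \<open>w s = T\<^sub>s f x\<close> turns the heat semigroup into the translation semigroup:
  \<open>P\<^sub>t f x\<close> is the average of \<open>w\<close> against the density \<open>p\<^sub>t\<close> of the one-sided stable law of index
  \<open>1 / 2\<close>, and the potential \<open>J f = (I + L)\<^sup>-\<^sup>l\<^sup>/\<^sup>2 f\<close> has the orbit \<open>s \<mapsto> \<integral> w (s + r) g\<^sub>l\<^sub>/\<^sub>2 r dr\<close>, where \<open>g\<^sub>a\<close> is the
  gamma density of shape \<open>a\<close>. Since \<open>T\<^sub>s\<close> is a contraction, the Lipschitz hypothesis on \<open>f\<close> holds along the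
  whole orbit, so that only translations on the half line remain. As \<open>T\<^sub>s\<close> is not
  analytic on \<open>L\<^sup>\<infinity>\<close>, the derivatives must not fall on \<open>T\<^sub>s\<close>: for \<open>a < 1\<close> the second \<open>t\<close>-derivative of
  \<open>P\<^sub>t\<close> is minus a derivative along the orbit, and the monotonicity of \<open>g\<^sub>a\<close> (second mean value theorem)
  shows that averaging against \<open>g\<^sub>a\<close> gains \<open>t\<^sup>2\<^sup>a\<close>. Iterating with \<open>a = l / (2 k)\<close> and
  integrating the resulting high-order bound down from \<open>t = \<infinity>\<close> gives the claim for \<open>J f\<close>.

  The abstract potential agrees with this integral operator because both act alike on Laguerre
  polynomials, the integral operator contracts every \<open>L\<^sup>p\<close>, and polynomials are dense.\<close>

section \<open>The one-sided stable law of index one half\<close>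

text \<open>An average over the Poisson semigroup would make the gain immediate, since the
  derivatives of P_t P_s are those of P_(t+s); but with the gamma weight it represents (I + sqrt
  L)^(-l). The heat semigroup must be averaged instead, and T_r adds no decay in r to a derivative
  of P_t. On r \<le> t^2, the natural scale of the stable law, size alone gives the power t^(2a). On
  r > t^2 size alone would leave the bound multiplied by the mass of the tail; what helps is
  cancellation, because two of the t-derivatives integrate along the orbit to a difference of
  boundary values, and a decreasing weight keeps this bounded. The gamma density decreases only for
  shape at most 1, hence the factorisation of the potential into many pieces of small shape. Each
  piece costs two derivatives, so the order reached is larger than the one wanted; integrating down
  from infinity is possible because every order on the way still exceeds \<beta> + l. The estimates
  concern functions of one real variable, so that neither \<alpha> nor the dimension enters their
  constants.\<close>

fun stable_poly :: "nat \<Rightarrow> real poly" where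
  "stable_poly 0 = [:0, 1 / (2 * sqrt pi):]"
| "stable_poly (Suc j) = pderiv (stable_poly j) - [:0, 1/2:] * stable_poly j"

text \<open>The \<open>j\<close>-th derivative in \<open>t\<close> of \<open>t / (2 sqrt pi) exp (- t\<^sup>2 / (4 r)) r\<^sup>-\<^sup>3\<^sup>/\<^sup>2\<close>, extended by zero to \<open>r \<le> 0\<close>.\<close>

definition stable_kernel :: "nat \<Rightarrow> real \<Rightarrow> real \<Rightarrow> real" where
  "stable_kernel j t r =
     (if r \<le> 0 then 0 else poly (stable_poly j) (t / sqrt r) * exp (- (t\<^sup>2) / (4 * r)) / sqrt r ^ (j + 2))"

lemma stable_kernel_nonpos [simp]: "r \<le> 0 \<Longrightarrow> stable_kernel j t r = 0"
  by (simp add: stable_kernel_def)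

lemma stable_kernel_0:
  assumes "r > 0"
  shows "stable_kernel 0 t r = t / (2 * sqrt pi) * (exp (- (t\<^sup>2) / (4 * r)) / r powr (3 / 2))"
proof -
  have "r powr (3/2) = r * sqrt r"
    using assms powr_add[of r 1 "1/2"] by (simp add: powr_half_sqrt)
  then show ?thesis
    using assms by (simp add: stable_kernel_def power2_eq_square field_simps)
qed

lemma stable_kernel_0_nonneg: "t \<ge> 0 \<Longrightarrow> stable_kernel 0 t r \<ge> 0"
  by (cases "r \<le> 0") (auto simp: stable_kernel_0)

lemma stable_kernel_0_pos: "t > 0 \<Longrightarrow> r > 0 \<Longrightarrow> stable_kernel 0 t r > 0"
  by (auto simp: stable_kernel_0)

text \<open>In y = t / sqrt r the kernel is q(y) exp (- y^2 / 4) over a power of sqrt r. A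
  t-derivative turns q into q' - (y / 2) q and adds a factor 1 / sqrt r, which is the recursion of
  \<open>stable_poly\<close>; the polynomials are rescaled Hermite polynomials of degree j +
  1.\<close>

lemma stable_kernel_deriv:
  "((\<lambda>t. stable_kernel j t r) has_real_derivative stable_kernel (Suc j) t r) (at t)"
proof (cases "r \<le> 0")
  case False
  define s where "s = sqrt r"
  have s: "s > 0" "r = s^2" using False by (auto simp: s_def)
  have "((\<lambda>t. poly (stable_poly j) (t / s) * exp (- (t\<^sup>2) / (4 * s^2)) / s ^ (j + 2)) has_real_derivative
     (poly (pderiv (stable_poly j)) (t/s) * (1/s) * exp (- (t\<^sup>2) / (4 * s^2))
       + poly (stable_poly j) (t / s) * (exp (- (t\<^sup>2) / (4 * s^2)) * (- (2*t) / (4 * s^2)))) / s ^ (j + 2)) (at t)"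
    using s by (auto intro!: derivative_eq_intros DERIV_chain2[OF poly_DERIV] simp: field_simps)
  also have "(poly (pderiv (stable_poly j)) (t/s) * (1/s) * exp (- (t\<^sup>2) / (4 * s^2))
       + poly (stable_poly j) (t / s) * (exp (- (t\<^sup>2) / (4 * s^2)) * (- (2*t) / (4 * s^2)))) / s ^ (j + 2)
     = stable_kernel (Suc j) t r"
  proof -
    have "\<not> r \<le> 0" "sqrt r = s" using False by (auto simp: s_def)
    then show ?thesis unfolding stable_kernel_def if_not_P[OF \<open>\<not> r \<le> 0\<close>] \<open>sqrt r = s\<close>
      using s(1) unfolding s(2) by (simp add: field_simps power2_eq_square)
  qed
  finally show ?thesis using False by (simp add: stable_kernel_def s_def)
qed simp

lemma stable_kernel_measurable [measurable]: "(\<lambda>r. stable_kernel j t r) \<in> borel_measurable borel"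
proof -
  have [measurable]: "poly p \<in> borel_measurable borel" for p :: "real poly"
    by (intro borel_measurable_continuous_onI continuous_on_poly continuous_on_id)
  show ?thesis unfolding stable_kernel_def by measurable
qed

text \<open>Induction over the coefficients spends half of the exponent on \<open>p\<close> and half
  on the additional factor y; for this \<open>c\<close> varies in the induction.\<close>

lemma poly_le_exp_square:
  fixes p :: "real poly"
  assumes "c > 0"
  shows "\<exists>C\<ge>0. \<forall>y. \<bar>poly p y\<bar> \<le> C * exp (c * y\<^sup>2)"
  using assms
proof (induction p arbitrary: c)
  case 0
  then show ?case by (intro exI[of _ 0]) auto
next
  case (pCons a p)
  obtain C where C: "C \<ge> 0" "\<And>y. \<bar>poly p y\<bar> \<le> C * exp (c/2 * y\<^sup>2)"
    using pCons.IH[of "c/2"] pCons.prems by auto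
  \<comment> \<open>The constant comes from 1 + y^2 \<le> (1 + 2/c) (1 + (c/2) y^2).\<close>
  have y: "\<bar>y\<bar> \<le> (1 + 2/c) * exp (c/2*y^2)" for y
  proof -
    have "1 + c/2*y^2 \<le> exp (c/2*y^2)" by (rule exp_ge_add_one_self)
    moreover have "\<bar>y\<bar> \<le> 1 + y^2"
      using sum_squares_bound[of "\<bar>y\<bar>" 1] by simp
    moreover have "1 + y^2 \<le> (1 + 2/c) * (1 + c/2*y^2)"
      using pCons.prems by (simp add: field_simps)
    moreover have "(1 + 2/c) * (1 + c/2*y^2) \<le> (1 + 2/c) * exp (c/2*y^2)"
      using pCons.prems \<open>1 + c/2*y^2 \<le> exp (c/2*y^2)\<close> by (intro mult_left_mono) auto
    ultimately show ?thesis by linarith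
  qed
  have "\<bar>poly (pCons a p) y\<bar> \<le> (\<bar>a\<bar> + (1 + 2/c) * C) * exp (c * y\<^sup>2)" for y
  proof -
    have "\<bar>poly (pCons a p) y\<bar> \<le> \<bar>a\<bar> + \<bar>y\<bar> * \<bar>poly p y\<bar>"
      by (simp add: abs_mult[symmetric] abs_triangle_ineq)
    also have "\<bar>y\<bar> * \<bar>poly p y\<bar> \<le> ((1 + 2/c) * exp (c/2*y^2)) * (C * exp (c/2*y^2))"
      using y[of y] C pCons.prems by (intro mult_mono) auto
    also have "\<dots> = (1 + 2/c) * C * (exp (c/2*y^2) * exp (c/2*y^2))"
      by simp
    also have "exp (c/2*y^2) * exp (c/2*y^2) = exp (c * y\<^sup>2)"
      by (simp flip: exp_add)
    also have "\<bar>a\<bar> \<le> \<bar>a\<bar> * exp (c*y^2)"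
      using pCons.prems by (simp add: mult_le_cancel_left1)
    finally show ?thesis by (simp add: algebra_simps)
  qed
  then show ?case using C pCons.prems by (intro exI[of _ "\<bar>a\<bar> + (1 + 2/c) * C"]) auto
qed

text \<open>The comparison kernel \<open>stable_kernel 0\<close> has a factor y, so one must be
  split off before the rest is absorbed by an exponential. For j = 0 the polynomial itself supplies
  it, otherwise the power y^j does.\<close>

lemma stable_poly_factor: "\<exists>R. \<forall>y. y ^ j * poly (stable_poly j) y = y * poly R y"
proof (cases j)
  case 0
  then show ?thesis by (intro exI[of _ "[:1 / (2 * sqrt pi):]"]) simp
next
  case (Suc i)
  then show ?thesis by (intro exI[of _ "monom 1 i * stable_poly j"]) (simp add: poly_monom)
qed

text \<open>By homogeneity t^j times the kernel depends on r only through y = t / sqrt r and a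
  factor 1 / r. Of the exponent 1/4 the part 3/16 absorbs the polynomial; the remaining 1/16 is the
  exponent that belongs to the time t / 2.\<close>

lemma stable_kernel_bound:
  "\<exists>C\<ge>0. \<forall>t>0. \<forall>r. \<bar>stable_kernel j t r\<bar> \<le> C / t ^ j * stable_kernel 0 (t / 2) r"
proof -
  obtain R where R: "\<And>y. y ^ j * poly (stable_poly j) y = y * poly R y"
    using stable_poly_factor by blast
  obtain C where C: "C \<ge> 0" "\<And>y. \<bar>poly R y\<bar> \<le> C * exp (3/16 * y\<^sup>2)"
    using poly_le_exp_square[of "3/16" R] by auto
  have "\<bar>stable_kernel j t r\<bar> \<le> (C * (4 * sqrt pi)) / t ^ j * stable_kernel 0 (t / 2) r"
    if t: "t > 0" for t r
  proof (cases "r \<le> 0")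
    case False
    define s where "s = sqrt r"
    have s: "s > 0" "r = s^2" using False by (auto simp: s_def)
    define y where "y = t / s"
    have y: "y > 0" "t = y * s" using s t by (auto simp: y_def)
    have e: "(y * s)\<^sup>2 / (4 * s\<^sup>2) = y^2/4" "(y * s / 2)\<^sup>2 / (4 * s\<^sup>2) = y^2/16"
      using s by (auto simp: power2_eq_square)
    have "t ^ j * \<bar>stable_kernel j t r\<bar> = \<bar>y ^ j * poly (stable_poly j) y\<bar> * exp (- (y^2) / 4) / s^2"
      using False s(1) y(1) by (simp add: stable_kernel_def s_def[symmetric] s(2) y(2) e abs_mult
        power_mult_distrib power_add power2_eq_square)
    also have "\<dots> = y * \<bar>poly R y\<bar> * exp (- (y^2) / 4) / s^2"
      using y unfolding R by (simp add: abs_mult)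
    also have "\<dots> \<le> y * (C * exp (3/16 * y^2)) * exp (- (y^2) / 4) / s^2"
      using s y C by (intro divide_right_mono mult_right_mono mult_left_mono) auto
    also have "\<dots> = C * y / s^2 * (exp (3/16 * y^2) * exp (- (y^2) / 4))"
      by simp
    also have "exp (3/16 * y^2) * exp (- (y^2) / 4) = exp (- (y^2)/16)"
      by (simp flip: exp_add)
    also have "C * y / s^2 * exp (- (y^2)/16) = C * (4 * sqrt pi) * stable_kernel 0 (t / 2) r"
    proof -
      have sr: "sqrt r = s" by (simp add: s_def)
      have "stable_kernel 0 (t / 2) r = y / (4 * sqrt pi) * exp (- (y^2)/16) / s^2"
        unfolding stable_kernel_def if_not_P[OF False] sr
        unfolding s(2) y(2) minus_divide_left[symmetric] e
        using s(1) by (simp add: power2_eq_square)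
      then show ?thesis by simp
    qed
    finally show ?thesis using t by (simp add: field_simps)
  qed simp
  then show ?thesis using C by (intro exI[of _ "C * (4 * sqrt pi)"]) auto
qed

section \<open>The Gaussian primitive; mass and convolution of the stable density\<close>

definition erf_primitive :: "real \<Rightarrow> real" where
  "erf_primitive z = (LBINT u=ereal 0..ereal z. exp (- (u\<^sup>2)))"

lemma erf_primitive_deriv: "(erf_primitive has_real_derivative exp (- (z\<^sup>2))) (at z)"
proof -
  have "((\<lambda>u. LBINT y=ereal 0..ereal u. exp (- (y\<^sup>2))) has_vector_derivative exp (- (z\<^sup>2)))
      (at z within {min 0 z - 1..max 0 z + 1})"
    by (rule interval_integral_FTC2) (auto intro!: continuous_intros)
  then show ?thesis
    unfolding erf_primitive_def[abs_def] has_real_derivative_iff_has_vector_derivative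
    by (subst (asm) at_within_interior) (auto simp: interior_atLeastAtMost_real)
qed

lemma erf_primitive_minus: "erf_primitive (- z) = - erf_primitive z"
proof -
  have "((\<lambda>x. erf_primitive (- x) + erf_primitive x) has_real_derivative 0) (at x)" for x
    using DERIV_add[OF DERIV_chain2[OF erf_primitive_deriv DERIV_minus[OF DERIV_ident]] erf_primitive_deriv, of x]
    by simp
  then have "erf_primitive (- z) + erf_primitive z = erf_primitive (- 0) + erf_primitive 0"
    by (intro DERIV_isconst_all) auto
  moreover have "erf_primitive 0 = 0"
    by (simp add: erf_primitive_def)
  ultimately show ?thesis by simp
qed

lemma erf_primitive_at_top: "(erf_primitive \<longlongrightarrow> sqrt pi / 2) at_top"
proof -
  have i: "set_integrable lborel {0..} (\<lambda>x::real. exp (- x\<^sup>2))" "(LBINT x:{0..}. exp (- x\<^sup>2)) = sqrt pi / 2"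
    using integrable.intros[OF gaussian_moment_0] has_bochner_integral_integral_eq[OF gaussian_moment_0]
    by (simp_all only: set_integrable_def set_lebesgue_integral_def)
  have "((\<lambda>z. LBINT x:{0..z}. exp (- x\<^sup>2)) \<longlongrightarrow> (LBINT x:{0::real..}. exp (- x\<^sup>2))) at_top"
    using tendsto_set_lebesgue_integral_at_top[OF _ i(1)] by simp
  moreover have "eventually (\<lambda>z. (LBINT x:{0..z}. exp (- x\<^sup>2)) = erf_primitive z) at_top"
    using eventually_ge_at_top[of 0]
    by eventually_elim (auto simp: erf_primitive_def interval_integral_Icc)
  ultimately show ?thesis unfolding i(2) by (rule Lim_transform_eventually)
qed

lemma erf_primitive_at_bot: "(erf_primitive \<longlongrightarrow> - (sqrt pi / 2)) at_bot"
  using tendsto_minus[OF erf_primitive_at_top] erf_primitive_minus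
  by (subst filterlim_at_bot_mirror) (simp add: erf_primitive_minus)

text \<open>Linear decay at the origin makes the extension by zero continuous there, as the
  fundamental theorem of calculus requires later.\<close>

lemma stable_kernel_0_le:
  assumes t: "t > 0"
  shows "\<exists>C. \<forall>r>0. stable_kernel 0 t r \<le> C * r"
proof -
  \<comment> \<open>The degree 5 comes from t / s^3 = y^5 s^2 / t^4 with y = t / s and s^2 =
    r.\<close>
  obtain C :: real where C: "C \<ge> 0" "\<And>y. \<bar>poly (monom 1 5) y\<bar> \<le> C * exp (1/4 * y\<^sup>2)"
    using poly_le_exp_square[of "1/4" "monom 1 5"] by auto
  have "stable_kernel 0 t r \<le> C / (2 * sqrt pi * t^4) * r" if r: "r > 0" for r
  proof -
    define s where "s = sqrt r"
    have s: "s > 0" "r = s^2" using r by (auto simp: s_def)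
    define y where "y = t / s"
    have "y > 0" using t s by (simp add: y_def)
    have "stable_kernel 0 t r = y ^ 5 * exp (- (1/4 * y^2)) / (2 * sqrt pi * t^4) * r"
      using r s(1) t unfolding stable_kernel_def y_def s_def by (simp add: power_divide field_simps eval_nat_numeral)
    also have "y ^ 5 \<le> C * exp (1/4*y^2)"
      using C(2)[of y] \<open>y > 0\<close> by (simp add: poly_monom)
    then have "y ^ 5 * exp (- (1/4 * y^2)) / (2 * sqrt pi * t^4) * r \<le> C * exp (1/4*y^2) * exp (- (1/4 * y^2)) / (2 * sqrt pi * t^4) * r"
      using r t by (intro mult_right_mono divide_right_mono) auto
    also have "\<dots> = C / (2 * sqrt pi * t^4) * r"
      by (simp add: exp_minus)
    finally show ?thesis .
  qed
  then show ?thesis by blast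
qed

lemma stable_kernel_isCont:
  assumes t: "t > 0"
  shows "isCont (stable_kernel 0 t) r"
proof (cases "r > 0")
  case True
  have "isCont (\<lambda>r. t / (2 * sqrt pi) * (exp (- (t\<^sup>2) / (4 * r)) / r powr (3 / 2))) r"
    using True by (intro continuous_intros) auto
  moreover have "eventually (\<lambda>x. t / (2 * sqrt pi) * (exp (- (t\<^sup>2) / (4 * x)) / x powr (3 / 2)) = stable_kernel 0 t x) (nhds r)"
    using eventually_nhds_in_open[of "{0<..}" r] True
    by (auto elim!: eventually_mono simp: stable_kernel_0)
  ultimately show ?thesis by (simp add: isCont_cong)
next
  case False
  obtain C where C: "\<And>r. r > 0 \<Longrightarrow> stable_kernel 0 t r \<le> C * r"
    using stable_kernel_0_le[OF t] by blast
  have C0: "C > 0"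
    using C[of 1] stable_kernel_0_pos[OF t, of 1] by simp
  have *: "norm (stable_kernel 0 t x) \<le> C * \<bar>x - r\<bar>" for x
  proof (cases "x > 0")
    case True
    have "norm (stable_kernel 0 t x) \<le> C * x"
      using C[OF True] stable_kernel_0_pos[OF t True] by simp
    also have "\<dots> \<le> C * \<bar>x - r\<bar>" using False C0 True by (intro mult_left_mono) auto
    finally show ?thesis .
  qed (use C0 in auto)
  have "((\<lambda>x. C * \<bar>x - r\<bar>) \<longlongrightarrow> C * \<bar>r - r\<bar>) (at r)"
    by (intro tendsto_intros)
  then have "((\<lambda>x. C * \<bar>x - r\<bar>) \<longlongrightarrow> 0) (at r)" by simp
  from Lim_null_comparison[OF always_eventually[OF allI[OF *]] this]
  have "(stable_kernel 0 t \<longlongrightarrow> 0) (at r)" .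
  then show ?thesis using False by (simp add: isCont_def)
qed

text \<open>The substitution t / (2 sqrt r) makes the density Gaussian, so that \<open>F\<close> is
  an explicit primitive, rising from -1 at the origin to 0 at infinity.\<close>

lemma stable_kernel_0_integral:
  assumes t: "t > 0"
  shows "has_bochner_integral lborel (stable_kernel 0 t) 1"
proof -
  define F where "F r = - (2 / sqrt pi) * erf_primitive (t / (2 * sqrt r))" for r
  have "filterlim (\<lambda>r::real. t / (2 * sqrt r)) at_top (at_right 0)"
    using t by (intro LIM_at_top_divide[where a=t])
      (auto intro!: tendsto_eq_intros eventually_at_right_less simp: eventually_at_right_less eventually_at_filter)
  then have l0: "(F \<longlongrightarrow> - (2 / sqrt pi) * (sqrt pi / 2)) (at_right 0)"
    unfolding F_def by (intro tendsto_intros filterlim_compose[OF erf_primitive_at_top])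
  have "((\<lambda>r. t / (2 * sqrt r)) \<longlongrightarrow> 0) at_top"
    by (intro real_tendsto_divide_at_top tendsto_const filterlim_tendsto_pos_mult_at_top[where c=2] sqrt_at_top) auto
  moreover have "isCont erf_primitive 0" "erf_primitive 0 = 0"
    using erf_primitive_deriv DERIV_isCont by (blast, simp add: erf_primitive_def)
  ultimately have "((\<lambda>r. erf_primitive (t / (2 * sqrt r))) \<longlongrightarrow> 0) at_top"
    using isCont_tendsto_compose[of 0 erf_primitive] by fastforce
  then have l1: "(F \<longlongrightarrow> 0) at_top"
    unfolding F_def using tendsto_mult_right_zero by blast
  have d: "(F has_real_derivative stable_kernel 0 t r) (at r)" if r: "r > 0" for r
  proof -
    have "((\<lambda>r. t / (2 * sqrt r)) has_real_derivative - (t / (4 * r * sqrt r))) (at r)"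
      using r by (auto intro!: derivative_eq_intros simp: field_simps)
    from DERIV_chain2[OF erf_primitive_deriv this]
    have "(F has_real_derivative - (2 / sqrt pi) * (exp (- ((t / (2 * sqrt r))\<^sup>2)) * (- (t / (4 * r * sqrt r))))) (at r)"
      unfolding F_def by (intro DERIV_cmult)
    also have "- (2 / sqrt pi) * (exp (- ((t / (2 * sqrt r))\<^sup>2)) * (- (t / (4 * r * sqrt r)))) = stable_kernel 0 t r"
      using r by (simp add: stable_kernel_def power_divide power_mult_distrib field_simps)
    finally show ?thesis .
  qed
  have c: "isCont (stable_kernel 0 t) r" for r
    using t by (rule stable_kernel_isCont)
  note * = interval_integral_FTC_nonneg[of 0 \<infinity> F "stable_kernel 0 t" "- (2 / sqrt pi) * (sqrt pi / 2)" 0]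
  have "set_integrable lborel (einterval 0 \<infinity>) (stable_kernel 0 t)"
    by (rule *) (use l0 l1 d c t in \<open>auto simp: ereal_tendsto_simps zero_ereal_def stable_kernel_0_nonneg\<close>)
  moreover have "interval_lebesgue_integral lborel 0 \<infinity> (stable_kernel 0 t) = 0 - (- (2 / sqrt pi) * (sqrt pi / 2))"
    by (rule *) (use l0 l1 d c t in \<open>auto simp: ereal_tendsto_simps zero_ereal_def stable_kernel_0_nonneg\<close>)
  moreover have "(\<lambda>r. indicat_real (einterval 0 \<infinity>) r *\<^sub>R stable_kernel 0 t r) = stable_kernel 0 t"
    by (auto simp: fun_eq_iff einterval_def indicator_def)
  ultimately show ?thesis
    by (simp add: has_bochner_integral_iff set_integrable_def interval_lebesgue_integral_def set_lebesgue_integral_def)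
qed

text \<open>The integrand has an explicit primitive: up to constants, the exponent is \<open>- y\<^sup>2\<close> as well as \<open>- z\<^sup>2\<close>
  for the functions \<open>y\<close> and \<open>z\<close> below, and the algebraic factor is a linear combination of \<open>y'\<close> and \<open>z'\<close>.\<close>

lemma stable_kernel_0_convolution:
  assumes t: "t > 0" and u: "u > 0"
  shows "has_bochner_integral lborel (\<lambda>r. stable_kernel 0 t r * stable_kernel 0 u (s - r)) (stable_kernel 0 (t + u) s)"
proof (cases "s > 0")
  case False
  then have "(\<lambda>r. stable_kernel 0 t r * stable_kernel 0 u (s - r)) = (\<lambda>_. 0)"
    by (intro ext) (metis diff_gt_0_iff_gt less_trans mult_eq_0_iff not_le stable_kernel_nonpos)
  then show ?thesis using False by (simp add: has_bochner_integral_zero)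
next
  case s: True
  define f where "f r = stable_kernel 0 t r * stable_kernel 0 u (s - r)" for r
  define y where "y r = (u * (sqrt r / sqrt (s - r)) - t * (sqrt (s - r) / sqrt r)) / (2 * sqrt s)" for r
  define z where "z r = (u * (sqrt r / sqrt (s - r)) + t * (sqrt (s - r) / sqrt r)) / (2 * sqrt s)" for r
  \<comment> \<open>\<open>A\<close> and \<open>B\<close> are determined by (A + B) u = 1 and (A -
    B) t = 1; this is what makes A y' + B z' the algebraic factor of the integrand.\<close>
  define A where "A = (1 / u + 1 / t) / 2"
  define B where "B = (1 / u - 1 / t) / 2"
  define ep where "ep = exp (- ((u + t)\<^sup>2) / (4 * s))"
  define em where "em = exp (- ((u - t)\<^sup>2) / (4 * s))"
  define K where "K = t * u / (pi * (s * sqrt s))"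
  define F where "F r = K * (A * (ep * erf_primitive (y r)) + B * (em * erf_primitive (z r)))" for r
  have d: "(F has_real_derivative f r) (at r)" if r: "0 < r" "r < s" for r
  proof -
    define q k m where "q = sqrt r" and "k = sqrt (s - r)" and "m = sqrt s"
    have q: "q > 0" "k > 0" "m > 0" "r = q^2" "s - r = k^2" "s = m^2" "m^2 = q^2 + k^2"
      using r s by (auto simp: q_def k_def m_def)
    have sk: "s = k^2 + q^2" using q(6,7) by simp
    have d1: "((\<lambda>r. sqrt r / sqrt (s - r)) has_real_derivative s / (2 * q * k^3)) (at r)"
    proof -
      have "((\<lambda>r. sqrt r / sqrt (s - r)) has_real_derivative (inverse q / 2 * k - q * (- (inverse k / 2))) / (k * k)) (at r)"
        using r q(1,2) by (auto intro!: derivative_eq_intros simp: q_def[symmetric] k_def[symmetric])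
      also have "(inverse q / 2 * k - q * (- (inverse k / 2))) / (k * k) = (k^2 + q^2) / (2 * q * k^3)"
        using q(1,2) by (simp add: field_simps power2_eq_square power3_eq_cube)
      also have "\<dots> = s / (2 * q * k^3)" using sk by simp
      finally show ?thesis .
    qed
    have d2: "((\<lambda>r. sqrt (s - r) / sqrt r) has_real_derivative - s / (2 * q^3 * k)) (at r)"
    proof -
      have "((\<lambda>r. sqrt (s - r) / sqrt r) has_real_derivative (- (inverse k / 2) * q - k * (inverse q / 2)) / (q * q)) (at r)"
        using r q(1,2) by (auto intro!: derivative_eq_intros simp: q_def[symmetric] k_def[symmetric])
      also have "(- (inverse k / 2) * q - k * (inverse q / 2)) / (q * q) = - (k^2 + q^2) / (2 * q^3 * k)"
        using q(1,2) by (simp add: field_simps power2_eq_square power3_eq_cube)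
      also have "\<dots> = - s / (2 * q^3 * k)" using sk by simp
      finally show ?thesis .
    qed
    have dy: "(y has_real_derivative (u * (s / (2 * q * k^3)) - t * (- s / (2 * q^3 * k))) / (2 * m)) (at r)"
      unfolding y_def m_def by (intro DERIV_cdivide DERIV_diff DERIV_cmult d1 d2)
    have dz: "(z has_real_derivative (u * (s / (2 * q * k^3)) + t * (- s / (2 * q^3 * k))) / (2 * m)) (at r)"
      unfolding z_def m_def by (intro DERIV_cdivide DERIV_add DERIV_cmult d1 d2)
    define e where "e = exp (- (t\<^sup>2) / (4 * r)) * exp (- (u\<^sup>2) / (4 * (s - r)))"
    \<comment> \<open>This is where s = r + (s - r) enters. It lets both squares, together with the
      constants in \<open>ep\<close> and \<open>em\<close>, produce one and the same
      exponent.\<close>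
    have sq: "u^2/k^2 + t^2/q^2 = (u^2 + t^2 + (u * (q/k))^2 + (t * (k/q))^2) / m^2"
      using q(1-3) unfolding q(7) by (simp add: divide_simps add_pos_pos power_mult_distrib power_divide)
         (simp add: algebra_simps power2_eq_square)
    have uv: "(u * (q/k)) * (t * (k/q)) = u * t"
      using q(1,2) by simp
    have yr: "y r = (u * (q/k) - t * (k/q)) / (2*m)" and zr: "z r = (u * (q/k) + t * (k/q)) / (2*m)"
      by (simp_all only: y_def z_def q_def k_def m_def)
    have ey: "ep * exp (- (y r)\<^sup>2) = e"
    proof -
      have "((u + t)\<^sup>2) / (4 * m^2) + ((u * (q/k) - t * (k/q)) / (2*m))\<^sup>2 = ((u^2 + t^2 + 2*(u*t)) + ((u * (q/k))^2 + (t * (k/q))^2 - 2*((u * (q/k)) * (t * (k/q))))) / (4*m^2)"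
        by (simp only: power_divide power2_sum power2_diff power_mult_distrib add_divide_distrib) (simp add: power2_eq_square)
      also have "\<dots> = (t\<^sup>2) / (4 * q^2) + (u\<^sup>2) / (4 * k^2)"
        unfolding uv using sq by (simp add: add_divide_distrib)
      finally have "- ((u + t)\<^sup>2) / (4 * s) + - (y r)\<^sup>2 = - (t\<^sup>2) / (4 * r) + - (u\<^sup>2) / (4 * (s - r))"
        unfolding yr q(5)
        unfolding q(4,6) minus_divide_left[symmetric] by linarith
      then show ?thesis by (simp add: ep_def e_def exp_add[symmetric])
    qed
    have ez: "em * exp (- (z r)\<^sup>2) = e"
    proof -
      have "((u - t)\<^sup>2) / (4 * m^2) + ((u * (q/k) + t * (k/q)) / (2*m))\<^sup>2 = ((u^2 + t^2 - 2*(u*t)) + ((u * (q/k))^2 + (t * (k/q))^2 + 2*((u * (q/k)) * (t * (k/q))))) / (4*m^2)"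
        by (simp only: power_divide power2_sum power2_diff power_mult_distrib add_divide_distrib diff_divide_distrib) (simp add: power2_eq_square)
      also have "\<dots> = (t\<^sup>2) / (4 * q^2) + (u\<^sup>2) / (4 * k^2)"
        unfolding uv using sq by (simp add: add_divide_distrib)
      finally have "- ((u - t)\<^sup>2) / (4 * s) + - (z r)\<^sup>2 = - (t\<^sup>2) / (4 * r) + - (u\<^sup>2) / (4 * (s - r))"
        unfolding zr q(5)
        unfolding q(4,6) minus_divide_left[symmetric] by linarith
      then show ?thesis by (simp add: em_def e_def exp_add[symmetric])
    qed
    define Y Z where "Y = (u * (s / (2 * q * k^3)) - t * (- s / (2 * q^3 * k))) / (2 * m)"
      and "Z = (u * (s / (2 * q * k^3)) + t * (- s / (2 * q^3 * k))) / (2 * m)"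
    have "(F has_real_derivative K * (A * (ep * (exp (- (y r)\<^sup>2) * Y)) + B * (em * (exp (- (z r)\<^sup>2) * Z)))) (at r)"
      unfolding F_def Y_def Z_def by (intro DERIV_cmult DERIV_add DERIV_chain2[OF erf_primitive_deriv] dy dz)
    also have "K * (A * (ep * (exp (- (y r)\<^sup>2) * Y)) + B * (em * (exp (- (z r)\<^sup>2) * Z))) = K * e * (A * Y + B * Z)"
      unfolding mult.assoc[of ep, symmetric] mult.assoc[of em, symmetric] ey ez by (simp add: algebra_simps)
    also have "A * Y + B * Z = m^3 / (4 * q^3 * k^3)"
    proof -
      have "A * Y + B * Z = ((A + B) * u * q^2 + (A - B) * t * k^2) * m / (4 * q^3 * k^3)"
        unfolding Y_def Z_def q(6) using q(1-3)
        by (simp add: divide_simps) (simp add: algebra_simps power2_eq_square power3_eq_cube)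
      also have "(A + B) * u = 1"
        using t u by (auto simp: A_def B_def field_simps)
      also have "(A - B) * t = 1"
        using t u by (auto simp: A_def B_def field_simps)
      finally show ?thesis using q(7) by (simp add: power2_eq_square power3_eq_cube algebra_simps)
    qed
    also have "K * e * (m^3 / (4 * q^3 * k^3)) = f r"
    proof -
      have "f r = t / (2 * sqrt pi) * (exp (- (t\<^sup>2) / (4 * r)) / q^3) * (u / (2 * sqrt pi) * (exp (- (u\<^sup>2) / (4 * (s - r))) / k^3))"
        using r unfolding f_def stable_kernel_def q_def k_def by (simp add: power3_eq_cube)
      also have "\<dots> = t * u / (4 * (sqrt pi * sqrt pi)) * e / (q^3 * k^3)"
        unfolding e_def times_divide_eq_left times_divide_eq_right divide_divide_eq_left times_divide_times_eq
        by (rule arg_cong2[where f="(/)"]; algebra)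
      also have "K = t * u / (pi * m^3)"
        using s unfolding K_def m_def by (simp add: power3_eq_cube)
      ultimately show ?thesis using q(3) by simp
    qed
    finally show ?thesis .
  qed
  have l0: "filterlim (\<lambda>r. sqrt (s - r) / sqrt r) at_top (at_right 0)"
    using s by (intro LIM_at_top_divide[where a="sqrt s"])
      (auto intro!: tendsto_eq_intros simp: eventually_at_filter)
  have l0': "((\<lambda>r. sqrt r / sqrt (s - r)) \<longlongrightarrow> 0) (at_right 0)"
    using s by (auto intro!: tendsto_eq_intros)
  have l1: "filterlim (\<lambda>r. sqrt r / sqrt (s - r)) at_top (at_left s)"
    using s by (intro LIM_at_top_divide[where a="sqrt s"])
      (auto intro!: tendsto_eq_intros simp: eventually_at_filter)
  have l1': "((\<lambda>r. sqrt (s - r) / sqrt r) \<longlongrightarrow> 0) (at_left s)"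
    using s by (auto intro!: tendsto_eq_intros)
  have pos: "0 < inverse (2 * sqrt s)" using s by simp
  have z0: "filterlim z at_top (at_right 0)"
    unfolding z_def divide_inverse[of _ "2 * sqrt s"]
    by (intro filterlim_at_top_mult_tendsto_pos[OF tendsto_const pos] filterlim_tendsto_add_at_top
       [OF tendsto_mult_right_zero[OF l0']] filterlim_tendsto_pos_mult_at_top[OF tendsto_const t l0])
  have z1: "filterlim z at_top (at_left s)"
    unfolding z_def divide_inverse[of _ "2 * sqrt s"] add.commute[of "u * _"]
    by (intro filterlim_at_top_mult_tendsto_pos[OF tendsto_const pos] filterlim_tendsto_add_at_top
       [OF tendsto_mult_right_zero[OF l1']] filterlim_tendsto_pos_mult_at_top[OF tendsto_const u l1])
  have y0: "filterlim (\<lambda>r. - y r) at_top (at_right 0)"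
  proof -
    have *: "(\<lambda>r. - y r) = (\<lambda>r. (- (u * (sqrt r / sqrt (s - r))) + t * (sqrt (s - r) / sqrt r)) * inverse (2 * sqrt s))"
      unfolding y_def divide_inverse[of _ "2 * sqrt s"] by (rule ext) (simp only: minus_mult_left minus_diff_eq, simp)
    show ?thesis unfolding *
      by (rule filterlim_at_top_mult_tendsto_pos[OF tendsto_const pos], rule filterlim_tendsto_add_at_top
       [OF tendsto_minus[OF tendsto_mult_right_zero[OF l0']]], rule filterlim_tendsto_pos_mult_at_top[OF tendsto_const t l0])
  qed
  have y1: "filterlim y at_top (at_left s)"
  proof -
    have *: "y = (\<lambda>r. (- (t * (sqrt (s - r) / sqrt r)) + u * (sqrt r / sqrt (s - r))) * inverse (2 * sqrt s))"
      unfolding y_def divide_inverse[of _ "2 * sqrt s"] by (rule ext) simp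
    show ?thesis unfolding *
      by (rule filterlim_at_top_mult_tendsto_pos[OF tendsto_const pos], rule filterlim_tendsto_add_at_top
       [OF tendsto_minus[OF tendsto_mult_right_zero[OF l1']]], rule filterlim_tendsto_pos_mult_at_top[OF tendsto_const u l1])
  qed
  have y0': "filterlim y at_bot (at_right 0)"
    using y0 by (simp add: filterlim_uminus_at_bot)
  \<comment> \<open>Between the two ends only \<open>y\<close> changes sign, whereas
    \<open>z\<close> tends to infinity at both; hence the \<open>B\<close> terms cancel in
    \<open>L1 - L0\<close>.\<close>
  define L0 where "L0 = K * (A * (ep * - (sqrt pi / 2)) + B * (em * (sqrt pi / 2)))"
  define L1 where "L1 = K * (A * (ep * (sqrt pi / 2)) + B * (em * (sqrt pi / 2)))"
  have F0: "(F \<longlongrightarrow> L0) (at_right 0)"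
    unfolding F_def L0_def
    by (intro tendsto_intros filterlim_compose[OF erf_primitive_at_bot y0'] filterlim_compose[OF erf_primitive_at_top z0])
  have F1: "(F \<longlongrightarrow> L1) (at_left s)"
    unfolding F_def L1_def
    by (intro tendsto_intros filterlim_compose[OF erf_primitive_at_top y1] filterlim_compose[OF erf_primitive_at_top z1])
  have c: "isCont f r" if "0 < r" "r < s" for r
    unfolding f_def using that
    by (intro isCont_mult stable_kernel_isCont isCont_o2[OF _ stable_kernel_isCont, of _ "\<lambda>r. s - r"] continuous_intros) (use t u in auto)
  note * = interval_integral_FTC_nonneg[of 0 "ereal s" F f L0 L1]
  have "set_integrable lborel (einterval 0 s) f"
    by (rule *) (use F0 F1 d c t u s in \<open>auto simp: ereal_tendsto_simps zero_ereal_def f_def stable_kernel_0_nonneg\<close>)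
  moreover have "interval_lebesgue_integral lborel 0 s f = L1 - L0"
    by (rule *) (use F0 F1 d c t u s in \<open>auto simp: ereal_tendsto_simps zero_ereal_def f_def stable_kernel_0_nonneg\<close>)
  moreover have "(\<lambda>r. indicat_real (einterval 0 s) r *\<^sub>R f r) = f"
    by (auto simp: fun_eq_iff einterval_def indicator_def f_def intro!: stable_kernel_nonpos)
  moreover have "L1 - L0 = stable_kernel 0 (t + u) s"
  proof -
    have "L1 - L0 = K * A * ep * sqrt pi"
      by (simp add: L1_def L0_def algebra_simps)
    also have "K * A = (t * u * (1/u + 1/t)) / (2 * pi * (s * sqrt s))"
      by (simp add: K_def A_def)
    also have "t * u * (1/u + 1/t) = t + u"
      using t u by (simp add: field_simps)
    also have "(t + u) / (2 * pi * (s * sqrt s)) * ep * sqrt pi = (t + u) * (sqrt pi / pi) / 2 * ep / (s * sqrt s)"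
      by (simp add: mult_ac)
    also have "sqrt pi / pi = 1 / sqrt pi"
      using real_divide_square_eq by (simp add: field_simps)
    also have "(t + u) * (1 / sqrt pi) / 2 * ep / (s * sqrt s) = (t + u) / (2 * sqrt pi) * ep / (s * sqrt s)"
      by simp
    also have "\<dots> = stable_kernel 0 (t + u) s"
      using s by (simp add: stable_kernel_def ep_def add.commute)
    finally show ?thesis .
  qed
  ultimately show ?thesis using s unfolding f_def[symmetric]
    by (simp add: has_bochner_integral_iff set_integrable_def interval_lebesgue_integral_def set_lebesgue_integral_def)
qed

section \<open>Averages over translations\<close>

lemma stable_kernel_0_compare:
  assumes "0 < a" "a \<le> b"
  shows "stable_kernel 0 b r \<le> b / a * stable_kernel 0 a r"
proof (cases "r \<le> 0")
  case False
  have "exp (- (b\<^sup>2) / (4 * r)) \<le> exp (- (a\<^sup>2) / (4 * r))"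
    using assms False by (simp add: divide_right_mono power_mono)
  then show ?thesis
    using assms False by (simp add: stable_kernel_0 divide_right_mono mult_left_mono)
qed simp

lemma stable_kernel_integrable:
  assumes t: "t > 0"
  shows "integrable lborel (stable_kernel j t)"
proof -
  obtain C where C: "\<And>r. \<bar>stable_kernel j t r\<bar> \<le> C / t ^ j * stable_kernel 0 (t / 2) r"
    using stable_kernel_bound[of j] t by blast
  show ?thesis
  proof (rule Bochner_Integration.integrable_bound)
    show "integrable lborel (\<lambda>r. C / t ^ j * stable_kernel 0 (t / 2) r)"
      using stable_kernel_0_integral[of "t/2"] t by (auto simp: has_bochner_integral_iff)
    show "AE r in lborel. norm (stable_kernel j t r) \<le> norm (C / t ^ j * stable_kernel 0 (t / 2) r)"
      using order_trans[OF C abs_ge_self] by (intro AE_I2) (simp only: real_norm_def)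
  qed simp
qed

lemma stable_kernel_L1:
  "\<exists>C\<ge>0. \<forall>t>0. (LBINT r. \<bar>stable_kernel j t r\<bar>) \<le> C / t ^ j"
proof -
  obtain C where C: "C \<ge> 0" "\<And>t r. t > 0 \<Longrightarrow> \<bar>stable_kernel j t r\<bar> \<le> C / t ^ j * stable_kernel 0 (t / 2) r"
    using stable_kernel_bound[of j] by blast
  have "(LBINT r. \<bar>stable_kernel j t r\<bar>) \<le> C / t ^ j" if t: "t > 0" for t
  proof -
    have "(LBINT r. \<bar>stable_kernel j t r\<bar>) \<le> (LBINT r. C / t ^ j * stable_kernel 0 (t / 2) r)"
      using C(2)[OF t] stable_kernel_integrable[OF t] stable_kernel_integrable[of "t/2"] t by (intro integral_mono) auto
    also have "\<dots> = C / t ^ j"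
      using stable_kernel_0_integral[of "t/2"] t by (simp add: has_bochner_integral_iff)
    finally show ?thesis .
  qed
  then show ?thesis using C by blast
qed

lemma integrable_bounded_mult:
  fixes h k :: "'a \<Rightarrow> real"
  assumes "integrable M k" "h \<in> borel_measurable M" "\<And>x. \<bar>h x\<bar> \<le> B"
  shows "integrable M (\<lambda>x. h x * k x)"
proof (rule Bochner_Integration.integrable_bound)
  show "integrable M (\<lambda>x. B * k x)" using assms by simp
  show "AE x in M. norm (h x * k x) \<le> norm (B * k x)"
    using order_trans[OF assms(3) abs_ge_self] by (auto simp: abs_mult intro!: mult_right_mono)
qed (use assms in auto)

lemma integral_bounded_mult_le:
  fixes h k :: "'a \<Rightarrow> real"
  assumes "integrable M k" "h \<in> borel_measurable M" "\<And>x. \<bar>h x\<bar> \<le> B"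
  shows "\<bar>LINT x|M. h x * k x\<bar> \<le> B * (LINT x|M. \<bar>k x\<bar>)"
proof -
  have "\<bar>LINT x|M. h x * k x\<bar> \<le> (LINT x|M. \<bar>h x * k x\<bar>)"
    by (rule integral_abs_bound)
  also have "\<dots> \<le> (LINT x|M. B * \<bar>k x\<bar>)"
    using assms integrable_bounded_mult[OF assms]
    by (intro integral_mono integrable_abs) (auto simp: abs_mult intro!: mult_right_mono)
  finally show ?thesis by simp
qed

text \<open>The mean value inequality, once for f' and once for f minus its tangent. The constant is
  not sharp; only the quadratic order matters.\<close>

lemma taylor_remainder_bound:
  fixes f :: "real \<Rightarrow> real"
  assumes f: "\<And>z. z \<in> closed_segment x y \<Longrightarrow> (f has_real_derivative f' z) (at z)"
    and f': "\<And>z. z \<in> closed_segment x y \<Longrightarrow> (f' has_real_derivative f'' z) (at z)"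
    and b: "\<And>z. z \<in> closed_segment x y \<Longrightarrow> \<bar>f'' z\<bar> \<le> K"
  shows "\<bar>f y - f x - (y - x) * f' x\<bar> \<le> K * (y - x)\<^sup>2"
proof -
  have K: "K \<ge> 0" using b[of x] by auto
  have *: "\<bar>f' z - f' x\<bar> \<le> K * \<bar>y - x\<bar>" if z: "z \<in> closed_segment x y" for z
  proof -
    have "norm (f' z - f' x) \<le> K * norm (z - x)"
      by (rule field_differentiable_bound[OF convex_closed_segment[of x y]])
         (use z b in \<open>auto intro: has_field_derivative_at_within f'\<close>)
    also have "\<dots> \<le> K * \<bar>y - x\<bar>"
      using z K by (intro mult_left_mono) (auto simp: closed_segment_eq_real_ivl split: if_splits)
    finally show ?thesis by simp
  qed
  have "norm ((f y - y * f' x) - (f x - x * f' x)) \<le> K * \<bar>y - x\<bar> * norm (y - x)"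
    by (rule field_differentiable_bound[OF convex_closed_segment[of x y], where f'="\<lambda>z. f' z - f' x"])
       (use * in \<open>auto intro!: derivative_eq_intros has_field_derivative_at_within[OF f]\<close>)
  then show ?thesis by (simp add: algebra_simps power2_eq_square abs_mult_self_eq flip: abs_mult)
qed

text \<open>Differentiation under the integral without any regularity of \<open>h\<close>: for times
  near t the second t-derivatives of the kernel are dominated by one multiple of
  \<open>stable_kernel 0 (t/4)\<close>, so the Taylor remainder is quadratic after
  integration.\<close>

lemma stable_kernel_integral_deriv:
  assumes t: "t > 0" and h: "h \<in> borel_measurable borel" "\<And>r. \<bar>h r\<bar> \<le> M"
  shows "((\<lambda>t. LBINT r. h r * stable_kernel j t r) has_real_derivative (LBINT r. h r * stable_kernel (Suc j) t r)) (at t)"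
proof -
  define F where "F t = (LBINT r. h r * stable_kernel j t r)" for t
  define D where "D = (LBINT r. h r * stable_kernel (Suc j) t r)"
  obtain C where C: "C \<ge> 0" "\<And>t r. t > 0 \<Longrightarrow> \<bar>stable_kernel (Suc (Suc j)) t r\<bar> \<le> C / t ^ Suc (Suc j) * stable_kernel 0 (t / 2) r"
    using stable_kernel_bound[of "Suc (Suc j)"] by blast
  \<comment> \<open>For t/2 < u < 2 t the time u/2 is at least t/4, and the comparison of kernels
    costs the factor (u/2) / (t/4), which is at most 4.\<close>
  define K where "K = C / (t/2) ^ Suc (Suc j) * 4"
  have K: "K \<ge> 0" using C t by (simp add: K_def)
  have M: "M \<ge> 0" using order_trans[OF abs_ge_zero h(2)] .
  have int: "integrable lborel (\<lambda>r. h r * stable_kernel j u r)" if "u > 0" for u j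
    using that h by (intro integrable_bounded_mult[where B=M] stable_kernel_integrable) auto
  have b: "\<bar>stable_kernel (Suc (Suc j)) u r\<bar> \<le> K * stable_kernel 0 (t/4) r" if u: "\<bar>u - t\<bar> < t/2" for u r
  proof -
    have u': "t/2 < u" "u < 2*t" using u t by (auto simp: abs_if split: if_splits)
    have "\<bar>stable_kernel (Suc (Suc j)) u r\<bar> \<le> C / u ^ Suc (Suc j) * stable_kernel 0 (u / 2) r"
      using C(2) u' t by auto
    also have "\<dots> \<le> C / (t/2) ^ Suc (Suc j) * (4 * stable_kernel 0 (t/4) r)"
    proof (rule mult_mono)
      show "C / u ^ Suc (Suc j) \<le> C / (t/2) ^ Suc (Suc j)"
        using u' t C(1) by (intro divide_left_mono power_mono mult_pos_pos zero_less_power) auto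
      have "stable_kernel 0 (u / 2) r \<le> (u/2) / (t/4) * stable_kernel 0 (t/4) r"
        using u' t by (intro stable_kernel_0_compare) auto
      also have "\<dots> \<le> 4 * stable_kernel 0 (t/4) r"
        using u' t by (intro mult_right_mono stable_kernel_0_nonneg) (auto simp: field_simps)
      finally show "stable_kernel 0 (u / 2) r \<le> 4 * stable_kernel 0 (t/4) r" .
    qed (use C t u' in \<open>auto intro!: stable_kernel_0_nonneg\<close>)
    finally show ?thesis by (simp add: K_def)
  qed
  have est: "\<bar>F u - F t - (u - t) * D\<bar> \<le> M * K * (u - t)\<^sup>2" if u: "\<bar>u - t\<bar> < t/2" for u
  proof -
    have u0: "u > 0" using u t by (auto simp: abs_if split: if_splits)
    define q where "q r = stable_kernel j u r - stable_kernel j t r - (u - t) * stable_kernel (Suc j) t r" for r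
    have qi: "integrable lborel q"
      unfolding q_def using stable_kernel_integrable t u0 by auto
    have "\<bar>q r\<bar> \<le> K * stable_kernel 0 (t/4) r * (u - t)\<^sup>2" for r
      unfolding q_def
    proof (rule taylor_remainder_bound)
      fix z assume "z \<in> closed_segment t u"
      then have z: "\<bar>z - t\<bar> < t/2"
        using u by (auto simp: closed_segment_eq_real_ivl abs_if split: if_splits)
      show "\<bar>stable_kernel (Suc (Suc j)) z r\<bar> \<le> K * stable_kernel 0 (t/4) r" by (rule b[OF z])
    qed (rule stable_kernel_deriv)+
    then have "(LBINT r. \<bar>q r\<bar>) \<le> (LBINT r. K * stable_kernel 0 (t/4) r * (u - t)\<^sup>2)"
      using qi stable_kernel_integrable[of "t/4" 0] t by (intro integral_mono) auto
    also have "\<dots> = K * (u - t)\<^sup>2"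
      using stable_kernel_0_integral[of "t/4"] t by (simp add: has_bochner_integral_iff)
    finally have q1: "(LBINT r. \<bar>q r\<bar>) \<le> K * (u - t)\<^sup>2" .
    have "F u - F t - (u - t) * D = (LBINT r. h r * q r)"
      unfolding F_def D_def q_def using int[OF t, of j] int[OF t, of "Suc j"] int[OF u0, of j] t u0 h
      by (simp add: algebra_simps mult.left_commute[of "h _"])
    also have "\<bar>\<dots>\<bar> \<le> M * (LBINT r. \<bar>q r\<bar>)"
      using qi h by (intro integral_bounded_mult_le) auto
    also have "\<dots> \<le> M * (K * (u - t)\<^sup>2)"
      using q1 M by (intro mult_left_mono)
    finally show ?thesis by (simp add: mult.assoc)
  qed
  have "((\<lambda>u. (F u - F t) / (u - t) - D) \<longlongrightarrow> 0) (at t)"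
  proof (rule Lim_null_comparison)
    have "eventually (\<lambda>u. \<bar>u - t\<bar> < t/2 \<and> u \<noteq> t) (at t)"
      unfolding eventually_at using t by (intro exI[of _ "t/2"]) (auto simp: dist_real_def)
    then show "eventually (\<lambda>u. norm ((F u - F t) / (u - t) - D) \<le> M * K * \<bar>u - t\<bar>) (at t)"
    proof eventually_elim
      case (elim u)
      have "norm ((F u - F t) / (u - t) - D) = \<bar>F u - F t - (u - t) * D\<bar> / \<bar>u - t\<bar>"
        using elim by (simp add: field_simps flip: abs_divide)
      also have "\<dots> \<le> M * K * (u - t)\<^sup>2 / \<bar>u - t\<bar>"
        using est elim by (intro divide_right_mono) auto
      also have "\<dots> = M * K * \<bar>u - t\<bar>"
      proof -
        have "(u - t)\<^sup>2 = \<bar>u - t\<bar> * \<bar>u - t\<bar>" by (metis abs_mult_self_eq power2_eq_square)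
        then show ?thesis using elim by (simp del: abs_mult_self_eq)
      qed
      finally show ?case .
    qed
    have "((\<lambda>u. M * K * \<bar>u - t\<bar>) \<longlongrightarrow> M * K * \<bar>t - t\<bar>) (at t)" by (intro tendsto_intros)
    then show "((\<lambda>u. M * K * \<bar>u - t\<bar>) \<longlongrightarrow> 0) (at t)" by simp
  qed
  then show ?thesis
    unfolding has_field_derivative_iff F_def[symmetric] D_def[symmetric] by (simp add: LIM_zero_iff)
qed

lemma Fubini_kernels:
  fixes g :: "real \<Rightarrow> real \<Rightarrow> real"
  assumes [measurable]: "case_prod g \<in> borel_measurable (borel \<Otimes>\<^sub>M borel)"
    and g: "\<And>r q. \<bar>g r q\<bar> \<le> M"
    and k: "integrable lborel k" "integrable lborel l"
  shows "(LBINT r. (LBINT q. g r q * k q) * l r) = (LBINT q. (LBINT r. g r q * l r) * k q)"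
proof -
  have [measurable]: "k \<in> borel_measurable borel" "l \<in> borel_measurable borel" using k by auto
  have g1: "g r \<in> borel_measurable borel" for r by measurable
  have M: "M \<ge> 0" using order_trans[OF abs_ge_zero g] .
  have "integrable (lborel \<Otimes>\<^sub>M lborel) (\<lambda>(r, q). g r q * k q * l r)"
  proof (rule lborel_pair.Fubini_integrable)
    show "(\<lambda>(r, q). g r q * k q * l r) \<in> borel_measurable (lborel \<Otimes>\<^sub>M lborel)" by measurable
    have "(LBINT q. norm (g r q * k q * l r)) \<le> M * (LBINT q. \<bar>k q\<bar>) * \<bar>l r\<bar>" for r
    proof -
      have "(LBINT q. norm (g r q * k q * l r)) = \<bar>LBINT q. \<bar>g r q\<bar> * \<bar>k q\<bar>\<bar> * \<bar>l r\<bar>"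
        by (simp add: abs_mult mult.assoc[symmetric] integral_nonneg_AE)
      also have "\<dots> \<le> M * (LBINT q. \<bar>\<bar>k q\<bar>\<bar>) * \<bar>l r\<bar>"
        using g k g1 by (intro mult_right_mono integral_bounded_mult_le) auto
      finally show ?thesis by simp
    qed
    then show "integrable lborel (\<lambda>r. LBINT q. norm (case (r, q) of (r, q) \<Rightarrow> g r q * k q * l r))"
      by (intro Bochner_Integration.integrable_bound[OF integrable_mult_right[OF integrable_abs[OF k(2)], of "M * (LBINT q. \<bar>k q\<bar>)"]])
         (auto simp: abs_mult M intro!: integral_nonneg_AE mult_nonneg_nonneg)
    show "AE r in lborel. integrable lborel (\<lambda>q. case (r, q) of (r, q) \<Rightarrow> g r q * k q * l r)"
      using integrable_bounded_mult[OF k(1) _ g] g1 by (auto intro!: AE_I2 integrable_mult_left)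
  qed
  from lborel_pair.Fubini_integral[OF this]
  have "(LBINT q. LBINT r. g r q * k q * l r) = (LBINT r. LBINT q. g r q * k q * l r)" by simp
  moreover have "(LBINT q. g r q * k q * l r) = (LBINT q. g r q * k q) * l r" for r by simp
  moreover have "(LBINT r. g r q * k q * l r) = (LBINT r. g r q * l r) * k q" for q
    by (subst integral_mult_left_zero[symmetric]) (simp add: mult_ac)
  ultimately show ?thesis by simp
qed

text \<open>The substitution x = r + q moves the coupling of the variables into the kernels. If
  \<open>g\<close> does not depend on its first argument, the inner integral is a convolution of
  \<open>k\<close> and \<open>l\<close>.\<close>

lemma Fubini_translate:
  fixes g :: "real \<Rightarrow> real \<Rightarrow> real"
  assumes [measurable]: "case_prod g \<in> borel_measurable (borel \<Otimes>\<^sub>M borel)"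
    and g: "\<And>r q. \<bar>g r q\<bar> \<le> M"
    and k: "integrable lborel k" "integrable lborel l"
  shows "(LBINT r. (LBINT q. g r (r + q) * k q) * l r) = (LBINT x. LBINT r. g r x * k (x - r) * l r)"
proof -
  have [measurable]: "k \<in> borel_measurable borel" "l \<in> borel_measurable borel" using k by auto
  have g1: "g r \<in> borel_measurable borel" for r by measurable
  have M: "M \<ge> 0" using order_trans[OF abs_ge_zero g] .
  have ki: "integrable lborel (\<lambda>x. k (x - r))" for r
    using lborel_integrable_real_affine[OF k(1), of 1 "-r"] by simp
  have kn: "(LBINT x. \<bar>k (x - r)\<bar>) = (LBINT x. \<bar>k x\<bar>)" for r
    using lborel_integral_real_affine[of 1 "\<lambda>x. \<bar>k x\<bar>" "-r"] by simp
  have "integrable (lborel \<Otimes>\<^sub>M lborel) (\<lambda>(r, x). g r x * k (x - r) * l r)"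
  proof (rule lborel_pair.Fubini_integrable)
    show "(\<lambda>(r, x). g r x * k (x - r) * l r) \<in> borel_measurable (lborel \<Otimes>\<^sub>M lborel)" by measurable
    have "(LBINT x. norm (g r x * k (x - r) * l r)) \<le> M * (LBINT q. \<bar>k q\<bar>) * \<bar>l r\<bar>" for r
    proof -
      have "(LBINT x. norm (g r x * k (x - r) * l r)) = \<bar>LBINT x. \<bar>g r x\<bar> * \<bar>k (x - r)\<bar>\<bar> * \<bar>l r\<bar>"
        by (simp add: abs_mult mult.assoc[symmetric] integral_nonneg_AE)
      also have "\<dots> \<le> M * (LBINT x. \<bar>\<bar>k (x - r)\<bar>\<bar>) * \<bar>l r\<bar>"
        using g ki g1 by (intro mult_right_mono integral_bounded_mult_le) auto
      finally show ?thesis by (simp add: kn)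
    qed
    then show "integrable lborel (\<lambda>r. LBINT x. norm (case (r, x) of (r, x) \<Rightarrow> g r x * k (x - r) * l r))"
      by (intro Bochner_Integration.integrable_bound[OF integrable_mult_right[OF integrable_abs[OF k(2)], of "M * (LBINT q. \<bar>k q\<bar>)"]])
         (auto simp: abs_mult M intro!: integral_nonneg_AE mult_nonneg_nonneg)
    show "AE r in lborel. integrable lborel (\<lambda>x. case (r, x) of (r, x) \<Rightarrow> g r x * k (x - r) * l r)"
      using integrable_bounded_mult[OF ki _ g] g1 by (auto intro!: AE_I2 integrable_mult_left)
  qed
  from lborel_pair.Fubini_integral[OF this]
  have a: "(LBINT x. LBINT r. g r x * k (x - r) * l r) = (LBINT r. LBINT x. g r x * k (x - r) * l r)" by simp
  have b: "(LBINT x. g r x * k (x - r) * l r) = (LBINT q. g r (r + q) * k q) * l r" for r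
    using lborel_integral_real_affine[of 1 "\<lambda>x. g r x * k (x - r)" r] by simp
  show ?thesis unfolding a b ..
qed

text \<open>When \<open>w\<close> is the orbit of f through x and s > 0, this is the j-th
  t-derivative of P_t T_s f at x.\<close>

definition stable_op :: "nat \<Rightarrow> (real \<Rightarrow> real) \<Rightarrow> real \<Rightarrow> real \<Rightarrow> real" where
  "stable_op j w t s = (LBINT r. w (s + r) * stable_kernel j t r)"

lemma stable_op_measurable [measurable]:
  assumes [measurable]: "w \<in> borel_measurable borel"
  shows "stable_op j w t \<in> borel_measurable borel"
  unfolding stable_op_def[abs_def] by measurable

lemma stable_op_deriv:
  assumes "t > 0" "w \<in> borel_measurable borel" "\<And>r. \<bar>w r\<bar> \<le> M"
  shows "((\<lambda>t. stable_op j w t s) has_real_derivative stable_op (Suc j) w t s) (at t)"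
  unfolding stable_op_def using assms by (intro stable_kernel_integral_deriv) auto

lemma stable_op_bound:
  "\<exists>C\<ge>0. \<forall>w M t s. t > 0 \<longrightarrow> w \<in> borel_measurable borel \<longrightarrow> (\<forall>r. \<bar>w r\<bar> \<le> M) \<longrightarrow>
     \<bar>stable_op j w t s\<bar> \<le> C * M / t ^ j"
proof -
  obtain C where C: "C \<ge> 0" "\<And>t. t > 0 \<Longrightarrow> (LBINT r. \<bar>stable_kernel j t r\<bar>) \<le> C / t ^ j"
    using stable_kernel_L1 by blast
  have "\<bar>stable_op j w t s\<bar> \<le> C * M / t ^ j" if "t > 0" "w \<in> borel_measurable borel" "\<forall>r. \<bar>w r\<bar> \<le> M" for w M t s
  proof -
    have M: "M \<ge> 0" using that(3) abs_ge_zero order_trans by blast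
    have "\<bar>stable_op j w t s\<bar> \<le> M * (LBINT r. \<bar>stable_kernel j t r\<bar>)"
      unfolding stable_op_def using that stable_kernel_integrable by (intro integral_bounded_mult_le) auto
    also have "\<dots> \<le> M * (C / t ^ j)"
      using C that M by (intro mult_left_mono) auto
    finally show ?thesis by (simp add: mult_ac)
  qed
  then show ?thesis using C(1) by blast
qed

lemma stable_op_0_bound:
  assumes "t > 0" "w \<in> borel_measurable borel" "\<And>r. \<bar>w r\<bar> \<le> M"
  shows "\<bar>stable_op 0 w t s\<bar> \<le> M"
proof -
  have "\<bar>stable_op 0 w t s\<bar> \<le> M * (LBINT r. \<bar>stable_kernel 0 t r\<bar>)"
    unfolding stable_op_def using assms stable_kernel_integrable by (intro integral_bounded_mult_le) auto
  then show ?thesis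
    using stable_kernel_0_integral[OF assms(1)] assms(1) by (simp add: stable_kernel_0_nonneg has_bochner_integral_iff)
qed

lemma stable_op_commute:
  assumes [measurable]: "w \<in> borel_measurable borel" and w: "\<And>r. \<bar>w r\<bar> \<le> M" and "t > 0" "u > 0"
  shows "stable_op m (stable_op j w t) u s = stable_op j (stable_op m w u) t s"
  using Fubini_kernels[of "\<lambda>r q. w (s + r + q)" M "stable_kernel j t" "stable_kernel m u"] w
    stable_kernel_integrable assms(3,4)
  by (simp add: stable_op_def add.assoc add.left_commute add.commute)

lemma stable_op_semigroup_0:
  assumes [measurable]: "w \<in> borel_measurable borel" and w: "\<And>r. \<bar>w r\<bar> \<le> M" and tu: "t > 0" "u > 0"
  shows "stable_op 0 w (t + u) s = stable_op 0 (stable_op 0 w t) u s"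
proof -
  have "stable_op 0 (stable_op 0 w t) u s = (LBINT x. LBINT r. w (s + x) * stable_kernel 0 t (x - r) * stable_kernel 0 u r)"
    using Fubini_translate[of "\<lambda>r x. w (s + x)" M "stable_kernel 0 t" "stable_kernel 0 u"] w
      stable_kernel_integrable tu by (simp add: stable_op_def add.assoc)
  moreover have "(LBINT r. w (s + x) * stable_kernel 0 t (x - r) * stable_kernel 0 u r) = w (s + x) * stable_kernel 0 (t + u) x" for x
  proof -
    have "(LBINT r. stable_kernel 0 t (x - r) * stable_kernel 0 u r) = stable_kernel 0 (t + u) x"
      using stable_kernel_0_convolution[of u t x] tu by (simp add: has_bochner_integral_iff mult.commute add.commute)
    then show ?thesis by (simp add: mult.assoc)
  qed
  ultimately show ?thesis by (simp add: stable_op_def)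
qed

text \<open>Differentiating an identity between functions of t any number of times. The function
  \<open>v\<close> is left open because the lemma is used for each of the two time
  variables.\<close>

lemma stable_op_semigroup_aux:
  assumes w: "w \<in> borel_measurable borel" "\<And>r. \<bar>w r\<bar> \<le> M" and v: "v \<in> borel_measurable borel" "\<And>r. \<bar>v r\<bar> \<le> M'"
    and u: "u > 0" and base: "\<And>t. t > 0 \<Longrightarrow> stable_op m w (t + u) s = stable_op 0 v t s" and t: "t > 0"
  shows "stable_op (j + m) w (t + u) s = stable_op j v t s"
  using t
proof (induction j arbitrary: t)
  case 0
  then show ?case using base by simp
next
  case (Suc j)
  have "((\<lambda>t. stable_op (j + m) w (t + u) s) has_real_derivative stable_op (Suc (j + m)) w (t + u) s) (at t)"
    using DERIV_shift[of "\<lambda>t. stable_op (j + m) w t s"  "stable_op (Suc (j + m)) w (t + u) s" t u] stable_op_deriv[OF _ w, of "t + u"] Suc.prems u by simp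
  then have "((\<lambda>t. stable_op j v t s) has_real_derivative stable_op (Suc (j + m)) w (t + u) s) (at t)"
    by (rule has_field_derivative_transform_within_open[of _ _ _ "{0<..}"]) (use Suc in auto)
  from DERIV_unique[OF this stable_op_deriv[OF Suc.prems v]] show ?case by simp
qed

lemma stable_op_semigroup:
  assumes w: "w \<in> borel_measurable borel" "\<And>r. \<bar>w r\<bar> \<le> M" and tu: "t > 0" "u > 0"
  shows "stable_op (j + m) w (t + u) s = stable_op j (stable_op m w u) t s"
proof -
  have [measurable]: "w \<in> borel_measurable borel" by fact
  obtain C where C: "\<And>r. \<bar>stable_op m w u r\<bar> \<le> C * M / u ^ m"
    using stable_op_bound[of m] w tu by blast
  \<comment> \<open>The order m is first produced in the variable u, starting from the semigroup law
    without derivatives; the order j is then produced in t.\<close>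
  have 1: "stable_op m w (u + t) s = stable_op m (stable_op 0 w t) u s" if "t > 0" for t
  proof -
    have "stable_op (m + 0) w (u + t) s = stable_op m (stable_op 0 w t) u s"
      by (rule stable_op_semigroup_aux[OF w _ stable_op_0_bound[OF that w]])
         (use stable_op_semigroup_0[OF w] stable_op_commute[OF w] that tu in \<open>auto simp: add.commute\<close>)
    then show ?thesis by simp
  qed
  show ?thesis
  proof (rule stable_op_semigroup_aux[OF w _ C])
    fix t :: real assume t: "t > 0"
    show "stable_op m w (t + u) s = stable_op 0 (stable_op m w u) t s"
      using 1[OF t] stable_op_commute[OF w t tu(2)] by (simp add: add.commute)
  qed (use tu in auto)
qed

text \<open>The equation behind subordination: the density has the Laplace transform exp (- t sqrt
  m) in r, so two t-derivatives multiply by m, exactly as one r-derivative does.\<close>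

lemma stable_kernel_0_deriv_space:
  assumes r: "r > 0"
  shows "((\<lambda>r. stable_kernel 0 t r) has_real_derivative stable_kernel 2 t r) (at r)"
proof -
  define s where "s = sqrt r"
  have s: "s > 0" "r = s^2" using r by (auto simp: s_def)
  have "((\<lambda>r. t / (2 * sqrt pi) * (exp (- (t\<^sup>2) / (4 * r)) / (r * sqrt r))) has_real_derivative
      t / (2 * sqrt pi) * ((exp (- (t\<^sup>2) / (4 * r)) * (t^2 / (4 * r^2)) * (r * s) - exp (- (t\<^sup>2) / (4 * r)) * (s + r * (inverse s / 2))) / ((r * s) * (r * s)))) (at r)"
    using r s(1) by (auto intro!: derivative_eq_intros simp: s_def[symmetric] power2_eq_square field_simps)
  also have "t / (2 * sqrt pi) * ((exp (- (t\<^sup>2) / (4 * r)) * (t^2 / (4 * r^2)) * (r * s) - exp (- (t\<^sup>2) / (4 * r)) * (s + r * (inverse s / 2))) / ((r * s) * (r * s)))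
     = stable_kernel 2 t r"
  proof -
    have sr: "sqrt r = s" "\<not> r \<le> 0" using r by (auto simp: s_def)
    define E where "E = exp (- (t\<^sup>2) / (4 * r))"
    have p: "poly (stable_poly 2) y = (- 3/2 * y + y^3 / 4) / (2 * sqrt pi)" for y
      by (simp add: numeral_2_eq_2 pderiv_pCons) (simp add: field_simps power3_eq_cube)
    have "stable_kernel 2 t r = ((- 3/2 * (t/s) + (t/s)^3 / 4) / (2 * sqrt pi)) * E / s^4"
      unfolding stable_kernel_def if_not_P[OF sr(2)] sr(1) E_def p by simp
    also have "\<dots> = t / (2 * sqrt pi) * ((E * (t^2 / (4 * r^2)) * (r * s) - E * (s + r * (inverse s / 2))) / ((r * s) * (r * s)))"
      using s(1) unfolding s(2) by (simp add: field_simps eval_nat_numeral)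
    finally show ?thesis unfolding E_def by simp
  qed
  finally show ?thesis
    by (rule has_field_derivative_transform_within_open[of _ _ _ "{0<..}"])
       (use r in \<open>auto simp: stable_kernel_def power3_eq_cube field_simps\<close>)
qed

text \<open>The integral falls on the kernel of order 2, which is an r-derivative and therefore
  telescopes; \<open>v\<close> need not be differentiable.\<close>

lemma stable_op_integral:
  assumes [measurable]: "v \<in> borel_measurable borel" and v: "\<And>r. \<bar>v r\<bar> \<le> M" and t: "t > 0" and ab: "a \<le> b"
  shows "(LBINT p:{a..b}. stable_op 2 v t (s + p)) = stable_op 0 v t (s + a) - stable_op 0 v t (s + b)"
proof -
  have 1: "(LBINT r. stable_kernel 2 t (x - r) * indicator {a..b} r) = stable_kernel 0 t (x - a) - stable_kernel 0 t (x - b)" for x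
  proof -
    have "((\<lambda>r. stable_kernel 2 t (x - r)) has_integral (- stable_kernel 0 t (x - b) - (- stable_kernel 0 t (x - a)))) {a..b}"
    \<comment> \<open>At r = x the two pieces of the kernel are glued. Only continuity is used
      there, and the theorem allows such an exceptional point.\<close>
    proof (rule fundamental_theorem_of_calculus_interior_strong[of "{x}"])
      show "continuous_on {a..b} (\<lambda>r. - stable_kernel 0 t (x - r))"
        by (intro continuous_at_imp_continuous_on ballI isCont_minus isCont_o2[OF _ stable_kernel_isCont[OF t], of _ "\<lambda>r. x - r"] continuous_intros)
      fix r assume r: "r \<in> {a<..<b} - {x}"
      show "((\<lambda>r. - stable_kernel 0 t (x - r)) has_vector_derivative stable_kernel 2 t (x - r)) (at r)"
      proof (cases "x - r > 0")
        case True
        have "((\<lambda>r. - stable_kernel 0 t (x - r)) has_real_derivative - (stable_kernel 2 t (x - r) * (0 - 1))) (at r)"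
          by (intro DERIV_minus DERIV_chain2[where f="stable_kernel 0 t" and g="\<lambda>r. x - r", OF stable_kernel_0_deriv_space[OF True]] DERIV_diff DERIV_const DERIV_ident)
        then show ?thesis by (simp add: has_real_derivative_iff_has_vector_derivative)
      next
        case False
        have "((\<lambda>r. - stable_kernel 0 t (x - r)) has_real_derivative 0) (at r)"
          by (rule has_field_derivative_transform_within_open[OF DERIV_const[of 0], of "{x<..}"]) (use r False in auto)
        then show ?thesis using False by (simp add: has_real_derivative_iff_has_vector_derivative)
      qed
    qed (use ab in auto)
    moreover have "set_integrable lborel {a..b} (\<lambda>r. stable_kernel 2 t (x - r))"
      using lborel_integrable_real_affine[OF stable_kernel_integrable[OF t, of 2], of "-1" x]
      by (auto simp: set_integrable_def intro!: integrable_mult_indicator[where f="\<lambda>r. stable_kernel 2 t (x - r)", simplified])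
    ultimately show ?thesis
      using set_borel_integral_eq_integral(2) by (force simp: set_lebesgue_integral_def mult.commute dest: integral_unique)
  qed
  have "(LBINT p:{a..b}. stable_op 2 v t (s + p)) = (LBINT p. (LBINT q. v (s + (p + q)) * stable_kernel 2 t q) * indicator {a..b} p)"
    by (simp add: set_lebesgue_integral_def stable_op_def mult.commute add.assoc)
  also have "\<dots> = (LBINT x. LBINT r. v (s + x) * stable_kernel 2 t (x - r) * indicator {a..b} r)"
    using v t stable_kernel_integrable ab by (intro Fubini_translate[where M=M]) auto
  also have "\<dots> = (LBINT x. v (s + x) * (stable_kernel 0 t (x - a) - stable_kernel 0 t (x - b)))"
    using 1 by (simp add: mult.assoc)
  also have "\<dots> = (LBINT x. v (s + x) * stable_kernel 0 t (x - a)) - (LBINT x. v (s + x) * stable_kernel 0 t (x - b))"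
  proof -
    have "integrable lborel (\<lambda>x. v (s + x) * stable_kernel 0 t (x - c))" for c
      using lborel_integrable_real_affine[OF stable_kernel_integrable[OF t, of 0], of 1 "-c"] v
      by (intro integrable_bounded_mult) auto
    then show ?thesis by (simp add: right_diff_distrib)
  qed
  moreover have "(LBINT x. v (s + x) * stable_kernel 0 t (x - c)) = stable_op 0 v t (s + c)" for c
    using lborel_integral_real_affine[of 1 "\<lambda>x. v (s + x) * stable_kernel 0 t (x - c)" c] by (simp add: stable_op_def add.assoc)
  ultimately show ?thesis by simp
qed

section \<open>Gamma averages and the gain of smoothness\<close>

text \<open>The one source of gamma integrals below: it normalises the gamma density, gives the
  exponential moments of the Laguerre weight and integrates the terms of the kernel series, where
  the scale is 1 - exp (- t).\<close>

lemma gamma_moment: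
  assumes a: "a > 0" and c: "c > (0::real)"
  shows "has_bochner_integral lborel (\<lambda>y. indicator {0<..} y * (y powr (a - 1) * exp (- (y / c)))) (Gamma a * c powr a)"
proof -
  define f where "f y = indicator {0<..} y * (y powr (a - 1) * exp (- y))" for y :: real
  have [measurable]: "f \<in> borel_measurable borel" unfolding f_def[abs_def] by measurable
  have "(\<integral>\<^sup>+t. ennreal (indicator {0..} t * t powr (a - 1) / exp t) \<partial>lborel) = (\<integral>\<^sup>+t. ennreal (f t) \<partial>lborel)"
    by (intro nn_integral_cong arg_cong[where f=ennreal]) (auto simp: f_def indicator_def exp_minus field_simps)
  then have "(\<integral>\<^sup>+t. ennreal (f t) \<partial>lborel) = ennreal (Gamma a)"
    using Gamma_conv_nn_integral_real[OF a] by simp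
  then have "has_bochner_integral lborel f (Gamma a)"
    using a by (intro has_bochner_integral_nn_integral) (auto simp: f_def)
  from lborel_has_bochner_integral_real_affine_iff[of "1/c" f "Gamma a" 0, THEN iffD1, OF _ this]
  have "has_bochner_integral lborel (\<lambda>y. f (y / c)) (c * Gamma a)" using c by simp
  then have "has_bochner_integral lborel (\<lambda>y. c powr (a - 1) * f (y / c)) (c powr (a - 1) * (c * Gamma a))"
    by (rule has_bochner_integral_mult_right)
  moreover have "c powr (a - 1) * (c * Gamma a) = Gamma a * c powr a"
    using c powr_add[of c "a - 1" 1] by (simp add: powr_one)
  moreover have "(\<lambda>y. c powr (a - 1) * f (y / c)) = (\<lambda>y. indicator {0<..} y * (y powr (a - 1) * exp (- (y / c))))"
    using c by (auto simp: fun_eq_iff f_def indicator_def powr_divide zero_less_divide_iff)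
  ultimately show ?thesis by simp
qed

definition gamma_density :: "real \<Rightarrow> real \<Rightarrow> real" where
  "gamma_density a r = (if r \<le> 0 then 0 else r powr (a - 1) * exp (- r) / Gamma a)"

lemma gamma_density_nonneg: "a > 0 \<Longrightarrow> gamma_density a r \<ge> 0"
  by (simp add: gamma_density_def Gamma_real_pos less_imp_le)

lemma gamma_density_nonpos [simp]: "r \<le> 0 \<Longrightarrow> gamma_density a r = 0"
  by (simp add: gamma_density_def)

lemma gamma_density_measurable [measurable]: "gamma_density a \<in> borel_measurable borel"
  unfolding gamma_density_def[abs_def] by measurable

text \<open>For a = l / 2 and m = |k| this value is the Bessel multiplier, since the semigroup acts
  on the k-th Laguerre polynomial by exp (- |k| s).\<close>

lemma gamma_density_laplace:
  assumes a: "a > 0" and m: "m \<ge> 0"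
  shows "has_bochner_integral lborel (\<lambda>r. gamma_density a r * exp (- (m * r))) ((1 + m) powr (- a))"
proof -
  have "has_bochner_integral lborel (\<lambda>y. 1 / Gamma a * (indicator {0<..} y * (y powr (a - 1) * exp (- (y / (1 / (1 + m)))))))
     (1 / Gamma a * (Gamma a * (1 / (1 + m)) powr a))"
    using a m by (intro has_bochner_integral_mult_right gamma_moment) auto
  moreover have "(\<lambda>y. 1 / Gamma a * (indicator {0<..} y * (y powr (a - 1) * exp (- (y / (1 / (1 + m))))))) = (\<lambda>r. gamma_density a r * exp (- (m * r)))"
  proof -
    have "exp (- (y * (1 + m))) = exp (- y) * exp (- (m * y))" for y
      by (simp add: exp_add[symmetric] algebra_simps)
    then show ?thesis by (auto simp: fun_eq_iff gamma_density_def indicator_def)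
  qed
  moreover have "1 / Gamma a * (Gamma a * (1 / (1 + m)) powr a) = (1 + m) powr (- a)"
    using Gamma_real_pos[OF a] m by (simp add: powr_divide powr_minus field_simps)
  ultimately show ?thesis by simp
qed

lemma gamma_density_integral: "a > 0 \<Longrightarrow> has_bochner_integral lborel (gamma_density a) 1"
  using gamma_density_laplace[of a 0] by simp

lemma gamma_density_integrable: "a > 0 \<Longrightarrow> integrable lborel (gamma_density a)"
  using gamma_density_integral by (auto simp: has_bochner_integral_iff)

text \<open>Scaling r = s t leaves a Beta integral. This is the law (I + L)^(-a) (I + L)^(-b) = (I +
  L)^(-a-b), by which the potential splits into pieces.\<close>

lemma gamma_density_convolution:
  assumes a: "a > 0" and b: "b > 0"
  shows "(LBINT r. gamma_density a (s - r) * gamma_density b r) = gamma_density (a + b) s"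
proof (cases "s > 0")
  case False
  then have "gamma_density a (s - r) * gamma_density b r = 0" for r
    by (cases "r \<le> 0") auto
  then have z: "(\<lambda>r. gamma_density a (s - r) * gamma_density b r) = (\<lambda>_. 0)" by auto
  show ?thesis unfolding z using False by simp
next
  case s: True
  define f where "f t = indicator {0..1} t * (t powr (b - 1) * (1 - t) powr (a - 1))" for t :: real
  have "((\<lambda>t. t powr (b - 1) * (1 - t) powr (a - 1)) has_integral Beta b a) {0..1}"
    by (rule has_integral_Beta_real[OF b a])
  then have B: "(LBINT t. f t) = Beta b a"
    using set_borel_integral_eq_integral(2)[OF integrable_Beta[OF b a]]
    by (simp add: f_def set_lebesgue_integral_def integral_unique)
  have "(LBINT r. gamma_density a (s - r) * gamma_density b r) = s * (LBINT t. gamma_density a (s - s * t) * gamma_density b (s * t))"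
    using lborel_integral_real_affine[of s "\<lambda>r. gamma_density a (s - r) * gamma_density b r" 0] s by simp
  also have "(LBINT t. gamma_density a (s - s * t) * gamma_density b (s * t)) = (LBINT t. s powr (a + b - 2) * exp (- s) / (Gamma a * Gamma b) * f t)"
  proof (rule Bochner_Integration.integral_cong_AE)
    have "AE t in lborel. t \<noteq> 0 \<and> t \<noteq> (1::real)"
      using AE_lborel_singleton[of "0::real"] AE_lborel_singleton[of "1::real"] by eventually_elim auto
    then show "AE t in lborel. gamma_density a (s - s * t) * gamma_density b (s * t) = s powr (a + b - 2) * exp (- s) / (Gamma a * Gamma b) * f t"
    proof eventually_elim
      case (elim t)
      show ?case
      proof (cases "0 < t \<and> t < 1")
        case True
        have e: "s - s * t = s * (1 - t)" by (simp add: algebra_simps)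
        have p: "s * (1 - t) > 0" "s * t > 0" using s True by auto
        have "gamma_density a (s - s * t) * gamma_density b (s * t) =
          (s powr (a - 1) * s powr (b - 1)) * (exp (- (s * (1 - t))) * exp (- (s * t))) / (Gamma a * Gamma b) * (t powr (b - 1) * (1 - t) powr (a - 1))"
          unfolding e gamma_density_def if_not_P[OF p(1)[unfolded not_le[symmetric]]] if_not_P[OF p(2)[unfolded not_le[symmetric]]]
          using s True by (simp add: powr_mult)
        also have "s powr (a - 1) * s powr (b - 1) = s powr (a + b - 2)"
          by (simp add: powr_add[symmetric] algebra_simps)
        also have "exp (- (s * (1 - t))) * exp (- (s * t)) = exp (- s)"
          by (simp add: exp_add[symmetric] algebra_simps)
        finally show ?thesis using True by (simp add: f_def)
      next
        case False
        then have "t < 0 \<or> t > 1" using elim by auto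
        then have "s * t \<le> 0 \<or> s - s * t \<le> 0"
          using s by (auto simp: mult_le_0_iff)
        then show ?thesis using \<open>t < 0 \<or> t > 1\<close> by (auto simp: f_def)
      qed
    qed
  qed (auto simp: f_def)
  also have "s * (LBINT t. s powr (a + b - 2) * exp (- s) / (Gamma a * Gamma b) * f t) = gamma_density (a + b) s"
  proof -
    have "s * s powr (a + b - 2) = s powr (a + b - 1)"
      using s powr_add[of s 1 "a + b - 2"] by simp
    then show ?thesis
      using s Gamma_real_pos[OF a] Gamma_real_pos[OF b]
      by (simp add: B Beta_def gamma_density_def not_le mult.assoc[symmetric]) (simp add: add.commute)
  qed
  finally show ?thesis .
qed

text \<open>Translation along an orbit is the heat semigroup, so on orbits this is (I +
  L)^(-a).\<close>

definition gamma_op :: "real \<Rightarrow> (real \<Rightarrow> real) \<Rightarrow> real \<Rightarrow> real" where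
  "gamma_op a w s = (LBINT r. w (s + r) * gamma_density a r)"

lemma gamma_op_measurable [measurable]:
  assumes [measurable]: "w \<in> borel_measurable borel"
  shows "gamma_op a w \<in> borel_measurable borel"
  unfolding gamma_op_def[abs_def] by measurable

lemma gamma_op_bound:
  assumes "a > 0" "w \<in> borel_measurable borel" "\<And>r. \<bar>w r\<bar> \<le> M"
  shows "\<bar>gamma_op a w s\<bar> \<le> M"
proof -
  have "\<bar>gamma_op a w s\<bar> \<le> M * (LBINT r. \<bar>gamma_density a r\<bar>)"
    unfolding gamma_op_def using assms gamma_density_integrable by (intro integral_bounded_mult_le) auto
  then show ?thesis
    using gamma_density_integral[OF assms(1)] assms(1) by (simp add: gamma_density_nonneg has_bochner_integral_iff)
qed

lemma stable_op_gamma_op: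
  assumes [measurable]: "w \<in> borel_measurable borel" and w: "\<And>r. \<bar>w r\<bar> \<le> M" and "t > 0" "a > 0"
  shows "stable_op j (gamma_op a w) t s = gamma_op a (stable_op j w t) s"
  using Fubini_kernels[of "\<lambda>r q. w (s + r + q)" M "gamma_density a" "stable_kernel j t"] w
    stable_kernel_integrable gamma_density_integrable assms(3,4)
  by (simp add: stable_op_def gamma_op_def add.assoc add.left_commute add.commute)

lemma gamma_op_gamma_op:
  assumes [measurable]: "w \<in> borel_measurable borel" and w: "\<And>r. \<bar>w r\<bar> \<le> M" and ab: "a > 0" "b > 0"
  shows "gamma_op b (gamma_op a w) s = gamma_op (a + b) w s"
proof -
  have "gamma_op b (gamma_op a w) s = (LBINT x. LBINT r. w (s + x) * gamma_density a (x - r) * gamma_density b r)"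
    using Fubini_translate[of "\<lambda>r x. w (s + x)" M "gamma_density a" "gamma_density b"] w
      gamma_density_integrable ab by (simp add: gamma_op_def add.assoc)
  also have "\<dots> = (LBINT x. w (s + x) * (LBINT r. gamma_density a (x - r) * gamma_density b r))"
    by (simp add: mult.assoc)
  finally show ?thesis by (simp add: gamma_density_convolution ab gamma_op_def)
qed

section \<open>A gamma average of shape a gains the power \<open>2 * a\<close> of t\<close>

lemma gamma_density_le:
  assumes "a > 0" "r > 0"
  shows "gamma_density a r \<le> r powr (a - 1) / Gamma a"
  using assms Gamma_real_pos[of a] by (simp add: gamma_density_def divide_right_mono mult_left_le)

lemma gamma_density_antimono:
  assumes "0 < a" "a < 1" "0 < x" "x \<le> y"
  shows "gamma_density a y \<le> gamma_density a x"
proof -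
  have "y powr (a - 1) * exp (- y) \<le> x powr (a - 1) * exp (- x)"
    using assms by (intro mult_mono powr_mono2') auto
  then show ?thesis
    using assms Gamma_real_pos[of a] by (simp add: gamma_density_def divide_right_mono)
qed

text \<open>Since \<open>v\<close> is bounded by \<open>B\<close>, its image under \<open>stable_op 2\<close> is small in two senses: it is
  bounded by \<open>B / t\<^sup>2\<close>, and its integral over any interval is bounded by \<open>2 B\<close>. The first bound is used
  for the part of the gamma density on \<open>[0, t\<^sup>2]\<close>, the second one together with the monotonicity
  of the density on the rest.\<close>

lemma gamma_op_stable_op_2_bound:
  assumes a: "0 < a" "a < 1"
  shows "\<exists>C\<ge>0. \<forall>v B t s. t > 0 \<longrightarrow> v \<in> borel_measurable borel \<longrightarrow> (\<forall>r. \<bar>v r\<bar> \<le> B) \<longrightarrow>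
     \<bar>gamma_op a (stable_op 2 v t) s\<bar> \<le> C * B * t powr (2 * a - 2)"
proof -
  obtain K where K: "K \<ge> 0" "\<And>w M t s. t > 0 \<Longrightarrow> w \<in> borel_measurable borel \<Longrightarrow> (\<forall>r. \<bar>w r\<bar> \<le> M) \<Longrightarrow>
     \<bar>stable_op 2 w t s\<bar> \<le> K * M / t ^ 2"
    using stable_op_bound[of 2] by blast
  define C where "C = K / (a * Gamma a) + 4 / Gamma a"
  have G: "Gamma a > 0" using a by (simp add: Gamma_real_pos)
  have C: "C \<ge> 0" using K a G by (simp add: C_def)
  have "\<bar>gamma_op a (stable_op 2 v t) s\<bar> \<le> C * B * t powr (2 * a - 2)"
    if t: "t > 0" and v[measurable]: "v \<in> borel_measurable borel" and vB: "\<forall>r. \<bar>v r\<bar> \<le> B" for v B t s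
  proof -
    have B: "B \<ge> 0" using vB abs_ge_zero order_trans by blast
    define Y where "Y p = stable_op 2 v t (s + p)" for p
    have Ym[measurable]: "Y \<in> borel_measurable borel" unfolding Y_def[abs_def] by measurable
    have Yb: "\<bar>Y p\<bar> \<le> K * B / t ^ 2" for p unfolding Y_def using K(2)[OF t v vB] .
    \<comment> \<open>At this cut the two estimates balance: K B c^a / t^2 from the left part and B
      c^(a - 1) from the right part are both multiples of t^(2a - 2).\<close>
    define c where "c = t\<^sup>2"
    have c: "c > 0" using t by (simp add: c_def)
    have cp: "c powr x = t powr (2 * x)" for x
      using t by (simp add: c_def powr_powr powr_numeral[symmetric] del: powr_numeral)
    have gi: "integrable lborel (\<lambda>p. Y p * gamma_density a p)"
      using Yb by (intro integrable_bounded_mult gamma_density_integrable a) auto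
    have split: "gamma_op a (stable_op 2 v t) s = (LBINT p:{..c}. Y p * gamma_density a p) + (LBINT p:{c<..}. Y p * gamma_density a p)"
    proof -
      have "gamma_op a (stable_op 2 v t) s = (LBINT p:{..c} \<union> {c<..}. Y p * gamma_density a p)"
      proof -
        have "{..c} \<union> {c<..} = UNIV" by auto
        then show ?thesis by (simp add: gamma_op_def Y_def set_lebesgue_integral_def)
      qed
      also have "\<dots> = (LBINT p:{..c}. Y p * gamma_density a p) + (LBINT p:{c<..}. Y p * gamma_density a p)"
        using gi by (intro set_integral_Un) (auto simp: set_integrable_def intro!: integrable_mult_indicator[where 'b=real, simplified])
      finally show ?thesis .
    qed
    have first: "\<bar>LBINT p:{..c}. Y p * gamma_density a p\<bar> \<le> K / (a * Gamma a) * B * t powr (2 * a - 2)"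
    proof -
      have pi: "has_bochner_integral lborel (\<lambda>p. indicator {0..c} p * p powr (a - 1)) (c powr a / a)"
      proof (rule has_bochner_integral_nn_integral)
        have "((\<lambda>x. x powr (a - 1)) has_integral (c powr (a - 1 + 1) / (a - 1 + 1))) {0..c}"
          using a c by (intro has_integral_powr_from_0) auto
        from nn_integral_has_integral_lebesgue[OF _ this]
        show "(\<integral>\<^sup>+x. ennreal (indicator {0..c} x * x powr (a - 1)) \<partial>lborel) = ennreal (c powr a / a)" by simp
      qed (use a c in auto)
      have "\<bar>LBINT p:{..c}. Y p * gamma_density a p\<bar> = \<bar>LBINT p. Y p * (indicator {..c} p * gamma_density a p)\<bar>"
        by (simp add: set_lebesgue_integral_def mult_ac)
      also have "\<dots> \<le> K * B / t^2 * (LBINT p. \<bar>indicator {..c} p * gamma_density a p\<bar>)"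
        using Yb a gamma_density_integrable[of a] by (intro integral_bounded_mult_le) (auto intro!: integrable_mult_indicator[where 'b=real, simplified])
      also have "(LBINT p. \<bar>indicator {..c} p * gamma_density a p\<bar>) \<le> (LBINT p. indicator {0..c} p * p powr (a - 1) / Gamma a)"
      proof (rule integral_mono)
        show "\<bar>indicator {..c} p * gamma_density a p\<bar> \<le> indicator {0..c} p * p powr (a - 1) / Gamma a" for p
          using gamma_density_le[OF a(1), of p] gamma_density_nonneg[OF a(1), of p] G
          by (cases "p \<le> 0") (auto simp: indicator_def)
      qed (use pi a gamma_density_integrable[of a] in \<open>auto simp: has_bochner_integral_iff intro!: integrable_abs integrable_mult_indicator[where 'b=real, simplified]\<close>)
      also have "\<dots> = c powr a / a / Gamma a"
        using pi by (simp add: has_bochner_integral_iff)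
      also have "K * B / t^2 * (c powr a / a / Gamma a) = K / (a * Gamma a) * B * (c powr a / c)"
        by (simp add: c_def field_simps)
      also have "c powr a / c = t powr (2 * a - 2)"
        using cp[of "a - 1"] c by (simp add: powr_diff algebra_simps)
      finally show ?thesis using K B t by (simp add: mult_left_mono divide_right_mono)
    qed
    have YI: "\<bar>integral {x..y} Y\<bar> \<le> 2 * B" "Y integrable_on {x..y}" if "x \<le> y" for x y
    proof -
      have si: "set_integrable lborel {x..y} Y"
      proof -
        have "integrable lborel (indicator {x..y} :: real \<Rightarrow> real)" by (intro integrable_real_indicator) (auto simp: emeasure_lborel_Icc_eq)
        from integrable_bounded_mult[OF this _ Yb] show ?thesis
          unfolding set_integrable_def by (simp add: mult.commute)
      qed
      then show "Y integrable_on {x..y}" by (rule set_borel_integral_eq_integral(1))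
      have "integral {x..y} Y = stable_op 0 v t (s + x) - stable_op 0 v t (s + y)"
        using set_borel_integral_eq_integral(2)[OF si] stable_op_integral[OF v _ t that, of B s] vB by (simp add: Y_def)
      then show "\<bar>integral {x..y} Y\<bar> \<le> 2 * B"
        using stable_op_0_bound[OF t v, of B "s + x"] stable_op_0_bound[OF t v, of B "s + y"] vB by (simp add: abs_le_iff)
    qed
    have second_R: "\<bar>LBINT p:{c..R}. Y p * gamma_density a p\<bar> \<le> 4 * B * gamma_density a c" if R: "c \<le> R" for R
    proof -
      \<comment> \<open>The sign turns the decreasing density into a nondecreasing weight, the form
        in which the second mean value theorem is stated. Each of the two resulting integrals of
        \<open>Y\<close> is at most 2 B, and each weight is at most the density at c.\<close>
      obtain z where z: "z \<in> {c..R}" and zi: "((\<lambda>x. (- gamma_density a x) * Y x) has_integral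
           (- gamma_density a c) * integral {c..z} Y + (- gamma_density a R) * integral {z..R} Y) {c..R}"
      proof (rule second_mean_value_theorem_full[OF YI(2)[OF R] R, of "\<lambda>x. - gamma_density a x"])
        show "- gamma_density a x \<le> - gamma_density a y" if "c \<le> x" "x \<le> y" for x y
          using gamma_density_antimono[OF a, of x y] c that by simp
      qed
      have "set_integrable lborel {c..R} (\<lambda>p. Y p * gamma_density a p)"
        using gi by (auto simp: set_integrable_def intro!: integrable_mult_indicator[where 'b=real, simplified])
      then have "(LBINT p:{c..R}. Y p * gamma_density a p) = integral {c..R} (\<lambda>p. Y p * gamma_density a p)"
        by (rule set_borel_integral_eq_integral(2))
      also have "\<dots> = gamma_density a c * integral {c..z} Y + gamma_density a R * integral {z..R} Y"
        using has_integral_neg[OF zi] by (intro integral_unique) (simp add: mult.commute add.commute)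
      also have "\<bar>\<dots>\<bar> \<le> gamma_density a c * (2 * B) + gamma_density a c * (2 * B)"
      proof -
        have "\<bar>gamma_density a c * integral {c..z} Y\<bar> \<le> gamma_density a c * (2 * B)"
          unfolding abs_mult using YI(1)[of c z] z gamma_density_nonneg[OF a(1)] by (intro mult_mono) auto
        moreover have "\<bar>gamma_density a R * integral {z..R} Y\<bar> \<le> gamma_density a c * (2 * B)"
          unfolding abs_mult using YI(1)[of z R] z gamma_density_nonneg[OF a(1)] gamma_density_antimono[OF a c R] by (intro mult_mono) auto
        ultimately show ?thesis by linarith
      qed
      finally show ?thesis by (simp add: mult_ac)
    qed
    have second: "\<bar>LBINT p:{c<..}. Y p * gamma_density a p\<bar> \<le> 4 / Gamma a * B * t powr (2 * a - 2)"
    proof -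
      have "((\<lambda>R. \<bar>LBINT p:{c..R}. Y p * gamma_density a p\<bar>) \<longlongrightarrow> \<bar>LBINT p:{c..}. Y p * gamma_density a p\<bar>) at_top"
        using gi by (intro tendsto_rabs tendsto_set_lebesgue_integral_at_top)
          (auto simp: set_integrable_def intro!: integrable_mult_indicator[where 'b=real, simplified])
      then have "\<bar>LBINT p:{c..}. Y p * gamma_density a p\<bar> \<le> 4 * B * gamma_density a c"
        by (rule tendsto_upperbound) (auto intro!: eventually_mono[OF eventually_ge_at_top[of c] second_R])
      also have "\<dots> \<le> 4 * B * (c powr (a - 1) / Gamma a)"
        using gamma_density_le[OF a(1) c] B by (intro mult_left_mono) auto
      also have "\<dots> = 4 / Gamma a * B * t powr (2 * a - 2)"
        by (simp add: cp algebra_simps)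
      also have "(LBINT p:{c..}. Y p * gamma_density a p) = (LBINT p:{c<..}. Y p * gamma_density a p)"
      proof -
        have "AE p in lborel. p \<noteq> c" by (rule AE_lborel_singleton)
        then show ?thesis unfolding set_lebesgue_integral_def
          by (intro Bochner_Integration.integral_cong_AE) (auto simp: indicator_def elim!: eventually_mono)
      qed
      finally show ?thesis .
    qed
    have "\<bar>gamma_op a (stable_op 2 v t) s\<bar> \<le> K / (a * Gamma a) * B * t powr (2 * a - 2) + 4 / Gamma a * B * t powr (2 * a - 2)"
      unfolding split using first second by linarith
    also have "\<dots> = C * B * t powr (2 * a - 2)" by (simp add: C_def algebra_simps)
    finally show ?thesis .
  qed
  then show ?thesis using C by blast
qed

text \<open>The time 2 t is divided equally: one half carries the N derivatives of the hypothesis,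
  the other half the two derivatives that the gamma average smooths.\<close>

lemma gamma_op_gain_step:
  assumes a: "0 < a" "a < 1"
  shows "\<exists>C\<ge>0. \<forall>w M N A t s. t > 0 \<longrightarrow> w \<in> borel_measurable borel \<longrightarrow> (\<forall>r. \<bar>w r\<bar> \<le> M) \<longrightarrow>
     (\<forall>s>0. \<bar>stable_op N w t s\<bar> \<le> A) \<longrightarrow> s \<ge> 0 \<longrightarrow>
     \<bar>stable_op (N + 2) (gamma_op a w) (2 * t) s\<bar> \<le> C * A * t powr (2 * a - 2)"
proof -
  obtain C where C: "C \<ge> 0" "\<And>v B t s. t > 0 \<Longrightarrow> v \<in> borel_measurable borel \<Longrightarrow> (\<forall>r. \<bar>v r\<bar> \<le> B) \<Longrightarrow>
     \<bar>gamma_op a (stable_op 2 v t) s\<bar> \<le> C * B * t powr (2 * a - 2)"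
    using gamma_op_stable_op_2_bound[OF a] by blast
  have "\<bar>stable_op (N + 2) (gamma_op a w) (2 * t) s\<bar> \<le> C * A * t powr (2 * a - 2)"
    if t: "t > 0" and w[measurable]: "w \<in> borel_measurable borel" and wM: "\<forall>r. \<bar>w r\<bar> \<le> M"
      and A: "\<forall>s>0. \<bar>stable_op N w t s\<bar> \<le> A" and s: "s \<ge> 0" for w M N A t s
  proof -
    \<comment> \<open>The hypothesis speaks of s > 0 only, whereas the smoothing estimate asks for a
      bound on the whole line. Cutting off is harmless, since both kernels charge only positive
      displacements from s \<ge> 0.\<close>
    define v where "v p = (if p > 0 then stable_op N w t p else 0)" for p
    have [measurable]: "v \<in> borel_measurable borel" unfolding v_def[abs_def] by measurable
    have "A \<ge> 0" using A[rule_format, of 1] by simp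
    then have vA: "\<forall>r. \<bar>v r\<bar> \<le> A" using A by (simp add: v_def)
    have "stable_op (N + 2) (gamma_op a w) (2 * t) s = gamma_op a (stable_op (2 + N) w (t + t)) s"
      using stable_op_gamma_op[OF w, of M "2 * t" a "N + 2" s] wM t a by (simp add: add.commute)
    also have "\<dots> = gamma_op a (stable_op 2 (stable_op N w t) t) s"
      using stable_op_semigroup[OF w _ t t, of M 2 N] wM by (simp add: gamma_op_def)
    also have "\<dots> = gamma_op a (stable_op 2 v t) s"
      unfolding gamma_op_def
    proof (rule Bochner_Integration.integral_cong[OF refl])
      fix r
      have "stable_op 2 (stable_op N w t) t (s + r) = stable_op 2 v t (s + r)" if "r > 0"
        unfolding stable_op_def[of 2]
      proof (rule Bochner_Integration.integral_cong[OF refl])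
        show "stable_op N w t (s + r + q) * stable_kernel 2 t q = v (s + r + q) * stable_kernel 2 t q" for q
          using s that by (cases "q \<le> 0") (auto simp: v_def)
      qed
      then show "stable_op 2 (stable_op N w t) t (s + r) * gamma_density a r = stable_op 2 v t (s + r) * gamma_density a r"
        by (cases "r \<le> 0") auto
    qed
    also have "\<bar>\<dots>\<bar> \<le> C * A * t powr (2 * a - 2)"
      by (rule C(2)[OF t _ vA]) simp
    finally show ?thesis .
  qed
  then show ?thesis using C(1) by blast
qed

text \<open>Each factor raises the order by 2 and the exponent by 2 a - 2, a net gain of 2 a. The
  conclusion covers more starting points than the hypothesis and can therefore be fed back; the
  powers of 2 in the constants come from using the step at time t / 2.\<close>

lemma gamma_op_gain:
  assumes a: "0 < a" "a < 1"
  shows "\<exists>C\<ge>0. \<forall>w M A. w \<in> borel_measurable borel \<longrightarrow> (\<forall>r. \<bar>w r\<bar> \<le> M) \<longrightarrow>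
     (\<forall>t>0. \<forall>s>0. \<bar>stable_op N w t s\<bar> \<le> A * t powr g) \<longrightarrow>
     (\<forall>t>0. \<forall>s\<ge>0. \<bar>stable_op (N + 2 * Suc k) (gamma_op (real (Suc k) * a) w) t s\<bar> \<le> C * A * t powr (g + real (Suc k) * (2 * a - 2)))"
proof -
  obtain C1 where C1: "C1 \<ge> 0" "\<And>w M N A t s. t > 0 \<Longrightarrow> w \<in> borel_measurable borel \<Longrightarrow> (\<forall>r. \<bar>w r\<bar> \<le> M) \<Longrightarrow>
     (\<forall>s>0. \<bar>stable_op N w t s\<bar> \<le> A) \<Longrightarrow> s \<ge> 0 \<Longrightarrow>
     \<bar>stable_op (N + 2) (gamma_op a w) (2 * t) s\<bar> \<le> C1 * A * t powr (2 * a - 2)"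
    using gamma_op_gain_step[OF a] by blast
  have step: "\<bar>stable_op (N + 2) (gamma_op a w) t s\<bar> \<le> C1 / 2 powr (g + (2 * a - 2)) * A * t powr (g + (2 * a - 2))"
    if w: "w \<in> borel_measurable borel" "\<forall>r. \<bar>w r\<bar> \<le> M" and A: "\<forall>t>0. \<forall>s>0. \<bar>stable_op N w t s\<bar> \<le> A * t powr g"
      and t: "t > 0" and s: "s \<ge> 0" for w M N A g t s
  proof -
    have "\<bar>stable_op (N + 2) (gamma_op a w) (2 * (t / 2)) s\<bar> \<le> C1 * (A * (t / 2) powr g) * (t / 2) powr (2 * a - 2)"
      using t A by (intro C1(2)[OF _ w _ s]) auto
    also have "\<dots> = C1 * A * ((t / 2) powr (g + (2 * a - 2)))"
      by (simp add: powr_add)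
    also have "\<dots> = C1 / 2 powr (g + (2 * a - 2)) * A * t powr (g + (2 * a - 2))"
      using t by (simp add: powr_divide)
    finally show ?thesis by simp
  qed
  show ?thesis
  proof (induction k)
    case 0
    show ?case
      using step[of _ _ N _ g] C1(1) by (intro exI[of _ "C1 / 2 powr (g + (2 * a - 2))"]) auto
  next
    case (Suc k)
    define a' where "a' = real (Suc k) * a"
    define g' where "g' = g + real (Suc k) * (2 * a - 2)"
    define N' where "N' = N + 2 * Suc k"
    have a': "a' > 0" using a by (simp add: a'_def)
    obtain C where C: "C \<ge> 0" and IH: "\<forall>w M A. w \<in> borel_measurable borel \<longrightarrow> (\<forall>r. \<bar>w r\<bar> \<le> M) \<longrightarrow>
     (\<forall>t>0. \<forall>s>0. \<bar>stable_op N w t s\<bar> \<le> A * t powr g) \<longrightarrow>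
     (\<forall>t>0. \<forall>s\<ge>0. \<bar>stable_op N' (gamma_op a' w) t s\<bar> \<le> C * A * t powr g')"
      using Suc.IH unfolding a'_def g'_def N'_def by (elim exE conjE)
    define C2 where "C2 = C1 / 2 powr (g' + (2 * a - 2)) * C"
    have "\<bar>stable_op (N + 2 * Suc (Suc k)) (gamma_op (real (Suc (Suc k)) * a) w) t s\<bar> \<le> C2 * A * t powr (g + real (Suc (Suc k)) * (2 * a - 2))"
      if w: "w \<in> borel_measurable borel" "\<forall>r. \<bar>w r\<bar> \<le> M" and A: "\<forall>t>0. \<forall>s>0. \<bar>stable_op N w t s\<bar> \<le> A * t powr g"
        and t: "t > 0" and s: "s \<ge> 0" for w M A t s
    proof -
      have "gamma_op (real (Suc (Suc k)) * a) w = gamma_op (a' + a) w"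
        by (simp add: a'_def algebra_simps)
      also have "\<dots> = gamma_op a (gamma_op a' w)"
        by (rule ext, rule gamma_op_gamma_op[OF w(1) _ a' a(1), symmetric, of M]) (use w(2) in auto)
      finally have e: "gamma_op (real (Suc (Suc k)) * a) w = gamma_op a (gamma_op a' w)" .
      have "\<bar>stable_op (N' + 2) (gamma_op a (gamma_op a' w)) t s\<bar> \<le> C1 / 2 powr (g' + (2 * a - 2)) * (C * A) * t powr (g' + (2 * a - 2))"
        by (rule step[OF _ _ _ t s, of _ M]) (use IH[THEN spec[where x=w], THEN spec[where x=M], THEN spec[where x=A]] A gamma_op_bound[OF a' w(1)] gamma_op_measurable[OF w(1)] w in auto)
      also have "\<dots> = C2 * A * t powr (g + real (Suc (Suc k)) * (2 * a - 2))"
        by (simp add: C2_def g'_def algebra_simps)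
      finally show ?thesis unfolding e by (simp add: N'_def)
    qed
    moreover have "C2 \<ge> 0" using C C1(1) by (simp add: C2_def)
    ultimately show ?case by blast
  qed
qed

text \<open>Subtracting the primitive (A / q) t^(-q) leaves a nondecreasing function with limit 0 at
  infinity, hence a nonpositive one; the same holds for - f.\<close>

lemma bound_from_derivative_decay:
  fixes f :: "real \<Rightarrow> real"
  assumes d: "\<And>t. t > 0 \<Longrightarrow> (f has_real_derivative f' t) (at t)"
    and b: "\<And>t. t > 0 \<Longrightarrow> \<bar>f' t\<bar> \<le> A * t powr (- q - 1)"
    and l: "(f \<longlongrightarrow> 0) at_top" and q: "q > 0" and t: "t > 0"
  shows "\<bar>f t\<bar> \<le> A / q * t powr (- q)"
proof -
  have *: "g t \<le> A / q * t powr (- q)"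
    if d: "\<And>t. t > 0 \<Longrightarrow> (g has_real_derivative g' t) (at t)"
    and b: "\<And>t. t > 0 \<Longrightarrow> \<bar>g' t\<bar> \<le> A * t powr (- q - 1)"
    and l: "(g \<longlongrightarrow> 0) at_top" for g g' :: "real \<Rightarrow> real"
  proof -
    define h where "h t = g t - A / q * t powr (- q)" for t
    have "((\<lambda>t. t powr (- q)) \<longlongrightarrow> 0) at_top"
      using q by (intro tendsto_neg_powr filterlim_ident) auto
    then have "(h \<longlongrightarrow> 0 - A / q * 0) at_top"
      unfolding h_def by (intro tendsto_intros l)
    then have hl: "(h \<longlongrightarrow> 0) at_top" by simp
    have "h t \<le> h u" if "t \<le> u" for u
    proof (rule DERIV_nonneg_imp_nondecreasing[OF that])
      fix x assume "t \<le> x" "x \<le> u"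
      then have x: "x > 0" using t by simp
      have "(h has_real_derivative g' x - A / q * (- q * x powr (- q - 1))) (at x)"
        unfolding h_def using x by (intro DERIV_diff DERIV_cmult d has_real_derivative_powr)
      moreover have "g' x - A / q * (- q * x powr (- q - 1)) \<ge> 0"
        using b[OF x] q by simp
      ultimately show "\<exists>y. (h has_real_derivative y) (at x) \<and> 0 \<le> y" by blast
    qed
    then have "h t \<le> 0"
      by (intro tendsto_lowerbound[OF hl]) (auto intro!: eventually_mono[OF eventually_ge_at_top[of t]])
    then show ?thesis by (simp add: h_def)
  qed
  have "f t \<le> A / q * t powr (- q)" by (rule *[OF d b l])
  moreover have "- f t \<le> A / q * t powr (- q)"
    by (rule *[of "\<lambda>t. - f t" "\<lambda>t. - f' t"]) (use d b tendsto_minus[OF l] in \<open>auto intro: DERIV_minus\<close>)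
  ultimately show ?thesis by linarith
qed

lemma stable_op_tendsto_0:
  assumes j: "j \<ge> 1" and w: "w \<in> borel_measurable borel" "\<And>r. \<bar>w r\<bar> \<le> M"
  shows "((\<lambda>t. stable_op j w t s) \<longlongrightarrow> 0) at_top"
proof -
  obtain C where C: "\<And>t. t > 0 \<Longrightarrow> \<bar>stable_op j w t s\<bar> \<le> C * M / t ^ j"
    using stable_op_bound[of j] w by blast
  have "((\<lambda>t. C * M / t ^ j) \<longlongrightarrow> 0) at_top"
    using j by (intro real_tendsto_divide_at_top[OF tendsto_const] filterlim_pow_at_top filterlim_ident) auto
  then show ?thesis
    by (rule Lim_null_comparison[rotated]) (auto intro!: eventually_mono[OF eventually_gt_at_top[of 0]] C)
qed

text \<open>The constant is chosen before \<open>w\<close>, \<open>M\<close> and \<open>A\<close>,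
  so one constant serves all orbits. In particular the sup bound \<open>M\<close> only guarantees
  convergence and decay at infinity and does not enter the estimate.\<close>

theorem gamma_op_lipschitz_gain:
  assumes l: "l > 0" and sg: "b + l < real n'" "0 < b"
  shows "\<exists>C\<ge>0. \<forall>w M A. w \<in> borel_measurable borel \<longrightarrow> (\<forall>r. \<bar>w r\<bar> \<le> M) \<longrightarrow>
     (\<forall>t>0. \<forall>s>0. \<bar>stable_op n w t s\<bar> \<le> A * t powr (b - real n)) \<longrightarrow>
     (\<forall>t>0. \<bar>stable_op n' (gamma_op (l / 2) w) t 0\<bar> \<le> C * A * t powr (b + l - real n'))"
proof -
  \<comment> \<open>The bound by \<open>l\<close> makes the shape of each of the k + 1 pieces less
    than 1; the bound by \<open>n'\<close> makes the order \<open>J\<close> reached at least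
    \<open>n'\<close>.\<close>
  obtain k where k: "real k > max l (real n')" using reals_Archimedean2 by blast
  define a where "a = l / 2 / real (Suc k)"
  have "real (Suc k) \<noteq> 0" by simp
  then have a: "0 < a" "a < 1" "real (Suc k) * a = l / 2"
    using l k unfolding a_def by (simp, simp add: field_simps, metis nonzero_mult_div_cancel_left times_divide_eq_right)
  define J where "J = n + 2 * Suc k"
  have J: "n' \<le> J" using k by (simp add: J_def)
  have e: "b - real n + real (Suc k) * (2 * a - 2) = b + l - real J"
    using a(3) by (simp add: J_def algebra_simps)
  obtain C where C: "C \<ge> 0" and *: "\<forall>w M A. w \<in> borel_measurable borel \<longrightarrow> (\<forall>r. \<bar>w r\<bar> \<le> M) \<longrightarrow>
     (\<forall>t>0. \<forall>s>0. \<bar>stable_op n w t s\<bar> \<le> A * t powr (b - real n)) \<longrightarrow>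
     (\<forall>t>0. \<forall>s\<ge>0. \<bar>stable_op J (gamma_op (l / 2) w) t s\<bar> \<le> C * A * t powr (b + l - real J))"
    using gamma_op_gain[OF a(1,2), of n "b - real n" k] unfolding e a(3) J_def[symmetric] by (elim exE conjE)
  show ?thesis
    using J
  \<comment> \<open>Descent from order J to order n'. At every order j on the way q = j - (b + l) is
    positive, so the integral from t to infinity of the next derivative converges and has the right
    power.\<close>
  proof (induction rule: inc_induct)
    case base
    show ?case using C * by (intro exI[of _ C]) auto
  next
    case (step j)
    define q where "q = real j - (b + l)"
    have q: "q > 0" using sg step by (simp add: q_def)
    have j: "j \<ge> 1" using step sg l by (cases j) auto
    obtain C where C: "C \<ge> 0" "\<And>w M A t. w \<in> borel_measurable borel \<Longrightarrow> (\<forall>r. \<bar>w r\<bar> \<le> M) \<Longrightarrow>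
     (\<forall>t>0. \<forall>s>0. \<bar>stable_op n w t s\<bar> \<le> A * t powr (b - real n)) \<Longrightarrow> t > 0 \<Longrightarrow>
     \<bar>stable_op (Suc j) (gamma_op (l / 2) w) t 0\<bar> \<le> C * A * t powr (b + l - real (Suc j))"
      using step.IH by blast
    have "\<bar>stable_op j (gamma_op (l / 2) w) t 0\<bar> \<le> C / q * A * t powr (b + l - real j)"
      if w: "w \<in> borel_measurable borel" "\<forall>r. \<bar>w r\<bar> \<le> M"
        and A: "\<forall>t>0. \<forall>s>0. \<bar>stable_op n w t s\<bar> \<le> A * t powr (b - real n)" and t: "t > 0" for w M A t
    proof -
      have l2: "l / 2 > 0" using l by simp
      have W: "gamma_op (l / 2) w \<in> borel_measurable borel" "\<And>r. \<bar>gamma_op (l / 2) w r\<bar> \<le> M"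
        using gamma_op_measurable[OF w(1)] gamma_op_bound[OF l2 w(1)] w(2) by auto
      have "\<bar>stable_op j (gamma_op (l / 2) w) t 0\<bar> \<le> C * A / q * t powr (- q)"
      proof (rule bound_from_derivative_decay[OF stable_op_deriv[OF _ W] _ stable_op_tendsto_0[OF j W] q t])
        fix t :: real assume t: "t > 0"
        show "\<bar>stable_op (Suc j) (gamma_op (l / 2) w) t 0\<bar> \<le> C * A * t powr (- q - 1)"
          using C(2)[OF w A t] by (simp add: q_def algebra_simps)
      qed
      then show ?thesis by (simp add: q_def)
    qed
    moreover have "C / q \<ge> 0" using C(1) q by simp
    ultimately show ?case by blast
  qed
qed

section \<open>The one-dimensional Laguerre semigroup\<close>

text \<open>Pascal's rule in the shape in which the product rule produces it.\<close>

lemma sum_binomial_Suc: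
  fixes h :: "nat \<Rightarrow> real"
  shows "(\<Sum>j\<le>Suc m. real (Suc m choose j) * h j) = (\<Sum>j\<le>m. real (m choose j) * (h j + h (Suc j)))"
proof -
  have "(\<Sum>j\<le>Suc m. real (Suc m choose j) * h j) = h 0 + (\<Sum>j\<le>m. (real (m choose j) + real (m choose Suc j)) * h (Suc j))"
    by (subst sum.atMost_Suc_shift) simp
  also have "\<dots> = (h 0 + (\<Sum>j\<le>m. real (m choose Suc j) * h (Suc j))) + (\<Sum>j\<le>m. real (m choose j) * h (Suc j))"
    by (simp add: sum.distrib algebra_simps)
  also have "h 0 + (\<Sum>j\<le>m. real (m choose Suc j) * h (Suc j)) = (\<Sum>j\<le>Suc m. real (m choose j) * h j)"
    by (subst sum.atMost_Suc_shift) simp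
  also have "\<dots> = (\<Sum>j\<le>m. real (m choose j) * h j)" by simp
  finally show ?thesis by (simp add: sum.distrib algebra_simps)
qed

text \<open>Leibniz' rule. It is proved for all positive points simultaneously because
  differentiating once more needs the formula in a neighbourhood.\<close>

lemma higher_deriv_exp_powr:
  fixes b x :: real
  assumes "x > 0"
  shows "(deriv ^^ m) (\<lambda>u. exp (- u) * u powr b) x =
    (\<Sum>j\<le>m. real (m choose j) * ((-1) ^ j * (\<Prod>i<m - j. b - real i) * (exp (- x) * x powr (b - real (m - j)))))"
  using assms
proof (induction m arbitrary: x)
  case 0
  then show ?case by simp
next
  case (Suc m)
  define h where "h j x = (-1) ^ j * (\<Prod>i<Suc m - j. b - real i) * (exp (- x) * x powr (b - real (Suc m - j)))" for j x
  have d: "((\<lambda>x. \<Sum>j\<le>m. real (m choose j) * ((-1) ^ j * (\<Prod>i<m - j. b - real i) * (exp (- x) * x powr (b - real (m - j)))))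
      has_real_derivative (\<Sum>j\<le>m. real (m choose j) * (h j x + h (Suc j) x))) (at x)"
  proof (intro DERIV_sum DERIV_cmult)
    fix j assume j: "j \<in> {..m}"
    define e where "e = b - real (m - j)"
    have "((\<lambda>x. (-1) ^ j * (\<Prod>i<m - j. b - real i) * (exp (- x) * x powr e)) has_real_derivative
       (-1) ^ j * (\<Prod>i<m - j. b - real i) * (exp (- x) * (e * x powr (e - 1)) - exp (- x) * x powr e)) (at x)"
      using Suc.prems by (auto intro!: derivative_eq_intros simp: algebra_simps powr_diff field_simps)
    also have "(-1) ^ j * (\<Prod>i<m - j. b - real i) * (exp (- x) * (e * x powr (e - 1)) - exp (- x) * x powr e) = h j x + h (Suc j) x"
    proof -
      have "h j x = (-1) ^ j * ((\<Prod>i<m - j. b - real i) * e) * (exp (- x) * x powr (e - 1))"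
        using j by (simp add: h_def Suc_diff_le e_def algebra_simps)
      moreover have "h (Suc j) x = - ((-1) ^ j * (\<Prod>i<m - j. b - real i) * (exp (- x) * x powr e))"
        by (simp add: h_def e_def)
      ultimately show ?thesis by (simp add: algebra_simps)
    qed
    finally show "((\<lambda>x. (-1) ^ j * (\<Prod>i<m - j. b - real i) * (exp (- x) * x powr (b - real (m - j)))) has_real_derivative h j x + h (Suc j) x) (at x)"
      by (simp add: e_def)
  qed
  have "((deriv ^^ m) (\<lambda>u. exp (- u) * u powr b) has_real_derivative (\<Sum>j\<le>m. real (m choose j) * (h j x + h (Suc j) x))) (at x)"
    by (rule has_field_derivative_transform_within_open[OF d, of "{0<..}"]) (use Suc in auto)
  then have "(deriv ^^ Suc m) (\<lambda>u. exp (- u) * u powr b) x = (\<Sum>j\<le>m. real (m choose j) * (h j x + h (Suc j) x))"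
    by (simp add: DERIV_imp_deriv)
  also have "\<dots> = (\<Sum>j\<le>Suc m. real (Suc m choose j) * h j x)"
    by (rule sum_binomial_Suc[symmetric])
  finally show ?case by (simp only: h_def)
qed

lemma Gamma_falling:
  fixes a :: real
  assumes a: "a > -1" and "j \<le> k"
  shows "(\<Prod>i<k - j. real k + a - real i) = Gamma (real k + a + 1) / Gamma (real j + a + 1)"
  using assms(2)
proof (induction rule: inc_induct)
  case base
  have "Gamma (real k + a + 1) > 0" using a by (intro Gamma_real_pos) auto
  then show ?case by simp
next
  case (step n)
  have p: "Gamma (real n + a + 1) > 0" "real n + a + 1 > 0" using a by (auto intro!: Gamma_real_pos)
  have "k - n = Suc (k - Suc n)" using step by simp
  then have "(\<Prod>i<k - n. real k + a - real i) = (\<Prod>i<k - Suc n. real k + a - real i) * (real n + a + 1)"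
    using step by (simp add: of_nat_diff algebra_simps)
  also have "(\<Prod>i<k - Suc n. real k + a - real i) = Gamma (real k + a + 1) / Gamma (real (Suc n) + a + 1)"
    by (rule step.IH)
  also have "Gamma (real (Suc n) + a + 1) = (real n + a + 1) * Gamma (real n + a + 1)"
    using Gamma_plus1[of "real n + a + 1"] p nonpos_Ints_nonpos by (fastforce simp: add_ac)
  finally show ?case using p by simp
qed

text \<open>The Laguerre polynomial multiplied by k! / Gamma (k + a + 1). In this normalisation the
  passage between monomials and Laguerre polynomials is a binomial transform.\<close>

definition laguerre_sum :: "real \<Rightarrow> nat \<Rightarrow> real \<Rightarrow> real" where
  "laguerre_sum a k x = (\<Sum>j\<le>k. real (k choose j) * (-1) ^ j * (x ^ j / Gamma (real j + a + 1)))"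

lemma laguerre_poly1_eq:
  assumes a: "a > -1" and x: "x > 0"
  shows "laguerre_poly1 a k x = Gamma (real k + a + 1) / fact k * laguerre_sum a k x"
proof -
  have "laguerre_poly1 a k x = 1 / fact k * exp x * x powr (- a) *
     (\<Sum>j\<le>k. real (k choose j) * ((-1) ^ j * (\<Prod>i<k - j. real k + a - real i) * (exp (- x) * x powr (real k + a - real (k - j)))))"
    unfolding laguerre_poly1_def by (simp add: higher_deriv_exp_powr[OF x])
  also have "\<dots> = (\<Sum>j\<le>k. Gamma (real k + a + 1) / fact k * (real (k choose j) * (-1) ^ j * (x ^ j / Gamma (real j + a + 1))))"
    unfolding sum_distrib_left
  proof (rule sum.cong[OF refl])
    fix j assume "j \<in> {..k}"
    then have j: "j \<le> k" by simp
    have "x powr (real k + a - real (k - j)) = x powr a * x ^ j"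
      using j x by (simp add: of_nat_diff powr_add powr_realpow)
    then have "1 / fact k * exp x * x powr (- a) * (real (k choose j) * ((-1) ^ j * (\<Prod>i<k - j. real k + a - real i) * (exp (- x) * x powr (real k + a - real (k - j)))))
      = 1 / fact k * (exp x * exp (- x)) * (x powr (- a) * x powr a) * (real (k choose j) * ((-1) ^ j * (\<Prod>i<k - j. real k + a - real i) * x ^ j))"
      by (simp add: mult_ac)
    also have "exp x * exp (- x) = 1" by (simp flip: exp_add)
    also have "x powr (- a) * x powr a = 1" using x by (simp flip: powr_add)
    finally show "1 / fact k * exp x * x powr (- a) * (real (k choose j) * ((-1) ^ j * (\<Prod>i<k - j. real k + a - real i) * (exp (- x) * x powr (real k + a - real (k - j)))))
      = Gamma (real k + a + 1) / fact k * (real (k choose j) * (-1) ^ j * (x ^ j / Gamma (real j + a + 1)))"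
      unfolding Gamma_falling[OF a j] by (simp add: mult_ac)
  qed
  finally show ?thesis by (simp add: laguerre_sum_def sum_distrib_left)
qed

text \<open>The binomial theorem for rising factorials, at negative arguments. It writes the k-th
  moment of a gamma law of shape b + m through the falling factorials of m, whose averages over a
  Poisson variable m are known.\<close>

lemma pochhammer_expansion:
  fixes b :: real
  shows "pochhammer (b + real m) k = (\<Sum>j\<le>k. real (k choose j) * (real (m choose j) * fact j) * pochhammer (b + real j) (k - j))"
proof -
  have 1: "pochhammer (- real m) j = (-1) ^ j * (real (m choose j) * fact j)" for j
    using gbinomial_pochhammer'[of "real m" j] by (simp add: pochhammer_minus binomial_gbinomial)
  have 2: "pochhammer (- (b + real k - 1)) (k - j) = (-1) ^ (k - j) * pochhammer (b + real j) (k - j)" if "j \<le> k" for j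
  proof -
    have "b + real k - 1 - real (k - j) + 1 = b + real j" using that by (simp add: of_nat_diff)
    then show ?thesis by (simp only: pochhammer_minus)
  qed
  have 3: "pochhammer (- real m + - (b + real k - 1)) k = (-1) ^ k * pochhammer (b + real m) k"
    using pochhammer_minus[of "real m + b + real k - 1" k] by (simp add: algebra_simps)
  have "(-1) ^ k * pochhammer (b + real m) k = (\<Sum>j\<le>k. real (k choose j) * pochhammer (- real m) j * pochhammer (- (b + real k - 1)) (k - j))"
    unfolding 3[symmetric] by (rule pochhammer_binomial_sum)
  also have "\<dots> = (\<Sum>j\<le>k. (-1) ^ k * (real (k choose j) * (real (m choose j) * fact j) * pochhammer (b + real j) (k - j)))"
  proof (rule sum.cong[OF refl])
    fix j assume "j \<in> {..k}"
    then have j: "j \<le> k" by simp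
    then have "(-1) ^ k = (-1) ^ j * (-1::real) ^ (k - j)" by (simp flip: power_add)
    then show "real (k choose j) * pochhammer (- real m) j * pochhammer (- (b + real k - 1)) (k - j) = (-1) ^ k * (real (k choose j) * (real (m choose j) * fact j) * pochhammer (b + real j) (k - j))"
      unfolding 1 2[OF j] by (simp add: mult_ac)
  qed
  finally show ?thesis by (simp flip: sum_distrib_left)
qed

text \<open>The factorial moments of the Poisson law: (m choose j) j! is the falling factorial of m,
  which cancels j factors of m! and shifts the exponential series.\<close>

lemma exp_binomial_sums:
  fixes z :: real
  shows "(\<lambda>m. z ^ m / fact m * (real (m choose j) * fact j)) sums (z ^ j * exp z)"
proof -
  have "(\<lambda>i. z ^ j * (z ^ i /\<^sub>R fact i)) sums (z ^ j * exp z)"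
    by (intro sums_mult exp_converges)
  moreover have "z ^ j * (z ^ i /\<^sub>R fact i) = z ^ (i + j) / fact (i + j) * (real ((i + j) choose j) * fact j)" for i
    by (simp add: binomial_fact power_add field_simps)
  ultimately have "(\<lambda>i. z ^ (i + j) / fact (i + j) * (real ((i + j) choose j) * fact j)) sums (z ^ j * exp z)" by simp
  then show ?thesis
    by (subst (asm) sums_zero_iff_shift) (auto simp: binomial_eq_0)
qed

lemma pochhammer_ge_fact: "pochhammer (b :: real) m \<ge> fact m" if "b \<ge> 1"
proof (induction m)
  case (Suc m)
  have "fact (Suc m) = fact m * (1 + real m)" by (simp add: algebra_simps)
  also have "\<dots> \<le> pochhammer b m * (b + real m)"
    using Suc that by (intro mult_mono) (auto intro: pochhammer_nonneg)
  finally show ?case by (simp add: pochhammer_Suc)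
qed simp

lemma Gamma_pochhammer_shift:
  fixes a :: real
  assumes "a > -1"
  shows "Gamma (real m + a + 1 + real k) = pochhammer (a + 1 + real m) k * Gamma (real m + a + 1)"
proof -
  have "real m + a + 1 > 0" using assms by simp
  then have "Gamma (real m + a + 1) \<noteq> 0" "real m + a + 1 \<notin> \<int>\<^sub>\<le>\<^sub>0"
    using Gamma_real_pos[of "real m + a + 1"] nonpos_Ints_nonpos by (force, fastforce)
  then show ?thesis using pochhammer_Gamma[of "real m + a + 1" k] by (simp add: field_simps add_ac)
qed

text \<open>Gamma (m + a + 1) dominates (m - 1)! Gamma (a + 2) because a + 2 \<ge> 1. As a + 1 may
  be less than 1, the index m = 0 is separate, and the shift by one costs the factor 1 + b.\<close>

lemma power_div_Gamma_le:
  fixes a b :: real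
  assumes a: "a > -1" and b: "b \<ge> 0"
  shows "b ^ m / Gamma (real m + a + 1) \<le> (1 / Gamma (a + 1) + 1 / Gamma (a + 2)) * ((1 + b) * exp b)"
proof -
  have G: "Gamma (a + 1) > 0" "Gamma (a + 2) > 0" using a by (auto intro!: Gamma_real_pos)
  have e: "1 \<le> (1 + b) * exp b" "b * exp b \<le> (1 + b) * exp b"
    using b mult_mono[of 1 "1 + b" 1 "exp b"] by auto
  show ?thesis
  proof (cases m)
    case 0
    have "1 / Gamma (a + 1) * 1 \<le> (1 / Gamma (a + 1) + 1 / Gamma (a + 2)) * ((1 + b) * exp b)"
      using G e by (intro mult_mono) auto
    then show ?thesis using 0 by simp
  next
    case (Suc n)
    have "Gamma (real m + a + 1) = pochhammer (a + 2) n * Gamma (a + 2)"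
      using Gamma_pochhammer_shift[of a 1 n] a Suc by (simp add: add_ac)
    also have "\<dots> \<ge> fact n * Gamma (a + 2)"
      using pochhammer_ge_fact[of "a + 2" n] a G by (intro mult_right_mono) auto
    finally have "b ^ m / Gamma (real m + a + 1) \<le> b ^ m / (fact n * Gamma (a + 2))"
      using b G by (intro divide_left_mono) (use a in \<open>auto intro!: mult_pos_pos Gamma_real_pos\<close>)
    also have "\<dots> = 1 / Gamma (a + 2) * (b * (b ^ n / fact n))"
      by (simp add: Suc)
    also have "\<dots> \<le> 1 / Gamma (a + 2) * (b * exp b)"
    proof -
      have "b ^ n / fact n \<le> exp b"
        using sum_le_suminf[OF summable_exp[of b], of "{n}"] b
        by (simp add: exp_def scaleR_conv_of_real divide_inverse mult.commute)
      then show ?thesis using b G by (intro mult_left_mono) auto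
    qed
    also have "\<dots> \<le> (1 / Gamma (a + 1) + 1 / Gamma (a + 2)) * ((1 + b) * exp b)"
      using G e b by (intro mult_mono) auto
    finally show ?thesis .
  qed
qed

lemma bessel_series_summable:
  fixes a c :: real
  assumes a: "a > -1" and c: "c \<ge> 0"
  shows "summable (\<lambda>m. c ^ m / (fact m * Gamma (real m + a + 1)))"
proof (rule summable_comparison_test')
  define D where "D = (1 / Gamma (a + 1) + 1 / Gamma (a + 2)) * ((1 + 1) * exp 1)"
  show "summable (\<lambda>m. D * (inverse (fact m) * c ^ m))"
    by (intro summable_mult summable_exp)
  fix m :: nat
  have G: "Gamma (real m + a + 1) > 0" using a by (intro Gamma_real_pos) auto
  have "1 ^ m / Gamma (real m + a + 1) \<le> D"
    unfolding D_def by (rule power_div_Gamma_le[OF a]) simp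
  then have "c ^ m / fact m * (1 / Gamma (real m + a + 1)) \<le> c ^ m / fact m * D"
    using c by (intro mult_left_mono) auto
  then show "norm (c ^ m / (fact m * Gamma (real m + a + 1))) \<le> D * (inverse (fact m) * c ^ m)"
    using G c by (simp add: divide_inverse mult_ac)
qed

section \<open>The one-dimensional kernel: power series, boundedness, moments\<close>

definition laguerre_kernel1 :: "real \<Rightarrow> real \<Rightarrow> real \<Rightarrow> real \<Rightarrow> real" where
  "laguerre_kernel1 a t x y = Gamma (a + 1) / (1 - exp (- t))
     * exp (- (exp (- t) / (1 - exp (- t))) * (x + y))
     * sqrt (exp (- t) * x * y) powr (- a)
     * bessel_I a (2 * sqrt (exp (- t) * x * y) / (1 - exp (- t)))"

text \<open>The prefactor cancels the fractional power in the Bessel series. What remains is a power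
  series in x y with positive coefficients, from which positivity and termwise integration
  follow.\<close>

lemma laguerre_kernel1_series:
  assumes a: "a > -1" and t: "t > 0" and xy: "x > 0" "y > 0"
  defines "r \<equiv> exp (- t)"
  shows "laguerre_kernel1 a t x y = Gamma (a + 1) * (1 - r) powr (- a - 1) * exp (- (r / (1 - r)) * (x + y)) *
     (\<Sum>m. (r * x * y / (1 - r)\<^sup>2) ^ m / (fact m * Gamma (real m + a + 1)))"
proof -
  have r: "0 < r" "r < 1" using t by (auto simp: r_def)
  define c where "c = r * x * y / (1 - r)\<^sup>2"
  define u where "u = sqrt (r * x * y) / (1 - r)"
  have c: "c > 0" "u > 0" "u\<^sup>2 = c" using r xy by (auto simp: c_def u_def power_divide)
  have "bessel_I a (2 * sqrt (r * x * y) / (1 - r)) = (\<Sum>m. u powr a * (c ^ m / (fact m * Gamma (real m + a + 1))))"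
    unfolding bessel_I_def
  proof (intro suminf_cong)
    fix m
    have "(2 * sqrt (r * x * y) / (1 - r) / 2) powr (2 * real m + a) = u powr (real (2 * m)) * u powr a"
    proof -
      have "2 * p / d / 2 = p / d" for p d :: real by simp
      then have "2 * sqrt (r * x * y) / (1 - r) / 2 = u" unfolding u_def .
      then show ?thesis by (simp only: powr_add[symmetric]) simp
    qed
    also have "u powr (real (2 * m)) = c ^ m"
      using c by (simp only: powr_realpow power_mult)
    finally show "(2 * sqrt (r * x * y) / (1 - r) / 2) powr (2 * real m + a) / (fact m * Gamma (real m + a + 1)) =
      u powr a * (c ^ m / (fact m * Gamma (real m + a + 1)))" by simp
  qed
  also have "\<dots> = u powr a * (\<Sum>m. c ^ m / (fact m * Gamma (real m + a + 1)))"
    using bessel_series_summable[OF a, of c] c by (intro suminf_mult) auto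
  finally have B: "bessel_I a (2 * sqrt (r * x * y) / (1 - r)) = u powr a * (\<Sum>m. c ^ m / (fact m * Gamma (real m + a + 1)))" .
  have S: "sqrt (r * x * y) powr (- a) * u powr a = (1 - r) powr (- a)"
  proof -
    have "u powr a = sqrt (r * x * y) powr a / (1 - r) powr a"
      unfolding u_def by (rule powr_divide)
    then show ?thesis using r xy by (simp add: powr_minus field_simps)
  qed
  have "laguerre_kernel1 a t x y = Gamma (a + 1) * ((1 - r) powr (- a) / (1 - r)) * exp (- (r / (1 - r)) * (x + y)) *
     (\<Sum>m. c ^ m / (fact m * Gamma (real m + a + 1)))"
    unfolding laguerre_kernel1_def r_def[symmetric] B S[symmetric] by simp
  also have "(1 - r) powr (- a) / (1 - r) = (1 - r) powr (- a - 1)"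
    using r by (simp add: powr_diff)
  finally show ?thesis unfolding c_def .
qed

lemma laguerre_kernel1_nonneg:
  assumes "a > -1" "t > 0" "x > 0" "y > 0"
  shows "laguerre_kernel1 a t x y \<ge> 0"
  unfolding laguerre_kernel1_series[OF assms] using assms
  by (intro mult_nonneg_nonneg suminf_nonneg bessel_series_summable divide_nonneg_nonneg) (auto intro!: less_imp_le[OF Gamma_real_pos])

lemma laguerre_kernel1_commute: "laguerre_kernel1 a t x y = laguerre_kernel1 a t y x"
  by (simp add: laguerre_kernel1_def mult_ac add.commute)

lemma bessel_I_measurable [measurable]: "bessel_I a \<in> borel_measurable borel"
  unfolding bessel_I_def[abs_def] by measurable

lemma laguerre_kernel1_measurable [measurable (raw)]:
  assumes [measurable]: "f \<in> borel_measurable M" "g \<in> borel_measurable M" "h \<in> borel_measurable M"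
  shows "(\<lambda>z. laguerre_kernel1 a (f z) (g z) (h z)) \<in> borel_measurable M"
  unfolding laguerre_kernel1_def by measurable

text \<open>For fixed x the series grows at most like (1 + b) exp b, where b is proportional to y,
  while the Gaussian-type prefactor contributes exp (- 2 b). Boundedness in y makes f \<mapsto> T_t
  f (x) continuous on L^1.\<close>

lemma laguerre_kernel1_bounded:
  assumes a: "a > -1" and t: "t > 0" and x: "x > 0"
  shows "\<exists>C\<ge>0. \<forall>y>0. laguerre_kernel1 a t x y \<le> C"
proof -
  define r where "r = exp (- t)"
  have r: "0 < r" "r < 1" using t by (auto simp: r_def)
  define D where "D = 1 / Gamma (a + 1) + 1 / Gamma (a + 2)"
  define A where "A = 2 * x / (1 - r)"
  define K where "K = Gamma (a + 1) * (1 - r) powr (- a - 1)"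
  have G: "Gamma (a + 1) > 0" "Gamma (a + 2) > 0" using a by (auto intro!: Gamma_real_pos)
  have pos: "D \<ge> 0" "A \<ge> 0" "K \<ge> 0" using G r x by (auto simp: D_def A_def K_def)
  have "laguerre_kernel1 a t x y \<le> K * (D * exp A)" if y: "y > 0" for y
  proof -
    \<comment> \<open>Chosen so that the y-part of the prefactor is exactly exp (- 2 b);
      \<open>A\<close> then collects the remaining factor of the series argument, which depends on x
      alone.\<close>
    define b where "b = r * y / (2 * (1 - r))"
    have b: "b \<ge> 0" using r y by (simp add: b_def)
    have c: "r * x * y / (1 - r)\<^sup>2 = A * b"
    proof -
      have "r * x * y / d\<^sup>2 = 2 * x / d * (r * y / (2 * d))" for d by (simp add: power2_eq_square)
      then show ?thesis unfolding A_def b_def .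
    qed
    have "(\<Sum>m. (A * b) ^ m / (fact m * Gamma (real m + a + 1))) \<le> (\<Sum>m. D * ((1 + b) * exp b) * (inverse (fact m) * A ^ m))"
    proof (rule suminf_le)
      fix m :: nat
      have "A ^ m / fact m * (b ^ m / Gamma (real m + a + 1)) \<le> A ^ m / fact m * (D * ((1 + b) * exp b))"
        unfolding D_def using pos by (intro mult_left_mono power_div_Gamma_le[OF a b]) auto
      then show "(A * b) ^ m / (fact m * Gamma (real m + a + 1)) \<le> D * ((1 + b) * exp b) * (inverse (fact m) * A ^ m)"
        by (simp add: power_mult_distrib divide_inverse mult_ac)
    qed (use pos b a in \<open>auto intro!: bessel_series_summable summable_mult summable_exp mult_nonneg_nonneg\<close>)
    also have "\<dots> = D * ((1 + b) * exp b) * exp A"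
      by (subst suminf_mult[OF summable_exp]) (simp add: exp_def scaleR_conv_of_real divide_inverse mult.commute)
    finally have s: "(\<Sum>m. (A * b) ^ m / (fact m * Gamma (real m + a + 1))) \<le> D * ((1 + b) * exp b) * exp A" .
    have e: "exp (- (r / (1 - r)) * (x + y)) \<le> exp (- (2 * b))"
      using r x y by (simp add: b_def field_simps)
    have "laguerre_kernel1 a t x y = K * (exp (- (r / (1 - r)) * (x + y)) * (\<Sum>m. (A * b) ^ m / (fact m * Gamma (real m + a + 1))))"
      unfolding laguerre_kernel1_series[OF a t x y] r_def[symmetric] c K_def by simp
    also have "\<dots> \<le> K * (exp (- (2 * b)) * (D * ((1 + b) * exp b) * exp A))"
      using pos b a by (intro mult_left_mono mult_mono[OF e s] suminf_nonneg bessel_series_summable divide_nonneg_nonneg)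
        (auto intro!: less_imp_le[OF Gamma_real_pos])
    also have "exp (- (2 * b)) * (D * ((1 + b) * exp b) * exp A) = D * exp A * ((1 + b) * (exp (- (2 * b)) * exp b))"
      by simp
    also have "\<dots> \<le> D * exp A * 1"
    proof (intro mult_left_mono)
      have "(1 + b) * exp (- b) \<le> exp b * exp (- b)" by (intro mult_right_mono exp_ge_add_one_self) auto
      then show "(1 + b) * (exp (- (2 * b)) * exp b) \<le> 1" by (simp flip: exp_add)
    qed (use pos in auto)
    finally show ?thesis using pos by (simp add: mult_left_mono)
  qed
  then show ?thesis using pos by (intro exI[of _ "K * (D * exp A)"]) auto
qed

definition laguerre_weight :: "real \<Rightarrow> real \<Rightarrow> real" where
  "laguerre_weight a y = indicator {0<..} y * (y powr a * exp (- y) / Gamma (a + 1))"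

lemma laguerre_weight_measurable [measurable]: "laguerre_weight a \<in> borel_measurable borel"
  unfolding laguerre_weight_def[abs_def] by measurable

lemma laguerre_weight_nonneg: "a > -1 \<Longrightarrow> laguerre_weight a y \<ge> 0"
  using Gamma_real_pos[of "a + 1"] by (simp add: laguerre_weight_def)

text \<open>The kernel is the density of a mixture: \<open>y\<close> has a gamma law of shape \<open>m + a + 1\<close> and scale \<open>1 - r\<close>,
  where \<open>m\<close> is Poisson distributed with mean \<open>z = r x / (1 - r)\<close>.\<close>

lemma laguerre_kernel1_moment:
  assumes a: "a > -1" and t: "t > 0" and x: "x > 0"
  defines "r \<equiv> exp (- t)"
  shows "(\<integral>\<^sup>+y. ennreal (laguerre_weight a y * laguerre_kernel1 a t x y * y ^ k) \<partial>lborel) =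
    ennreal (Gamma (real k + a + 1) * (\<Sum>j\<le>k. real (k choose j) * (r ^ j * (1 - r) ^ (k - j)) * (x ^ j / Gamma (real j + a + 1))))"
proof -
  have r: "0 < r" "r < 1" using t by (auto simp: r_def)
  have G: "Gamma (real j + a + 1) > 0" for j using a by (intro Gamma_real_pos) auto
  have G1: "Gamma (a + 1) > 0" using G[of 0] by simp
  define z where "z = r * x / (1 - r)"
  define A where "A m = (1 - r) powr (- a - 1) * exp (- z) * ((r * x / (1 - r)\<^sup>2) ^ m / (fact m * Gamma (real m + a + 1)))" for m
  have A: "A m \<ge> 0" for m using r x G[of m] by (simp add: A_def less_imp_le)
  \<comment> \<open>The factor y^k only raises the shape of the m-th gamma law from m + a + 1 to m +
    k + a + 1.\<close>
  define F where "F m y = A m * (indicator {0<..} y * (y powr (real m + real k + a + 1 - 1) * exp (- (y / (1 - r)))))" for m y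
  define S where "S m = A m * (Gamma (real m + real k + a + 1) * (1 - r) powr (real m + real k + a + 1))" for m
  have F: "F m y \<ge> 0" for m y using A by (simp add: F_def)
  have FS: "has_bochner_integral lborel (F m) (S m)" for m
    unfolding F_def S_def using a r by (intro has_bochner_integral_mult_right gamma_moment) auto
  have S: "S m \<ge> 0" for m using A r a by (auto simp: S_def intro!: mult_nonneg_nonneg less_imp_le[OF Gamma_real_pos])
  have nF: "(\<integral>\<^sup>+y. ennreal (F m y) \<partial>lborel) = ennreal (S m)" for m
    using FS[of m] F by (subst nn_integral_eq_integral) (auto simp: has_bochner_integral_iff)
  have Fs: "(\<lambda>m. F m y) sums (laguerre_weight a y * laguerre_kernel1 a t x y * y ^ k)" for y
  proof (cases "y > 0")
    case False
    then show ?thesis by (simp add: F_def laguerre_weight_def)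
  next
    case y: True
    define c where "c = r * x * y / (1 - r)\<^sup>2"
    define L where "L = y powr a * exp (- y) * ((1 - r) powr (- a - 1) * exp (- (r / (1 - r)) * (x + y))) * y ^ k"
    have c: "c \<ge> 0" using r x y by (simp add: c_def)
    have "(\<lambda>m. L * (c ^ m / (fact m * Gamma (real m + a + 1)))) sums (L * (\<Sum>m. c ^ m / (fact m * Gamma (real m + a + 1))))"
      by (intro sums_mult summable_sums bessel_series_summable a c)
    also have "L * (\<Sum>m. c ^ m / (fact m * Gamma (real m + a + 1))) = laguerre_weight a y * laguerre_kernel1 a t x y * y ^ k"
      unfolding laguerre_kernel1_series[OF a t x y] r_def[symmetric] c_def[symmetric] L_def
      using G1 y by (simp add: laguerre_weight_def)
    also have "(\<lambda>m. L * (c ^ m / (fact m * Gamma (real m + a + 1)))) = (\<lambda>m. F m y)"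
    proof
      fix m
      have e: "exp (- y) * exp (- (r / (1 - r)) * (x + y)) = exp (- z) * exp (- (y / (1 - r)))"
      proof -
        have "- y + - (r / (1 - r)) * (x + y) = - z + - (y / (1 - r))"
        proof -
          have "y / (1 - r) = y + r / (1 - r) * y"
            using r by (simp add: divide_simps) (simp add: algebra_simps)
          then show ?thesis by (simp add: z_def distrib_left)
        qed
        then show ?thesis by (simp flip: exp_add)
      qed
      have p: "y powr (real m + real k + a + 1 - 1) = y powr a * y ^ k * y ^ m"
        using y by (simp add: powr_add powr_realpow)
      have "L * (c ^ m / (fact m * Gamma (real m + a + 1))) = (y powr a * y ^ k * y ^ m) * (1 - r) powr (- a - 1)
        * (exp (- y) * exp (- (r / (1 - r)) * (x + y))) * ((r * x / (1 - r)\<^sup>2) ^ m / (fact m * Gamma (real m + a + 1)))"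
        unfolding L_def c_def by (simp add: power_mult_distrib power_divide mult_ac)
      then show "L * (c ^ m / (fact m * Gamma (real m + a + 1))) = F m y"
        unfolding e p[symmetric] F_def A_def using y by (simp add: mult_ac)
    qed
    finally show ?thesis .
  qed
  have Ss: "S sums (Gamma (real k + a + 1) * (\<Sum>j\<le>k. real (k choose j) * (r ^ j * (1 - r) ^ (k - j)) * (x ^ j / Gamma (real j + a + 1))))"
  proof -
    \<comment> \<open>By \<open>pochhammer_expansion\<close> the quotient of the Gamma values
      becomes a combination of falling factorials of m, and the Poisson weights sum each of them to
      a power of z.\<close>
    define B where "B j = exp (- z) * (1 - r) ^ k * (real (k choose j) * pochhammer (a + 1 + real j) (k - j))" for j
    have "(\<lambda>m. \<Sum>j\<le>k. B j * (z ^ m / fact m * (real (m choose j) * fact j))) sums (\<Sum>j\<le>k. B j * (z ^ j * exp z))"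
      by (intro sums_sum sums_mult exp_binomial_sums)
    moreover have "(\<Sum>j\<le>k. B j * (z ^ m / fact m * (real (m choose j) * fact j))) = S m" for m
    proof -
      have "(\<Sum>j\<le>k. B j * (z ^ m / fact m * (real (m choose j) * fact j))) = exp (- z) * (1 - r) ^ k * (z ^ m / fact m) * pochhammer (a + 1 + real m) k"
        unfolding pochhammer_expansion[of "a + 1" m k] sum_distrib_left B_def by (intro sum.cong refl) (simp add: mult_ac)
      also have "pochhammer (a + 1 + real m) k = Gamma (real m + real k + a + 1) / Gamma (real m + a + 1)"
        using Gamma_pochhammer_shift[OF a, of m k] G[of m] by (simp add: field_simps add_ac)
      also have "(1 - r) ^ k * (z ^ m / fact m) = (1 - r) powr (- a - 1) * (1 - r) powr (real m + real k + a + 1) * ((r * x / (1 - r)\<^sup>2) ^ m / fact m)"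
      proof -
        have "(1 - r) powr (- a - 1) * (1 - r) powr (real m + real k + a + 1) = (1 - r) ^ (m + k)"
          using r by (simp flip: powr_add powr_realpow)
        moreover have "z ^ m = (1 - r) ^ m * (r * x / (1 - r)\<^sup>2) ^ m"
          using r by (simp add: z_def power2_eq_square flip: power_mult_distrib)
        ultimately show ?thesis by (simp add: power_add)
      qed
      then have "exp (- z) * (1 - r) ^ k * (z ^ m / fact m) = exp (- z) * ((1 - r) powr (- a - 1) * (1 - r) powr (real m + real k + a + 1) * ((r * x / (1 - r)\<^sup>2) ^ m / fact m))"
        by (simp add: mult.assoc)
      finally show ?thesis by (simp add: S_def A_def mult_ac)
    qed
    moreover have "(\<Sum>j\<le>k. B j * (z ^ j * exp z)) = Gamma (real k + a + 1) * (\<Sum>j\<le>k. real (k choose j) * (r ^ j * (1 - r) ^ (k - j)) * (x ^ j / Gamma (real j + a + 1)))"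
      unfolding sum_distrib_left
    proof (rule sum.cong[OF refl])
      fix j assume "j \<in> {..k}"
      then have j: "j \<le> k" by simp
      have "Gamma (real k + a + 1) = pochhammer (a + 1 + real j) (k - j) * Gamma (real j + a + 1)"
        using Gamma_pochhammer_shift[OF a, of j "k - j"] j by (simp add: of_nat_diff add_ac)
      then have p: "pochhammer (a + 1 + real j) (k - j) = Gamma (real k + a + 1) / Gamma (real j + a + 1)"
        using G[of j] by simp
      have "(1 - r) ^ k = (1 - r) ^ j * (1 - r) ^ (k - j)" using j by (simp flip: power_add)
      then have q: "(1 - r) ^ k * z ^ j = r ^ j * (1 - r) ^ (k - j) * x ^ j"
        using r by (simp add: z_def power_divide power_mult_distrib)
      have "B j * (z ^ j * exp z) = (exp (- z) * exp z) * ((1 - r) ^ k * z ^ j) * (real (k choose j) * pochhammer (a + 1 + real j) (k - j))"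
        by (simp add: B_def mult_ac)
      also have "exp (- z) * exp z = 1" by (simp flip: exp_add)
      finally show "B j * (z ^ j * exp z) = Gamma (real k + a + 1) * (real (k choose j) * (r ^ j * (1 - r) ^ (k - j)) * (x ^ j / Gamma (real j + a + 1)))"
        unfolding q p by (simp add: mult_ac)
    qed
    ultimately show ?thesis by simp
  qed
  have "(\<integral>\<^sup>+y. ennreal (laguerre_weight a y * laguerre_kernel1 a t x y * y ^ k) \<partial>lborel) = (\<integral>\<^sup>+y. (\<Sum>m. ennreal (F m y)) \<partial>lborel)"
    using suminf_ennreal2[OF F sums_summable[OF Fs]] by (simp add: sums_unique[OF Fs])
  also have "\<dots> = (\<Sum>m. \<integral>\<^sup>+y. ennreal (F m y) \<partial>lborel)"
    by (intro nn_integral_suminf) (simp add: F_def[abs_def])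
  also have "\<dots> = ennreal (\<Sum>m. S m)"
    unfolding nF using S Ss by (intro suminf_ennreal2) (auto simp: sums_summable)
  finally show ?thesis unfolding sums_unique[OF Ss] .
qed

lemma laguerre_kernel1_moment_bochner:
  assumes a: "a > -1" and t: "t > 0" and x: "x > 0"
  defines "r \<equiv> exp (- t)"
  shows "has_bochner_integral lborel (\<lambda>y. laguerre_weight a y * laguerre_kernel1 a t x y * y ^ k)
    (Gamma (real k + a + 1) * (\<Sum>j\<le>k. real (k choose j) * (r ^ j * (1 - r) ^ (k - j)) * (x ^ j / Gamma (real j + a + 1))))"
proof (rule has_bochner_integral_nn_integral[OF _ _ _ laguerre_kernel1_moment[OF a t x, of k, folded r_def]])
  have r: "0 < r" "r < 1" using t by (auto simp: r_def)
  show "AE y in lborel. 0 \<le> laguerre_weight a y * laguerre_kernel1 a t x y * y ^ k"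
  proof (intro AE_I2)
    fix y :: real
    show "0 \<le> laguerre_weight a y * laguerre_kernel1 a t x y * y ^ k"
    proof (cases "y > 0")
      case True
      then show ?thesis
        using laguerre_kernel1_nonneg[OF a t x] laguerre_weight_nonneg[OF a] by simp
    qed (simp add: laguerre_weight_def)
  qed
  show "0 \<le> Gamma (real k + a + 1) * (\<Sum>j\<le>k. real (k choose j) * (r ^ j * (1 - r) ^ (k - j)) * (x ^ j / Gamma (real j + a + 1)))"
    using r x a by (intro mult_nonneg_nonneg sum_nonneg divide_nonneg_nonneg) (auto intro!: less_imp_le[OF Gamma_real_pos])
qed measurable

section \<open>Laguerre polynomials as eigenfunctions of the kernel\<close>

lemma sum_triangle_swap:
  fixes f :: "nat \<Rightarrow> nat \<Rightarrow> real"
  shows "(\<Sum>j\<le>k. \<Sum>i\<le>j. f j i) = (\<Sum>i\<le>k. \<Sum>j=i..k. f j i)"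
proof -
  have "(\<Sum>j\<le>k. \<Sum>i\<le>j. f j i) = (\<Sum>j\<le>k. \<Sum>i | i \<in> {..k} \<and> i \<le> j. f j i)"
    by (intro sum.cong refl) auto
  also have "\<dots> = (\<Sum>i\<le>k. \<Sum>j | j \<in> {..k} \<and> i \<le> j. f j i)"
    by (rule sum.swap_restrict) auto
  also have "\<dots> = (\<Sum>i\<le>k. \<Sum>j=i..k. f j i)"
    by (intro sum.cong refl) auto
  finally show ?thesis .
qed

text \<open>Identify \<open>X\<^sup>j\<close> with \<open>x\<^sup>j / Gamma (j + a + 1)\<close>. Then the semigroup is the substitution of \<open>r X + 1 - r\<close> for \<open>X\<close>,
  and the Laguerre polynomial is a multiple of \<open>(1 - X)\<^sup>k\<close>.\<close>

lemma laguerre_sum_eigen: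
  assumes a: "a > -1" and t: "t > 0" and x: "x > 0"
  shows "has_bochner_integral lborel (\<lambda>y. laguerre_weight a y * laguerre_kernel1 a t x y * laguerre_sum a k y)
    (exp (- t) ^ k * laguerre_sum a k x)"
proof -
  define r where "r = exp (- t)"
  define e where "e j = x ^ j / Gamma (real j + a + 1)" for j
  have G: "Gamma (real j + a + 1) > 0" for j using a by (intro Gamma_real_pos) auto
  have "has_bochner_integral lborel (\<lambda>y. \<Sum>j\<le>k. real (k choose j) * (-1) ^ j / Gamma (real j + a + 1) * (laguerre_weight a y * laguerre_kernel1 a t x y * y ^ j))
    (\<Sum>j\<le>k. real (k choose j) * (-1) ^ j / Gamma (real j + a + 1) * (Gamma (real j + a + 1) * (\<Sum>i\<le>j. real (j choose i) * (r ^ i * (1 - r) ^ (j - i)) * e i)))"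
    unfolding r_def e_def by (intro has_bochner_integral_sum has_bochner_integral_mult_right laguerre_kernel1_moment_bochner a t x)
  also have "(\<lambda>y. \<Sum>j\<le>k. real (k choose j) * (-1) ^ j / Gamma (real j + a + 1) * (laguerre_weight a y * laguerre_kernel1 a t x y * y ^ j))
     = (\<lambda>y. laguerre_weight a y * laguerre_kernel1 a t x y * laguerre_sum a k y)"
    by (simp add: laguerre_sum_def sum_distrib_left mult_ac)
  also have "(\<Sum>j\<le>k. real (k choose j) * (-1) ^ j / Gamma (real j + a + 1) * (Gamma (real j + a + 1) * (\<Sum>i\<le>j. real (j choose i) * (r ^ i * (1 - r) ^ (j - i)) * e i)))
     = (\<Sum>j\<le>k. \<Sum>i\<le>j. real (k choose j) * (-1) ^ j * (real (j choose i) * (r ^ i * (1 - r) ^ (j - i)) * e i))"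
  proof (rule sum.cong[OF refl])
    fix j show "real (k choose j) * (-1) ^ j / Gamma (real j + a + 1) * (Gamma (real j + a + 1) * (\<Sum>i\<le>j. real (j choose i) * (r ^ i * (1 - r) ^ (j - i)) * e i))
      = (\<Sum>i\<le>j. real (k choose j) * (-1) ^ j * (real (j choose i) * (r ^ i * (1 - r) ^ (j - i)) * e i))"
      using G[of j] by (simp add: sum_distrib_left mult.assoc)
  qed
  also have "\<dots> = (\<Sum>i\<le>k. \<Sum>j=i..k. real (k choose j) * (-1) ^ j * (real (j choose i) * (r ^ i * (1 - r) ^ (j - i)) * e i))"
    by (rule sum_triangle_swap)
  also have "\<dots> = (\<Sum>i\<le>k. r ^ k * (real (k choose i) * (-1) ^ i * e i))"
  proof (rule sum.cong[OF refl])
    fix i assume "i \<in> {..k}"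
    then have i: "i \<le> k" by simp
    \<comment> \<open>Regrouping the two binomial coefficients as (k choose i) (k - i choose j - i)
      leaves the expansion of (1 - (1 - r))^(k - i).\<close>
    have "(\<Sum>j=i..k. real (k choose j) * (-1) ^ j * (real (j choose i) * (r ^ i * (1 - r) ^ (j - i)) * e i))
      = (\<Sum>l\<le>k - i. real (k choose i) * (-1) ^ i * (r ^ i * e i) * (real ((k - i) choose l) * (- (1 - r)) ^ l * 1 ^ (k - i - l)))"
    proof (rule sum.reindex_bij_witness[of _ "\<lambda>l. l + i" "\<lambda>j. j - i"])
      fix j assume j: "j \<in> {i..k}"
      have c: "real (k choose j) * real (j choose i) = real (k choose i) * real ((k - i) choose (j - i))"
        using choose_mult[of i j k] j by (simp flip: of_nat_mult)
      have s: "(-1) ^ j = (-1) ^ i * (-1::real) ^ (j - i)" using j by (simp flip: power_add)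
      have "real (k choose j) * (-1) ^ j * (real (j choose i) * (r ^ i * (1 - r) ^ (j - i)) * e i) = (real (k choose j) * real (j choose i)) * (-1) ^ j * (r ^ i * (1 - r) ^ (j - i)) * e i"
        by (simp add: mult_ac)
      also have "\<dots> = real (k choose i) * (-1) ^ i * (r ^ i * e i) * (real ((k - i) choose (j - i)) * (- (1 - r)) ^ (j - i) * 1 ^ (k - i - (j - i)))"
        unfolding c s power_minus[of "1 - r"] by (simp add: mult_ac)
      finally show "real (k choose i) * (-1) ^ i * (r ^ i * e i) * (real ((k - i) choose (j - i)) * (- (1 - r)) ^ (j - i) * 1 ^ (k - i - (j - i)))
         = real (k choose j) * (-1) ^ j * (real (j choose i) * (r ^ i * (1 - r) ^ (j - i)) * e i)" ..
    qed (use i in auto)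
    also have "\<dots> = real (k choose i) * (-1) ^ i * (r ^ i * e i) * r ^ (k - i)"
      unfolding sum_distrib_left[symmetric] binomial_ring[symmetric] by simp
    also have "\<dots> = r ^ k * (real (k choose i) * (-1) ^ i * e i)"
    proof -
      have "r ^ k = r ^ i * r ^ (k - i)" using i by (simp flip: power_add)
      then show ?thesis by (simp add: mult_ac)
    qed
    finally show "(\<Sum>j=i..k. real (k choose j) * (-1) ^ j * (real (j choose i) * (r ^ i * (1 - r) ^ (j - i)) * e i)) = r ^ k * (real (k choose i) * (-1) ^ i * e i)" .
  qed
  also have "\<dots> = r ^ k * laguerre_sum a k x"
    by (simp add: laguerre_sum_def e_def sum_distrib_left)
  finally show ?thesis by (simp add: r_def)
qed

text \<open>Binomial inversion: X \<mapsto> 1 - X is an involution, so the same alternating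
  coefficients lead back to the monomials.\<close>

lemma laguerre_sum_inversion:
  assumes a: "a > -1"
  shows "x ^ k = Gamma (real k + a + 1) * (\<Sum>j\<le>k. real (k choose j) * (-1) ^ j * laguerre_sum a j x)"
proof -
  have G: "Gamma (real j + a + 1) > 0" for j using a by (intro Gamma_real_pos) auto
  define e where "e j = x ^ j / Gamma (real j + a + 1)" for j
  have "(\<Sum>j\<le>k. real (k choose j) * (-1) ^ j * laguerre_sum a j x) = (\<Sum>j\<le>k. \<Sum>i\<le>j. real (k choose j) * (-1) ^ j * (real (j choose i) * (-1) ^ i * e i))"
    by (simp add: laguerre_sum_def e_def sum_distrib_left)
  also have "\<dots> = (\<Sum>i\<le>k. \<Sum>j=i..k. real (k choose j) * (-1) ^ j * (real (j choose i) * (-1) ^ i * e i))"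
    by (rule sum_triangle_swap)
  also have "\<dots> = (\<Sum>i\<le>k. real (k choose i) * e i * 0 ^ (k - i))"
  proof (rule sum.cong[OF refl])
    fix i assume "i \<in> {..k}"
    then have i: "i \<le> k" by simp
    have "(\<Sum>j=i..k. real (k choose j) * (-1) ^ j * (real (j choose i) * (-1) ^ i * e i))
      = (\<Sum>l\<le>k - i. real (k choose i) * e i * (real ((k - i) choose l) * (-1) ^ l * 1 ^ (k - i - l)))"
    proof (rule sum.reindex_bij_witness[of _ "\<lambda>l. l + i" "\<lambda>j. j - i"])
      fix j assume j: "j \<in> {i..k}"
      have c: "real (k choose j) * real (j choose i) = real (k choose i) * real ((k - i) choose (j - i))"
        using choose_mult[of i j k] j by (simp flip: of_nat_mult)
      have s: "(-1) ^ j * (-1) ^ i = (-1::real) ^ (j - i)"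
      proof -
        have "(-1) ^ j = (-1) ^ i * (-1::real) ^ (j - i)" using j by (simp flip: power_add)
        then show ?thesis by (simp add: mult_ac flip: power_mult_distrib)
      qed
      have "real (k choose j) * (-1) ^ j * (real (j choose i) * (-1) ^ i * e i) = (real (k choose j) * real (j choose i)) * ((-1) ^ j * (-1) ^ i) * e i"
        by (simp add: mult_ac)
      also have "\<dots> = real (k choose i) * e i * (real ((k - i) choose (j - i)) * (-1) ^ (j - i) * 1 ^ (k - i - (j - i)))"
        unfolding c s by (simp add: mult_ac)
      finally show "real (k choose i) * e i * (real ((k - i) choose (j - i)) * (-1) ^ (j - i) * 1 ^ (k - i - (j - i)))
         = real (k choose j) * (-1) ^ j * (real (j choose i) * (-1) ^ i * e i)" ..
    qed (use i in auto)
    also have "\<dots> = real (k choose i) * e i * 0 ^ (k - i)"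
      unfolding sum_distrib_left[symmetric] binomial_ring[symmetric] by simp
    finally show "(\<Sum>j=i..k. real (k choose j) * (-1) ^ j * (real (j choose i) * (-1) ^ i * e i)) = real (k choose i) * e i * 0 ^ (k - i)" .
  qed
  also have "\<dots> = (\<Sum>i\<le>k. if i = k then e k else 0)"
    by (intro sum.cong refl) (auto simp: power_0_left)
  also have "\<dots> = e k" by simp
  finally show ?thesis using G[of k] by (simp add: e_def)
qed

lemma laguerre_sum_measurable [measurable]: "laguerre_sum a k \<in> borel_measurable borel"
  unfolding laguerre_sum_def[abs_def] by measurable

text \<open>The weight has exponential moments of every rate below 1. This threshold is the origin
  of the smallness conditions in the density argument.\<close>

lemma laguerre_weight_exp_integral:
  assumes a: "a > -1" and d: "d < 1"
  shows "has_bochner_integral lborel (\<lambda>y. laguerre_weight a y * exp (d * y)) ((1 / (1 - d)) powr (a + 1))"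
proof -
  have G: "Gamma (a + 1) > 0" using a by (intro Gamma_real_pos) auto
  have "has_bochner_integral lborel (\<lambda>y. 1 / Gamma (a + 1) * (indicator {0<..} y * (y powr (a + 1 - 1) * exp (- (y / (1 / (1 - d)))))))
    (1 / Gamma (a + 1) * (Gamma (a + 1) * (1 / (1 - d)) powr (a + 1)))"
    using a d by (intro has_bochner_integral_mult_right gamma_moment) auto
  moreover have "(\<lambda>y. 1 / Gamma (a + 1) * (indicator {0<..} y * (y powr (a + 1 - 1) * exp (- (y / (1 / (1 - d))))))) = (\<lambda>y. laguerre_weight a y * exp (d * y))"
  proof
    fix y
    have "exp (- (y / (1 / (1 - d)))) = exp (- y) * exp (d * y)" by (simp add: algebra_simps flip: exp_add)
    then show "1 / Gamma (a + 1) * (indicator {0<..} y * (y powr (a + 1 - 1) * exp (- (y / (1 / (1 - d)))))) = laguerre_weight a y * exp (d * y)"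
      by (simp add: laguerre_weight_def)
  qed
  ultimately show ?thesis using G by simp
qed

section \<open>The Laguerre measure and the kernel in several variables\<close>

lemma prod_Basis_vec:
  "(\<Prod>b\<in>Basis. g b) = (\<Prod>i\<in>UNIV. g (axis i (1::real) :: real ^ 'd))" for g :: "real ^ 'd \<Rightarrow> 'b :: comm_monoid_mult"
proof -
  have B: "(Basis :: (real ^ 'd) set) = (\<lambda>i. axis i 1) ` UNIV"
    by (auto simp: Basis_vec_def)
  have "inj (\<lambda>i. axis i (1::real) :: real ^ 'd)"
    by (auto simp: inj_on_def axis_eq_axis)
  then show ?thesis unfolding B by (subst prod.reindex) (auto simp: o_def)
qed

text \<open>Product integrals are indexed by the vectors in \<open>Basis\<close>; this recovers the
  coordinate that such a vector stands for.\<close>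

definition axis_index :: "real ^ 'd \<Rightarrow> 'd" where
  "axis_index b = (THE i. b = axis i 1)"

lemma axis_index_axis [simp]: "axis_index (axis i 1) = i"
  unfolding axis_index_def by (rule the_equality) (auto simp: axis_eq_axis)

lemma nn_integral_vec_prod:
  fixes f :: "'d::finite \<Rightarrow> real \<Rightarrow> ennreal"
  assumes "\<And>i. f i \<in> borel_measurable borel"
  shows "(\<integral>\<^sup>+x. (\<Prod>i\<in>UNIV. f i (x $ i)) \<partial>(lborel :: (real ^ 'd) measure)) = (\<Prod>i\<in>UNIV. \<integral>\<^sup>+y. f i y \<partial>lborel)"
proof -
  have "(\<integral>\<^sup>+x. (\<Prod>b\<in>Basis. f (axis_index b) (x \<bullet> b)) \<partial>(lborel :: (real ^ 'd) measure)) = (\<Prod>b\<in>(Basis :: (real ^ 'd) set). \<integral>\<^sup>+y. f (axis_index b) y \<partial>lborel)"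
    using assms by (intro nn_integral_lborel_prod) auto
  then show ?thesis by (simp add: prod_Basis_vec inner_axis)
qed

lemma has_bochner_integral_vec_prod:
  fixes f :: "'d::finite \<Rightarrow> real \<Rightarrow> real"
  assumes f: "\<And>i. has_bochner_integral lborel (f i) (v i)"
  shows "has_bochner_integral (lborel :: (real ^ 'd) measure) (\<lambda>x. \<Prod>i\<in>UNIV. f i (x $ i)) (\<Prod>i\<in>UNIV. v i)"
proof -
  define F where "F b = f (axis_index b)" for b :: "real ^ 'd"
  have [measurable]: "f i \<in> borel_measurable borel" for i using f[of i] by (auto simp: has_bochner_integral_iff)
  interpret product_sigma_finite "\<lambda>_ :: real ^ 'd. lborel :: real measure" ..
  have i: "integrable lborel (F b)" "integral\<^sup>L lborel (F b) = v (axis_index b)" for b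
    using f by (auto simp: F_def has_bochner_integral_iff)
  define g where "g = (\<lambda>x::real ^ 'd. \<Prod>b\<in>Basis. F b (x \<bullet> b))"
  have gm: "g \<in> borel_measurable borel" unfolding g_def F_def by measurable
  have T: "(\<lambda>f. \<Sum>b\<in>Basis. f b *\<^sub>R b) \<in> measurable (\<Pi>\<^sub>M b\<in>(Basis :: (real ^ 'd) set). lborel) (borel :: (real ^ 'd) measure)"
    by measurable
  have g': "g (\<Sum>b\<in>Basis. p b *\<^sub>R b) = (\<Prod>b\<in>Basis. F b (p b))" for p
    unfolding g_def by (intro prod.cong refl) simp
  have "integrable lborel g" "integral\<^sup>L lborel g = (\<Prod>b\<in>(Basis::(real ^ 'd) set). v (axis_index b))"
    unfolding lborel_eq[where 'a="real ^ 'd"] integrable_distr_eq[OF T gm] integral_distr[OF T gm] g'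
    using product_integrable_prod[of Basis F] product_integral_prod[of Basis F] i by auto
  then show ?thesis
    by (simp add: has_bochner_integral_iff g_def F_def prod_Basis_vec inner_axis)
qed

lemma orthant_measurable [measurable]: "(orthant :: (real ^ 'd) set) \<in> sets borel"
proof -
  have "(orthant :: (real ^ 'd) set) = (\<Inter>i\<in>UNIV. {x. 0 < x $ i})" by (auto simp: orthant_def)
  also have "\<dots> \<in> sets borel" by measurable
  finally show ?thesis .
qed

text \<open>The density with respect to Lebesgue measure on the whole space. The indicator of the
  orthant is distributed over the coordinates, which keeps the product structure.\<close>

definition laguerre_vweight :: "real ^ 'd \<Rightarrow> real ^ 'd \<Rightarrow> real" where
  "laguerre_vweight \<alpha> x = (\<Prod>i\<in>UNIV. laguerre_weight (\<alpha> $ i) (x $ i))"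

lemma laguerre_vweight_measurable [measurable]: "laguerre_vweight \<alpha> \<in> borel_measurable borel"
  unfolding laguerre_vweight_def[abs_def] by measurable

lemma laguerre_vweight_eq:
  "laguerre_vweight \<alpha> x = indicator orthant x * (\<Prod>i\<in>UNIV. x $ i powr \<alpha> $ i * exp (- x $ i) / Gamma (\<alpha> $ i + 1))"
proof (cases "x \<in> orthant")
  case True
  then show ?thesis by (simp add: laguerre_vweight_def laguerre_weight_def orthant_def)
next
  case False
  then obtain i where "\<not> 0 < x $ i" by (auto simp: orthant_def)
  then have "laguerre_weight (\<alpha> $ i) (x $ i) = 0" by (simp add: laguerre_weight_def)
  then have "\<exists>i\<in>UNIV. laguerre_weight (\<alpha> $ i) (x $ i) = 0" by blast
  then have "laguerre_vweight \<alpha> x = 0" unfolding laguerre_vweight_def by (subst prod_zero_iff) auto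
  then show ?thesis using False by simp
qed

lemma space_laguerre_measure [simp]: "space (laguerre_measure \<alpha>) = orthant"
  by (simp add: laguerre_measure_def space_restrict_space)

lemma sets_laguerre_measure: "sets (laguerre_measure \<alpha>) = sets (restrict_space borel orthant)"
  by (simp add: laguerre_measure_def sets_restrict_space)

lemma measurable_laguerre_measure1: "f \<in> measurable borel N \<Longrightarrow> f \<in> measurable (laguerre_measure \<alpha>) N"
  unfolding measurable_cong_sets[OF sets_laguerre_measure refl] by (rule measurable_restrict_space1)

lemma measurable_laguerre_borel [measurable]: "(\<lambda>x. x) \<in> measurable (laguerre_measure \<alpha>) borel"
  by (rule measurable_laguerre_measure1) simp

locale laguerre =
  fixes \<alpha> :: "real ^ 'd"
  assumes alpha: "\<And>i. \<alpha> $ i > -1"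
begin

abbreviation "\<mu> \<equiv> laguerre_measure \<alpha>"

lemma alpha1: "0 < \<alpha> $ i + 1"
  using alpha[of i] by linarith

lemma vweight_nonneg: "laguerre_vweight \<alpha> x \<ge> 0"
  unfolding laguerre_vweight_def by (intro prod_nonneg ballI laguerre_weight_nonneg alpha)

lemma density_measurable:
  "(\<lambda>x::real ^ 'd. \<Prod>i\<in>UNIV. x $ i powr \<alpha> $ i * exp (- x $ i) / Gamma (\<alpha> $ i + 1)) \<in> borel_measurable (restrict_space lborel orthant)"
  by (intro measurable_restrict_space1) measurable

lemma nn_integral_laguerre:
  assumes [measurable]: "f \<in> borel_measurable borel"
  shows "(\<integral>\<^sup>+x. f x \<partial>\<mu>) = (\<integral>\<^sup>+x. ennreal (laguerre_vweight \<alpha> x) * f x \<partial>lborel)"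
proof -
  have "(\<integral>\<^sup>+x. f x \<partial>\<mu>) = (\<integral>\<^sup>+x. ennreal (\<Prod>i\<in>UNIV. x $ i powr \<alpha> $ i * exp (- x $ i) / Gamma (\<alpha> $ i + 1)) * f x \<partial>(restrict_space lborel orthant))"
  proof -
    have "f \<in> borel_measurable (restrict_space lborel orthant)" by (intro measurable_restrict_space1) simp
    then show ?thesis
      unfolding laguerre_measure_def using density_measurable by (intro nn_integral_density) auto
  qed
  also have "\<dots> = (\<integral>\<^sup>+x. ennreal (laguerre_vweight \<alpha> x) * f x \<partial>lborel)"
    by (subst nn_integral_restrict_space) (auto intro!: nn_integral_cong simp: laguerre_vweight_eq indicator_def)
  finally show ?thesis .
qed

lemma has_bochner_integral_laguerre:
  assumes g[measurable]: "g \<in> borel_measurable borel"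
    and v: "has_bochner_integral lborel (\<lambda>x. laguerre_vweight \<alpha> x * g x) v"
  shows "has_bochner_integral \<mu> g v"
proof -
  define w where "w x = (\<Prod>i\<in>UNIV. x $ i powr \<alpha> $ i * exp (- x $ i) / Gamma (\<alpha> $ i + 1))" for x :: "real ^ 'd"
  have w: "w \<in> borel_measurable (restrict_space lborel orthant)" unfolding w_def[abs_def] by (rule density_measurable)
  have gm: "g \<in> borel_measurable (restrict_space lborel orthant)" by (intro measurable_restrict_space1) (use g in simp)
  have wp: "AE x in restrict_space lborel orthant. 0 \<le> w x"
    by (intro AE_I2) (auto simp: w_def space_restrict_space intro!: prod_nonneg divide_nonneg_nonneg less_imp_le[OF Gamma_real_pos] alpha1)
  have e: "indicator orthant x * (w x * g x) = laguerre_vweight \<alpha> x * g x" for x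
    by (simp add: laguerre_vweight_eq w_def)
  have "integrable \<mu> g"
    unfolding laguerre_measure_def w_def[symmetric] integrable_density[OF gm w wp]
    using v by (subst integrable_restrict_space) (auto simp: e has_bochner_integral_iff)
  moreover have "integral\<^sup>L \<mu> g = v"
    unfolding laguerre_measure_def w_def[symmetric] integral_density[OF gm w wp]
    using v by (subst integral_restrict_space) (auto simp: e has_bochner_integral_iff)
  ultimately show ?thesis by (simp add: has_bochner_integral_iff)
qed

lemma nn_integral_laguerre_prod:
  assumes [measurable]: "\<And>i. f i \<in> borel_measurable borel" and f: "\<And>i y. y > 0 \<Longrightarrow> f i y \<ge> 0"
  shows "(\<integral>\<^sup>+x. ennreal (\<Prod>i\<in>UNIV. f i (x $ i)) \<partial>\<mu>) = (\<Prod>i\<in>UNIV. \<integral>\<^sup>+y. ennreal (laguerre_weight (\<alpha> $ i) y * f i y) \<partial>lborel)"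
proof -
  have n: "laguerre_weight (\<alpha> $ i) y * f i y \<ge> 0" for i y
  proof (cases "y > 0")
    case True
    then show ?thesis using f[of y i] laguerre_weight_nonneg[OF alpha[of i], of y] by simp
  qed (simp add: laguerre_weight_def)
  have "(\<integral>\<^sup>+x. ennreal (\<Prod>i\<in>UNIV. f i (x $ i)) \<partial>\<mu>) = (\<integral>\<^sup>+x. ennreal (laguerre_vweight \<alpha> x) * ennreal (\<Prod>i\<in>UNIV. f i (x $ i)) \<partial>lborel)"
    by (rule nn_integral_laguerre) measurable
  also have "\<dots> = (\<integral>\<^sup>+x. (\<Prod>i\<in>UNIV. ennreal (laguerre_weight (\<alpha> $ i) (x $ i) * f i (x $ i))) \<partial>lborel)"
    using vweight_nonneg n by (intro nn_integral_cong) (simp add: prod_ennreal laguerre_vweight_def prod.distrib flip: ennreal_mult')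
  also have "\<dots> = (\<Prod>i\<in>UNIV. \<integral>\<^sup>+y. ennreal (laguerre_weight (\<alpha> $ i) y * f i y) \<partial>lborel)"
    by (rule nn_integral_vec_prod) measurable
  finally show ?thesis .
qed

lemma has_bochner_integral_laguerre_prod:
  assumes [measurable]: "\<And>i. f i \<in> borel_measurable borel"
    and f: "\<And>i. has_bochner_integral lborel (\<lambda>y. laguerre_weight (\<alpha> $ i) y * f i y) (v i)"
  shows "has_bochner_integral \<mu> (\<lambda>x. \<Prod>i\<in>UNIV. f i (x $ i)) (\<Prod>i\<in>UNIV. v i)"
proof (rule has_bochner_integral_laguerre)
  show "has_bochner_integral lborel (\<lambda>x. laguerre_vweight \<alpha> x * (\<Prod>i\<in>UNIV. f i (x $ i))) (\<Prod>i\<in>UNIV. v i)"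
    using has_bochner_integral_vec_prod[OF f] by (simp add: laguerre_vweight_def prod.distrib)
qed measurable

lemma has_bochner_integral_laguerre_exp:
  assumes "\<And>i. c $ i < 1"
  shows "has_bochner_integral \<mu> (\<lambda>x. exp (\<Sum>i\<in>UNIV. c $ i * x $ i)) (\<Prod>i\<in>UNIV. (1 / (1 - c $ i)) powr (\<alpha> $ i + 1))"
  using has_bochner_integral_laguerre_prod[of "\<lambda>i y. exp (c $ i * y)", OF _ laguerre_weight_exp_integral[OF alpha assms]]
  by (simp add: exp_sum)

lemma prob_space_laguerre: "prob_space \<mu>"
proof
  have "has_bochner_integral \<mu> (\<lambda>x. 1::real) 1"
    using has_bochner_integral_laguerre_exp[of 0] by simp
  then have "(\<integral>\<^sup>+x. ennreal 1 \<partial>\<mu>) = ennreal 1"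
    by (subst nn_integral_eq_integral) (auto simp: has_bochner_integral_iff)
  then show "emeasure \<mu> (space \<mu>) = 1" by simp
qed

sublocale prob_space \<mu> by (rule prob_space_laguerre)

lemma kernel_eq: "laguerre_kernel \<alpha> t x y = (\<Prod>i\<in>UNIV. laguerre_kernel1 (\<alpha> $ i) t (x $ i) (y $ i))"
  by (simp add: laguerre_kernel_def laguerre_kernel1_def)

lemma kernel_commute: "laguerre_kernel \<alpha> t x y = laguerre_kernel \<alpha> t y x"
  unfolding kernel_eq by (simp add: laguerre_kernel1_commute)

lemma kernel_nonneg: "t > 0 \<Longrightarrow> x \<in> orthant \<Longrightarrow> y \<in> orthant \<Longrightarrow> laguerre_kernel \<alpha> t x y \<ge> 0"
  unfolding kernel_eq by (intro prod_nonneg ballI laguerre_kernel1_nonneg alpha) (auto simp: orthant_def)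

lemma kernel_measurable_borel:
  assumes [measurable]: "f \<in> borel_measurable N" "g \<in> borel_measurable N" "h \<in> borel_measurable N"
  shows "(\<lambda>z. laguerre_kernel \<alpha> (f z) (g z) (h z)) \<in> borel_measurable N"
proof -
  have c: "(\<lambda>x::real ^ 'd. x $ i) \<in> borel_measurable borel" for i by measurable
  have [measurable]: "(\<lambda>z. g z $ i) \<in> borel_measurable N" "(\<lambda>z. h z $ i) \<in> borel_measurable N" for i
    using measurable_compose[OF assms(2) c] measurable_compose[OF assms(3) c] by auto
  show ?thesis unfolding kernel_eq by measurable
qed

lemma kernel_measurable [measurable (raw)]:
  assumes f[measurable]: "f \<in> borel_measurable N" and g: "g \<in> measurable N \<mu>" and h: "h \<in> measurable N \<mu>"
  shows "(\<lambda>z. laguerre_kernel \<alpha> (f z) (g z) (h z)) \<in> borel_measurable N"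
  using measurable_compose[OF g measurable_laguerre_borel] measurable_compose[OF h measurable_laguerre_borel]
  by (intro kernel_measurable_borel) auto

lemma kernel_bounded:
  assumes t: "t > 0" and x: "x \<in> orthant"
  shows "\<exists>C\<ge>0. \<forall>y\<in>orthant. laguerre_kernel \<alpha> t x y \<le> C"
proof -
  have "\<forall>i. \<exists>C\<ge>0. \<forall>y>0. laguerre_kernel1 (\<alpha> $ i) t (x $ i) y \<le> C"
    using x by (intro allI laguerre_kernel1_bounded alpha t) (auto simp: orthant_def)
  then obtain C where C: "\<And>i. C i \<ge> 0" "\<And>i y. y > 0 \<Longrightarrow> laguerre_kernel1 (\<alpha> $ i) t (x $ i) y \<le> C i"
    by metis
  have "laguerre_kernel \<alpha> t x y \<le> (\<Prod>i\<in>UNIV. C i)" if "y \<in> orthant" for y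
    unfolding kernel_eq using that x t C by (intro prod_mono conjI laguerre_kernel1_nonneg alpha) (auto simp: orthant_def)
  moreover have "(\<Prod>i\<in>UNIV. C i) \<ge> 0" using C by (intro prod_nonneg) auto
  ultimately show ?thesis by blast
qed

lemma kernel_monomial:
  assumes t: "t > 0" and x: "x \<in> orthant"
  shows "has_bochner_integral \<mu> (\<lambda>y. laguerre_kernel \<alpha> t x y * (\<Prod>i\<in>UNIV. y $ i ^ k i))
    (\<Prod>i\<in>UNIV. Gamma (real (k i) + \<alpha> $ i + 1) * (\<Sum>j\<le>k i. real (k i choose j) * (exp (- t) ^ j * (1 - exp (- t)) ^ (k i - j)) * (x $ i ^ j / Gamma (real j + \<alpha> $ i + 1))))"
proof -
  have "has_bochner_integral \<mu> (\<lambda>y. \<Prod>i\<in>UNIV. laguerre_kernel1 (\<alpha> $ i) t (x $ i) (y $ i) * y $ i ^ k i)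
    (\<Prod>i\<in>UNIV. Gamma (real (k i) + \<alpha> $ i + 1) * (\<Sum>j\<le>k i. real (k i choose j) * (exp (- t) ^ j * (1 - exp (- t)) ^ (k i - j)) * (x $ i ^ j / Gamma (real j + \<alpha> $ i + 1))))"
  proof (rule has_bochner_integral_laguerre_prod)
    fix i
    have "x $ i > 0" using x by (simp add: orthant_def)
    from laguerre_kernel1_moment_bochner[OF alpha t this, of i "k i"]
    show "has_bochner_integral lborel (\<lambda>y. laguerre_weight (\<alpha> $ i) y * (laguerre_kernel1 (\<alpha> $ i) t (x $ i) y * y ^ k i))
      (Gamma (real (k i) + \<alpha> $ i + 1) * (\<Sum>j\<le>k i. real (k i choose j) * (exp (- t) ^ j * (1 - exp (- t)) ^ (k i - j)) * (x $ i ^ j / Gamma (real j + \<alpha> $ i + 1))))"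
      by (simp add: mult.assoc)
  qed measurable
  then show ?thesis by (simp add: kernel_eq prod.distrib)
qed

text \<open>The moment formula in degree zero: the semigroup preserves constants.\<close>

lemma kernel_mass:
  assumes t: "t > 0" and x: "x \<in> orthant"
  shows "has_bochner_integral \<mu> (laguerre_kernel \<alpha> t x) 1"
proof -
  have "Gamma (\<alpha> $ i + 1) \<noteq> 0" for i using Gamma_real_pos[OF alpha1[of i]] by simp
  then show ?thesis using kernel_monomial[OF assms, of "\<lambda>_. 0"] by simp
qed

lemma laguerre_poly_eq:
  assumes "x \<in> orthant"
  shows "laguerre_poly \<alpha> k x = (\<Prod>i\<in>UNIV. Gamma (real (k $ i) + \<alpha> $ i + 1) / fact (k $ i)) * (\<Prod>i\<in>UNIV. laguerre_sum (\<alpha> $ i) (k $ i) (x $ i))"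
  unfolding laguerre_poly_def prod.distrib[symmetric]
  using assms by (intro prod.cong refl laguerre_poly1_eq alpha) (auto simp: orthant_def)

lemma laguerre_poly_measurable [measurable]: "laguerre_poly \<alpha> k \<in> borel_measurable \<mu>"
proof -
  have "(\<lambda>x::real ^ 'd. (\<Prod>i\<in>UNIV. Gamma (real (k $ i) + \<alpha> $ i + 1) / fact (k $ i)) * (\<Prod>i\<in>UNIV. laguerre_sum (\<alpha> $ i) (k $ i) (x $ i))) \<in> borel_measurable \<mu>"
    by (rule measurable_laguerre_measure1) measurable
  then show ?thesis by (subst measurable_cong) (auto simp: laguerre_poly_eq)
qed

lemma kernel_eigen:
  assumes t: "t > 0" and x: "x \<in> orthant"
  shows "has_bochner_integral \<mu> (\<lambda>y. laguerre_kernel \<alpha> t x y * laguerre_poly \<alpha> k y) (exp (- t) ^ (\<Sum>i\<in>UNIV. k $ i) * laguerre_poly \<alpha> k x)"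
proof -
  define c where "c = (\<Prod>i\<in>UNIV. Gamma (real (k $ i) + \<alpha> $ i + 1) / fact (k $ i))"
  have "has_bochner_integral \<mu> (\<lambda>y. \<Prod>i\<in>UNIV. laguerre_kernel1 (\<alpha> $ i) t (x $ i) (y $ i) * laguerre_sum (\<alpha> $ i) (k $ i) (y $ i))
    (\<Prod>i\<in>UNIV. exp (- t) ^ (k $ i) * laguerre_sum (\<alpha> $ i) (k $ i) (x $ i))"
  proof (rule has_bochner_integral_laguerre_prod)
    fix i
    have "x $ i > 0" using x by (simp add: orthant_def)
    from laguerre_sum_eigen[OF alpha t this, of i "k $ i"]
    show "has_bochner_integral lborel (\<lambda>y. laguerre_weight (\<alpha> $ i) y * (laguerre_kernel1 (\<alpha> $ i) t (x $ i) y * laguerre_sum (\<alpha> $ i) (k $ i) y))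
      (exp (- t) ^ (k $ i) * laguerre_sum (\<alpha> $ i) (k $ i) (x $ i))"
      by (simp add: mult.assoc)
  qed measurable
  then have "has_bochner_integral \<mu> (\<lambda>y. c * (\<Prod>i\<in>UNIV. laguerre_kernel1 (\<alpha> $ i) t (x $ i) (y $ i) * laguerre_sum (\<alpha> $ i) (k $ i) (y $ i)))
    (c * (\<Prod>i\<in>UNIV. exp (- t) ^ (k $ i) * laguerre_sum (\<alpha> $ i) (k $ i) (x $ i)))"
    by (rule has_bochner_integral_mult_right)
  moreover have "c * (\<Prod>i\<in>UNIV. exp (- t) ^ (k $ i) * laguerre_sum (\<alpha> $ i) (k $ i) (x $ i)) = exp (- t) ^ (\<Sum>i\<in>UNIV. k $ i) * laguerre_poly \<alpha> k x"
    using x by (simp add: laguerre_poly_eq c_def prod.distrib power_sum)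
  moreover have "c * (\<Prod>i\<in>UNIV. laguerre_kernel1 (\<alpha> $ i) t (x $ i) (y $ i) * laguerre_sum (\<alpha> $ i) (k $ i) (y $ i)) = laguerre_kernel \<alpha> t x y * laguerre_poly \<alpha> k y"
    if "y \<in> space \<mu>" for y
    using that by (simp add: laguerre_poly_eq c_def kernel_eq prod.distrib)
  ultimately show ?thesis
    by (subst has_bochner_integral_cong[OF refl _ refl, where g="\<lambda>y. c * (\<Prod>i\<in>UNIV. laguerre_kernel1 (\<alpha> $ i) t (x $ i) (y $ i) * laguerre_sum (\<alpha> $ i) (k $ i) (y $ i))"]) auto
qed

end

section \<open>Density of the polynomials\<close>

lemma abs_add_powr_le:
  fixes a b p :: real
  assumes "p \<ge> 0"
  shows "\<bar>a + b\<bar> powr p \<le> 2 powr p * (\<bar>a\<bar> powr p + \<bar>b\<bar> powr p)"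
proof -
  define m where "m = max \<bar>a\<bar> \<bar>b\<bar>"
  have "\<bar>a + b\<bar> powr p \<le> (2 * m) powr p"
    using assms by (intro powr_mono2) (auto simp: m_def)
  also have "\<dots> = 2 powr p * m powr p" by (rule powr_mult)
  also have "m powr p \<le> \<bar>a\<bar> powr p + \<bar>b\<bar> powr p" by (auto simp: m_def max_def)
  finally show ?thesis by simp
qed

context laguerre
begin

text \<open>Equality is required on the orthant only: elsewhere \<open>powr\<close> and
  \<open>deriv\<close> give \<open>laguerre_poly\<close> values without meaning, and \<mu> does not
  see them.\<close>

definition "laguerre_polys = {q. \<exists>K c. finite K \<and> (\<forall>x\<in>orthant. q x = laguerre_comb \<alpha> K c x)}"

lemma laguerre_comb_measurable [measurable]: "laguerre_comb \<alpha> K c \<in> borel_measurable \<mu>"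
  unfolding laguerre_comb_def[abs_def] by measurable

lemma laguerre_polys_measurable: "q \<in> laguerre_polys \<Longrightarrow> q \<in> borel_measurable \<mu>"
proof -
  assume "q \<in> laguerre_polys"
  then obtain K c where "\<And>x. x \<in> orthant \<Longrightarrow> q x = laguerre_comb \<alpha> K c x"
    by (auto simp: laguerre_polys_def)
  then show ?thesis
    by (subst measurable_cong[where g="laguerre_comb \<alpha> K c"]) auto
qed

lemma laguerre_polys_add:
  assumes "q \<in> laguerre_polys" "q' \<in> laguerre_polys"
  shows "(\<lambda>x. q x + q' x) \<in> laguerre_polys"
proof -
  obtain K c where K: "finite K" "\<And>x. x \<in> orthant \<Longrightarrow> q x = laguerre_comb \<alpha> K c x"
    using assms(1) by (auto simp: laguerre_polys_def)
  obtain K' c' where K': "finite K'" "\<And>x. x \<in> orthant \<Longrightarrow> q' x = laguerre_comb \<alpha> K' c' x"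
    using assms(2) by (auto simp: laguerre_polys_def)
  define d where "d k = (if k \<in> K then c k else 0) + (if k \<in> K' then c' k else 0)" for k
  have "laguerre_comb \<alpha> (K \<union> K') d x = laguerre_comb \<alpha> K c x + laguerre_comb \<alpha> K' c' x" for x
  proof -
    have "laguerre_comb \<alpha> (K \<union> K') d x = (\<Sum>k\<in>K \<union> K'. (if k \<in> K then c k * laguerre_poly \<alpha> k x else 0)) + (\<Sum>k\<in>K \<union> K'. (if k \<in> K' then c' k * laguerre_poly \<alpha> k x else 0))"
      unfolding laguerre_comb_def d_def sum.distrib[symmetric] by (intro sum.cong refl) (auto simp: algebra_simps)
    also have "\<dots> = (\<Sum>k\<in>(K \<union> K') \<inter> K. c k * laguerre_poly \<alpha> k x) + (\<Sum>k\<in>(K \<union> K') \<inter> K'. c' k * laguerre_poly \<alpha> k x)"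
      using K K' by (intro arg_cong2[where f="(+)"] sum.inter_restrict[symmetric]) auto
    finally have "laguerre_comb \<alpha> (K \<union> K') d x = (\<Sum>k\<in>(K \<union> K') \<inter> K. c k * laguerre_poly \<alpha> k x) + (\<Sum>k\<in>(K \<union> K') \<inter> K'. c' k * laguerre_poly \<alpha> k x)" .
    moreover have "(K \<union> K') \<inter> K = K" "(K \<union> K') \<inter> K' = K'" by auto
    ultimately show ?thesis by (simp add: laguerre_comb_def)
  qed
  then show ?thesis using K K' unfolding laguerre_polys_def mem_Collect_eq
    by (intro exI[of _ "K \<union> K'"] exI[of _ d]) auto
qed

lemma laguerre_polys_scale:
  assumes "q \<in> laguerre_polys"
  shows "(\<lambda>x. r * q x) \<in> laguerre_polys"
proof -
  obtain K c where K: "finite K" "\<And>x. x \<in> orthant \<Longrightarrow> q x = laguerre_comb \<alpha> K c x"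
    using assms(1) by (auto simp: laguerre_polys_def)
  then show ?thesis unfolding laguerre_polys_def mem_Collect_eq
    by (intro exI[of _ K] exI[of _ "\<lambda>k. r * c k"]) (auto simp: laguerre_comb_def sum_distrib_left mult.assoc)
qed

definition monomial :: "('d \<Rightarrow> nat) \<Rightarrow> real ^ 'd \<Rightarrow> real" where
  "monomial k x = (\<Prod>i\<in>UNIV. x $ i ^ k i)"

lemma monomial_measurable [measurable]: "monomial k \<in> borel_measurable borel"
  unfolding monomial_def[abs_def] by measurable

lemma monomial_nonneg: "x \<in> orthant \<Longrightarrow> monomial k x \<ge> 0"
  unfolding monomial_def by (intro prod_nonneg zero_le_power) (auto simp: orthant_def less_imp_le)

text \<open>One-dimensional inversion in each coordinate; multiplying out the product of sums yields
  the multi-indices below \<open>k\<close>.\<close>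

lemma monomial_polys: "monomial k \<in> laguerre_polys"
proof -
  define d where "d i j = Gamma (real (k i) + \<alpha> $ i + 1) * (real (k i choose j) * (-1) ^ j) * (fact j / Gamma (real j + \<alpha> $ i + 1))" for i j
  have e: "x $ i ^ k i = (\<Sum>j\<le>k i. d i j * laguerre_poly1 (\<alpha> $ i) j (x $ i))" if "x \<in> orthant" for x i
  proof -
    have "Gamma (real j + \<alpha> $ i + 1) \<noteq> 0" for j
    proof -
      have "real j + \<alpha> $ i + 1 > 0" using alpha1[of i] of_nat_0_le_iff[of j] by linarith
      from Gamma_real_pos[OF this] show ?thesis by (metis less_irrefl)
    qed
    moreover have "x $ i > 0" using that by (simp add: orthant_def)
    ultimately have "d i j * laguerre_poly1 (\<alpha> $ i) j (x $ i) = Gamma (real (k i) + \<alpha> $ i + 1) * (real (k i choose j) * (-1) ^ j * laguerre_sum (\<alpha> $ i) j (x $ i))" for j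
      unfolding d_def laguerre_poly1_eq[OF alpha \<open>x $ i > 0\<close>] by simp
    then show ?thesis
      unfolding laguerre_sum_inversion[OF alpha[of i], of "x $ i" "k i"] sum_distrib_left by simp
  qed
  define P where "P = PiE (UNIV :: 'd set) (\<lambda>i. {..k i})"
  have P: "finite P" unfolding P_def by (intro finite_PiE) auto
  have inj: "inj_on (\<lambda>g. (\<chi> i. g i) :: nat ^ 'd) P" by (auto simp: inj_on_def vec_eq_iff)
  have "monomial k x = laguerre_comb \<alpha> ((\<lambda>g. \<chi> i. g i) ` P) (\<lambda>v. \<Prod>i\<in>UNIV. d i (v $ i)) x" if x: "x \<in> orthant" for x
  proof -
    have "monomial k x = (\<Prod>i\<in>UNIV. \<Sum>j\<le>k i. d i j * laguerre_poly1 (\<alpha> $ i) j (x $ i))"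
      unfolding monomial_def using e[OF x] by (intro prod.cong refl) simp
    also have "\<dots> = (\<Sum>g\<in>P. \<Prod>i\<in>UNIV. d i (g i) * laguerre_poly1 (\<alpha> $ i) (g i) (x $ i))"
      unfolding P_def by (intro prod_sum_PiE) auto
    also have "\<dots> = laguerre_comb \<alpha> ((\<lambda>g. \<chi> i. g i) ` P) (\<lambda>v. \<Prod>i\<in>UNIV. d i (v $ i)) x"
      unfolding laguerre_comb_def sum.reindex[OF inj] by (simp add: laguerre_poly_def prod.distrib)
    finally show ?thesis .
  qed
  then show ?thesis unfolding laguerre_polys_def using P by blast
qed

text \<open>Closeness is measured by the integral of the p-th power itself. No norm is formed, so a
  triangle inequality with the factor 2^p suffices.\<close>

definition approximable :: "real \<Rightarrow> (real ^ 'd \<Rightarrow> real) \<Rightarrow> bool" where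
  "approximable p f \<longleftrightarrow> f \<in> borel_measurable \<mu> \<and>
     (\<forall>e>0. \<exists>q\<in>laguerre_polys. (\<integral>\<^sup>+x. ennreal (\<bar>q x - f x\<bar> powr p) \<partial>\<mu>) \<le> ennreal e)"

lemma nn_integral_add_powr_le:
  assumes [measurable]: "f \<in> borel_measurable \<mu>" "g \<in> borel_measurable \<mu>" and p: "p \<ge> 0"
  shows "(\<integral>\<^sup>+x. ennreal (\<bar>f x + g x\<bar> powr p) \<partial>\<mu>) \<le>
    ennreal (2 powr p) * ((\<integral>\<^sup>+x. ennreal (\<bar>f x\<bar> powr p) \<partial>\<mu>) + (\<integral>\<^sup>+x. ennreal (\<bar>g x\<bar> powr p) \<partial>\<mu>))"
proof -
  have "(\<integral>\<^sup>+x. ennreal (\<bar>f x + g x\<bar> powr p) \<partial>\<mu>) \<le> (\<integral>\<^sup>+x. ennreal (2 powr p) * (ennreal (\<bar>f x\<bar> powr p) + ennreal (\<bar>g x\<bar> powr p)) \<partial>\<mu>)"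
    using abs_add_powr_le[OF p] by (intro nn_integral_mono) (simp flip: ennreal_plus ennreal_mult')
  also have "\<dots> = ennreal (2 powr p) * ((\<integral>\<^sup>+x. ennreal (\<bar>f x\<bar> powr p) \<partial>\<mu>) + (\<integral>\<^sup>+x. ennreal (\<bar>g x\<bar> powr p) \<partial>\<mu>))"
    by (subst nn_integral_cmult, measurable, subst nn_integral_add, measurable)
  finally show ?thesis .
qed

lemma approximable_polys: "q \<in> laguerre_polys \<Longrightarrow> p > 0 \<Longrightarrow> approximable p q"
  unfolding approximable_def using laguerre_polys_measurable by (auto intro!: bexI[of _ q])

lemma approximable_cong:
  assumes "approximable p f" "\<And>x. x \<in> orthant \<Longrightarrow> f x = g x"
  shows "approximable p g"
proof -
  have "(\<integral>\<^sup>+x. ennreal (\<bar>q x - f x\<bar> powr p) \<partial>\<mu>) = (\<integral>\<^sup>+x. ennreal (\<bar>q x - g x\<bar> powr p) \<partial>\<mu>)" for q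
    using assms(2) by (intro nn_integral_cong) auto
  moreover have "f \<in> borel_measurable \<mu> \<longleftrightarrow> g \<in> borel_measurable \<mu>"
    using assms(2) by (intro measurable_cong) auto
  ultimately show ?thesis using assms(1) by (simp add: approximable_def)
qed

lemma approximable_add:
  assumes f: "approximable p f" and g: "approximable p g" and p: "p > 0"
  shows "approximable p (\<lambda>x. f x + g x)"
  unfolding approximable_def
proof safe
  have [measurable]: "f \<in> borel_measurable \<mu>" "g \<in> borel_measurable \<mu>" using f g by (auto simp: approximable_def)
  show "(\<lambda>x. f x + g x) \<in> borel_measurable \<mu>" by measurable
  fix e :: real assume e: "e > 0"
  \<comment> \<open>Two errors of size \<open>d\<close>, multiplied by the factor 2^p of
    \<open>nn_integral_add_powr_le\<close>, add up to \<open>e\<close>.\<close>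
  define d where "d = e / (2 * 2 powr p)"
  have d: "d > 0" using e by (simp add: d_def)
  obtain q where q: "q \<in> laguerre_polys" "(\<integral>\<^sup>+x. ennreal (\<bar>q x - f x\<bar> powr p) \<partial>\<mu>) \<le> ennreal d"
    using f d by (auto simp: approximable_def)
  obtain q' where q': "q' \<in> laguerre_polys" "(\<integral>\<^sup>+x. ennreal (\<bar>q' x - g x\<bar> powr p) \<partial>\<mu>) \<le> ennreal d"
    using g d by (auto simp: approximable_def)
  have [measurable]: "q \<in> borel_measurable \<mu>" "q' \<in> borel_measurable \<mu>"
    using q q' laguerre_polys_measurable by auto
  have "(\<integral>\<^sup>+x. ennreal (\<bar>(q x + q' x) - (f x + g x)\<bar> powr p) \<partial>\<mu>) = (\<integral>\<^sup>+x. ennreal (\<bar>(q x - f x) + (q' x - g x)\<bar> powr p) \<partial>\<mu>)"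
    by (simp add: algebra_simps)
  also have "\<dots> \<le> ennreal (2 powr p) * ((\<integral>\<^sup>+x. ennreal (\<bar>q x - f x\<bar> powr p) \<partial>\<mu>) + (\<integral>\<^sup>+x. ennreal (\<bar>q' x - g x\<bar> powr p) \<partial>\<mu>))"
    using p by (intro nn_integral_add_powr_le) auto
  also have "\<dots> \<le> ennreal (2 powr p) * (ennreal d + ennreal d)"
    using q q' by (intro mult_left_mono add_mono) auto
  also have "\<dots> = ennreal e"
    using d by (simp add: d_def flip: ennreal_plus ennreal_mult')
  finally show "\<exists>q\<in>laguerre_polys. (\<integral>\<^sup>+x. ennreal (\<bar>q x - (f x + g x)\<bar> powr p) \<partial>\<mu>) \<le> ennreal e"
    using laguerre_polys_add[OF q(1) q'(1)] by (intro bexI[of _ "\<lambda>x. q x + q' x"]) auto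
qed

lemma approximable_scale:
  assumes f: "approximable p f" and p: "p > 0"
  shows "approximable p (\<lambda>x. r * f x)"
  unfolding approximable_def
proof safe
  have [measurable]: "f \<in> borel_measurable \<mu>" using f by (auto simp: approximable_def)
  show "(\<lambda>x. r * f x) \<in> borel_measurable \<mu>" by measurable
  fix e :: real assume e: "e > 0"
  \<comment> \<open>The summand 1 covers r = 0.\<close>
  define d where "d = e / (\<bar>r\<bar> powr p + 1)"
  have d: "d > 0" using e by (simp add: d_def add_nonneg_pos)
  obtain q where q: "q \<in> laguerre_polys" "(\<integral>\<^sup>+x. ennreal (\<bar>q x - f x\<bar> powr p) \<partial>\<mu>) \<le> ennreal d"
    using f d by (auto simp: approximable_def)
  have [measurable]: "q \<in> borel_measurable \<mu>"
    using q laguerre_polys_measurable by auto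
  have "(\<integral>\<^sup>+x. ennreal (\<bar>r * q x - r * f x\<bar> powr p) \<partial>\<mu>) = (\<integral>\<^sup>+x. ennreal (\<bar>r\<bar> powr p) * ennreal (\<bar>q x - f x\<bar> powr p) \<partial>\<mu>)"
    by (simp add: abs_mult powr_mult flip: ennreal_mult' right_diff_distrib)
  also have "\<dots> = ennreal (\<bar>r\<bar> powr p) * (\<integral>\<^sup>+x. ennreal (\<bar>q x - f x\<bar> powr p) \<partial>\<mu>)"
    by (rule nn_integral_cmult) measurable
  also have "\<dots> \<le> ennreal (\<bar>r\<bar> powr p) * ennreal d" using q by (intro mult_left_mono) auto
  also have "\<dots> = ennreal (\<bar>r\<bar> powr p * d)" by (simp add: ennreal_mult')
  also have "\<bar>r\<bar> powr p * d \<le> (\<bar>r\<bar> powr p + 1) * d" using d by (intro mult_right_mono) auto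
  also have "\<dots> = e"
  proof -
    have "\<bar>r\<bar> powr p + 1 > 0" by (intro add_nonneg_pos) auto
    then show ?thesis by (simp add: d_def)
  qed
  finally show "\<exists>q\<in>laguerre_polys. (\<integral>\<^sup>+x. ennreal (\<bar>q x - r * f x\<bar> powr p) \<partial>\<mu>) \<le> ennreal e"
    using laguerre_polys_scale[OF q(1)] by (intro bexI[of _ "\<lambda>x. r * q x"]) (auto simp: ennreal_leI)
qed

lemma approximable_limit:
  assumes f: "\<And>n. approximable p (f n)" and g[measurable]: "g \<in> borel_measurable \<mu>" and p: "p > 0"
    and H[measurable]: "H \<in> borel_measurable \<mu>" and Hf: "(\<integral>\<^sup>+x. ennreal (H x powr p) \<partial>\<mu>) < \<infinity>"
    and b: "\<And>n x. x \<in> orthant \<Longrightarrow> \<bar>f n x - g x\<bar> \<le> H x"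
    and l: "AE x in \<mu>. (\<lambda>n. f n x) \<longlonglongrightarrow> g x"
  shows "approximable p g"
  unfolding approximable_def
proof safe
  fix e :: real assume e: "e > 0"
  have [measurable]: "f n \<in> borel_measurable \<mu>" for n using f by (auto simp: approximable_def)
  define d where "d = e / (2 * 2 powr p)"
  have d: "d > 0" using e by (simp add: d_def)
  have "(\<lambda>n. \<integral>\<^sup>+x. ennreal (\<bar>f n x - g x\<bar> powr p) \<partial>\<mu>) \<longlonglongrightarrow> (\<integral>\<^sup>+x. 0 \<partial>\<mu>)"
  proof (rule nn_integral_dominated_convergence[where w="\<lambda>x. ennreal (H x powr p)"])
    show "AE x in \<mu>. ennreal (\<bar>f n x - g x\<bar> powr p) \<le> ennreal (H x powr p)" for n
      using b p by (intro AE_I2 ennreal_leI powr_mono2) auto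
    show "AE x in \<mu>. (\<lambda>n. ennreal (\<bar>f n x - g x\<bar> powr p)) \<longlonglongrightarrow> 0"
      using l
    proof eventually_elim
      case (elim x)
      have "(\<lambda>n. \<bar>f n x - g x\<bar> powr p) \<longlonglongrightarrow> 0"
        using p by (intro tendsto_zero_powrI[where b=p] tendsto_const) (use tendsto_rabs[OF LIM_zero[OF elim]] in auto)
      then show ?case using tendsto_ennrealI by fastforce
    qed
  qed (use Hf in auto)
  then have "eventually (\<lambda>n. (\<integral>\<^sup>+x. ennreal (\<bar>f n x - g x\<bar> powr p) \<partial>\<mu>) < ennreal d) sequentially"
    using d by (intro order_tendstoD) auto
  then obtain n where n: "(\<integral>\<^sup>+x. ennreal (\<bar>f n x - g x\<bar> powr p) \<partial>\<mu>) < ennreal d"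
    by (auto simp: eventually_sequentially)
  obtain q where q: "q \<in> laguerre_polys" "(\<integral>\<^sup>+x. ennreal (\<bar>q x - f n x\<bar> powr p) \<partial>\<mu>) \<le> ennreal d"
    using f[of n] d by (auto simp: approximable_def)
  have [measurable]: "q \<in> borel_measurable \<mu>"
    using q laguerre_polys_measurable by auto
  have "(\<integral>\<^sup>+x. ennreal (\<bar>q x - g x\<bar> powr p) \<partial>\<mu>) = (\<integral>\<^sup>+x. ennreal (\<bar>(q x - f n x) + (f n x - g x)\<bar> powr p) \<partial>\<mu>)"
    by simp
  also have "\<dots> \<le> ennreal (2 powr p) * ((\<integral>\<^sup>+x. ennreal (\<bar>q x - f n x\<bar> powr p) \<partial>\<mu>) + (\<integral>\<^sup>+x. ennreal (\<bar>f n x - g x\<bar> powr p) \<partial>\<mu>))"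
    using p by (intro nn_integral_add_powr_le) auto
  also have "\<dots> \<le> ennreal (2 powr p) * (ennreal d + ennreal d)"
    using q n by (intro mult_left_mono add_mono) auto
  also have "\<dots> = ennreal e"
    using d by (simp add: d_def flip: ennreal_plus ennreal_mult')
  finally show "\<exists>q\<in>laguerre_polys. (\<integral>\<^sup>+x. ennreal (\<bar>q x - g x\<bar> powr p) \<partial>\<mu>) \<le> ennreal e"
    using q(1) by blast
qed fact

lemma monomial_le_exp:
  assumes e: "e > 0"
  shows "\<exists>C\<ge>0. \<forall>x\<in>orthant. monomial k x \<le> C * exp (\<Sum>i\<in>UNIV. e * x $ i)"
proof -
  have "monomial k x \<le> (\<Prod>i\<in>UNIV. fact (k i) / e ^ k i) * exp (\<Sum>i\<in>UNIV. e * x $ i)" if x: "x \<in> orthant" for x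
  proof -
    have "y ^ n \<le> fact n / e ^ n * exp (e * y)" if "y > 0" for y :: real and n
    proof -
      have "(e * y) ^ n / fact n \<le> exp (e * y)"
        using sum_le_suminf[OF summable_exp[of "e * y"], of "{n}"] that e
        by (simp add: exp_def scaleR_conv_of_real divide_inverse mult.commute)
      then show ?thesis using e by (simp add: field_simps power_mult_distrib)
    qed
    then have "monomial k x \<le> (\<Prod>i\<in>UNIV. fact (k i) / e ^ k i * exp (e * x $ i))"
      unfolding monomial_def using x by (intro prod_mono) (auto simp: orthant_def less_imp_le)
    also have "\<dots> = (\<Prod>i\<in>UNIV. fact (k i) / e ^ k i) * exp (\<Sum>i\<in>UNIV. e * x $ i)"
      unfolding exp_sum[OF finite_class.finite_UNIV] by (rule prod.distrib)
    finally show ?thesis .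
  qed
  then show ?thesis using e by (intro exI[of _ "\<Prod>i\<in>UNIV. fact (k i) / e ^ k i"]) (auto intro!: prod_nonneg)
qed

text \<open>The power p multiplies the rates, so a function of rate c lies in L^p as soon as p c <
  1.\<close>

lemma exp_powr_finite:
  assumes p: "p > 0" and c: "\<And>i. p * c i < 1"
  shows "(\<integral>\<^sup>+x. ennreal ((A * exp (\<Sum>i\<in>UNIV. c i * x $ i)) powr p) \<partial>\<mu>) < \<infinity>"
proof -
  define c' where "c' = (\<chi> i. p * c i)"
  have i: "integrable \<mu> (\<lambda>x. exp (\<Sum>i\<in>UNIV. c' $ i * x $ i))"
    using has_bochner_integral_laguerre_exp[of c'] c by (auto simp: has_bochner_integral_iff c'_def)
  have "(A * exp (\<Sum>i\<in>UNIV. c i * x $ i)) powr p = A powr p * exp (\<Sum>i\<in>UNIV. c' $ i * x $ i)" for x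
    by (simp add: powr_mult c'_def powr_def[of "exp _"] sum_distrib_left mult_ac)
  then have "(\<integral>\<^sup>+x. ennreal ((A * exp (\<Sum>i\<in>UNIV. c i * x $ i)) powr p) \<partial>\<mu>) = (\<integral>\<^sup>+x. ennreal (A powr p * exp (\<Sum>i\<in>UNIV. c' $ i * x $ i)) \<partial>\<mu>)"
    by simp
  also have "\<dots> < \<infinity>"
    using i by (subst nn_integral_eq_integral) auto
  finally show ?thesis .
qed

text \<open>Requiring the approximation of all products with monomials makes the class closed under multiplication
  by \<open>exp (- c x\<^sub>i)\<close>, through the Taylor series of the exponential for small \<open>c\<close>.\<close>

definition "stable_class p = {h. h \<in> borel_measurable borel \<and> (\<exists>B. \<forall>x. \<bar>h x\<bar> \<le> B) \<and> (\<forall>k. approximable p (\<lambda>x. h x * monomial k x))}"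

lemma stable_class_one: "p > 0 \<Longrightarrow> (\<lambda>_. 1) \<in> stable_class p"
  unfolding stable_class_def using approximable_polys[OF monomial_polys] by (auto intro!: exI[of _ 1])

lemma stable_class_add:
  assumes p: "p > 0" and g: "g \<in> stable_class p" and h: "h \<in> stable_class p"
  shows "(\<lambda>x. g x + h x) \<in> stable_class p"
proof -
  obtain B B' where B: "\<And>x. \<bar>g x\<bar> \<le> B" "\<And>x. \<bar>h x\<bar> \<le> B'" using g h by (auto simp: stable_class_def)
  have "\<bar>g x + h x\<bar> \<le> B + B'" for x using B(1)[of x] B(2)[of x] by linarith
  then show ?thesis
    using g h approximable_add[OF _ _ p] unfolding stable_class_def by (auto simp: distrib_right)
qed

lemma stable_class_scale:
  assumes p: "p > 0" and h: "h \<in> stable_class p"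
  shows "(\<lambda>x. r * h x) \<in> stable_class p"
proof -
  obtain B where B: "\<And>x. \<bar>h x\<bar> \<le> B" using h by (auto simp: stable_class_def)
  have "\<bar>r * h x\<bar> \<le> \<bar>r\<bar> * B" for x using B[of x] by (simp add: abs_mult mult_left_mono)
  then show ?thesis
    using h approximable_scale[OF _ p] unfolding stable_class_def by (auto simp: mult.assoc)
qed

lemma stable_class_diff:
  assumes p: "p > 0" and g: "g \<in> stable_class p" and h: "h \<in> stable_class p"
  shows "(\<lambda>x. g x - h x) \<in> stable_class p"
  using stable_class_add[OF p g stable_class_scale[OF p h, of "-1"]] by simp

lemma stable_class_limit:
  assumes p: "p > 0" and f: "\<And>n. f n \<in> stable_class p" and B: "\<And>n x. \<bar>f n x\<bar> \<le> B" "\<And>x. \<bar>g x\<bar> \<le> B"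
    and g[measurable]: "g \<in> borel_measurable borel" and l: "AE x in \<mu>. (\<lambda>n. f n x) \<longlonglongrightarrow> g x"
  shows "g \<in> stable_class p"
proof -
  have B0: "B \<ge> 0" using order_trans[OF abs_ge_zero B(2)] .
  have "approximable p (\<lambda>x. g x * monomial k x)" for k
  proof -
    \<comment> \<open>Monomials are dominated by an exponential of arbitrarily small rate; this rate
      uses up half of what integrability of the p-th power permits.\<close>
    define e where "e = 1 / (2 * p)"
    have e: "e > 0" "p * e < 1" using p by (auto simp: e_def)
    obtain C where C: "C \<ge> 0" "\<And>x. x \<in> orthant \<Longrightarrow> monomial k x \<le> C * exp (\<Sum>i\<in>UNIV. e * x $ i)"
      using monomial_le_exp[OF e(1)] by blast
    show ?thesis
    proof (rule approximable_limit[OF _ _ p, where f="\<lambda>n x. f n x * monomial k x" and H="\<lambda>x. (2 * B * C) * exp (\<Sum>i\<in>UNIV. e * x $ i)"])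
      show "approximable p (\<lambda>x. f n x * monomial k x)" for n using f by (auto simp: stable_class_def)
      show "(\<lambda>x. g x * monomial k x) \<in> borel_measurable \<mu>" by (rule measurable_laguerre_measure1) measurable
      show "(\<lambda>x. 2 * B * C * exp (\<Sum>i\<in>UNIV. e * x $ i)) \<in> borel_measurable \<mu>" by (rule measurable_laguerre_measure1) measurable
      show "(\<integral>\<^sup>+x. ennreal ((2 * B * C * exp (\<Sum>i\<in>UNIV. e * x $ i)) powr p) \<partial>\<mu>) < \<infinity>"
        by (rule exp_powr_finite[OF p e(2)])
      fix n x assume x: "x \<in> (orthant :: (real ^ 'd) set)"
      then have m: "monomial k x \<ge> 0" by (rule monomial_nonneg)
      have "\<bar>f n x - g x\<bar> \<le> 2 * B" using B(1)[of n x] B(2)[of x] by linarith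
      then have "\<bar>f n x * monomial k x - g x * monomial k x\<bar> \<le> (2 * B) * monomial k x"
        using m by (simp add: abs_mult mult_right_mono flip: left_diff_distrib)
      also have "\<dots> \<le> (2 * B) * (C * exp (\<Sum>i\<in>UNIV. e * x $ i))"
        using C(2)[OF x] B0 by (intro mult_left_mono) auto
      finally show "\<bar>f n x * monomial k x - g x * monomial k x\<bar> \<le> 2 * B * C * exp (\<Sum>i\<in>UNIV. e * x $ i)" by simp
    next
      show "AE x in \<mu>. (\<lambda>n. f n x * monomial k x) \<longlonglongrightarrow> g x * monomial k x"
        using l by eventually_elim (intro tendsto_intros)
    qed
  qed
  then show ?thesis using B g by (auto simp: stable_class_def)
qed

lemma stable_class_cong:
  assumes h: "h \<in> stable_class p" and g: "g \<in> borel_measurable borel" "\<And>x. \<bar>g x\<bar> \<le> B"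
    and e: "\<And>x. x \<in> orthant \<Longrightarrow> g x = h x"
  shows "g \<in> stable_class p"
proof -
  have "approximable p (\<lambda>x. g x * monomial k x)" for k
    by (rule approximable_cong[of p "\<lambda>x. h x * monomial k x"]) (use h e in \<open>auto simp: stable_class_def\<close>)
  then show ?thesis using g by (auto simp: stable_class_def)
qed

text \<open>The Taylor partial sums of exp (- c x_i) are dominated only by exp (c x_i), so
  \<open>c\<close> must fit under the integrability threshold next to the monomial. With half of it
  spent on the monomial, 2 p c < 1 is what remains. The absolute value keeps the function bounded
  off the orthant.\<close>

lemma stable_class_exp_small:
  assumes p: "p > 0" and h: "h \<in> stable_class p" and c: "c \<ge> 0" "p * (2 * c) < 1"
  shows "(\<lambda>x. h x * exp (- (c * \<bar>x $ i\<bar>))) \<in> stable_class p"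
proof -
  have hm[measurable]: "h \<in> borel_measurable borel" using h by (simp add: stable_class_def)
  obtain B where B: "\<And>x. \<bar>h x\<bar> \<le> B" using h by (auto simp: stable_class_def)
  have B0: "B \<ge> 0" using order_trans[OF abs_ge_zero B] .
  have "approximable p (\<lambda>x. h x * exp (- (c * \<bar>x $ i\<bar>)) * monomial k x)" for k
  proof -
    define e where "e = 1 / (2 * p)"
    have e: "e > 0" "p * (e + c) < 1" "p * e < 1" using p c by (auto simp: e_def distrib_left)
    obtain C where C: "C \<ge> 0" "\<And>x. x \<in> orthant \<Longrightarrow> monomial k x \<le> C * exp (\<Sum>i\<in>UNIV. e * x $ i)"
      using monomial_le_exp[OF e(1)] by blast
    define c' where "c' j = e + (if j = i then c else 0)" for j
    have c': "p * c' j < 1" for j using e by (simp add: c'_def)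
    have se: "exp (\<Sum>j\<in>UNIV. c' j * x $ j) = exp (\<Sum>j\<in>UNIV. e * x $ j) * exp (c * x $ i)" for x :: "real ^ 'd"
    proof -
      have "(\<Sum>j\<in>UNIV. c' j * x $ j) = (\<Sum>j\<in>UNIV. e * x $ j) + (\<Sum>j\<in>UNIV. if j = i then c * x $ i else 0)"
        unfolding sum.distrib[symmetric] by (intro sum.cong refl) (auto simp: c'_def distrib_right)
      then show ?thesis by (simp add: exp_add)
    qed
    define s where "s n x = (\<Sum>j<n. inverse (fact j) * (- (c * x)) ^ j)" for n x
    have sb: "\<bar>s n y\<bar> \<le> exp (c * y)" if "y > 0" for n y
    proof -
      have "\<bar>s n y\<bar> \<le> (\<Sum>j<n. inverse (fact j) * (c * y) ^ j)"
        unfolding s_def using c(1) that by (intro order_trans[OF sum_abs] sum_mono) (auto simp: abs_mult power_abs)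
      also have "\<dots> \<le> (\<Sum>j. inverse (fact j) * (c * y) ^ j)"
        using c(1) that by (intro sum_le_suminf summable_exp) auto
      also have "\<dots> = exp (c * y)" by (simp add: exp_def scaleR_conv_of_real)
      finally show ?thesis .
    qed
    show ?thesis
    proof (rule approximable_limit[OF _ _ p, where f="\<lambda>n x. h x * s n (x $ i) * monomial k x" and H="\<lambda>x. (2 * B * C) * exp (\<Sum>j\<in>UNIV. c' j * x $ j)"])
      \<comment> \<open>A Taylor polynomial in x_i times a monomial is a combination of monomials;
        multiplied by \<open>h\<close> each of them is approximable by membership in the
        class.\<close>
      show "approximable p (\<lambda>x. h x * s n (x $ i) * monomial k x)" for n
      proof (induction n)
        case 0
        have "approximable p (\<lambda>x. 0 * (h x * monomial k x))"
          using h by (intro approximable_scale p) (auto simp: stable_class_def)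
        then show ?case by (simp add: s_def)
      next
        case (Suc n)
        define k' where "k' j = k j + (if j = i then n else 0)" for j
        have mk: "monomial k' x = monomial k x * x $ i ^ n" for x
        proof -
          have "monomial k' x = monomial k x * (\<Prod>j\<in>UNIV. if j = i then x $ i ^ n else 1)"
            unfolding monomial_def prod.distrib[symmetric] by (intro prod.cong refl) (auto simp: k'_def power_add)
          then show ?thesis by simp
        qed
        have "approximable p (\<lambda>x. h x * s n (x $ i) * monomial k x + (inverse (fact n) * (- c) ^ n) * (h x * monomial k' x))"
          using h by (intro approximable_add approximable_scale p Suc.IH) (auto simp: stable_class_def)
        moreover have "h x * s n (x $ i) * monomial k x + (inverse (fact n) * (- c) ^ n) * (h x * monomial k' x) = h x * s (Suc n) (x $ i) * monomial k x" for x
        proof -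
          have "s (Suc n) y = s n y + inverse (fact n) * (- c) ^ n * y ^ n" for y
          proof -
            have "(- (c * y)) ^ n = (- c) ^ n * y ^ n" by (metis mult_minus_left power_mult_distrib)
            then show ?thesis by (simp add: s_def)
          qed
          then show ?thesis unfolding mk by (simp add: distrib_left distrib_right mult_ac)
        qed
        ultimately show ?case by simp
      qed
      show "(\<lambda>x. h x * exp (- (c * \<bar>x $ i\<bar>)) * monomial k x) \<in> borel_measurable \<mu>" by (rule measurable_laguerre_measure1) measurable
      show "(\<lambda>x. 2 * B * C * exp (\<Sum>j\<in>UNIV. c' j * x $ j)) \<in> borel_measurable \<mu>" by (rule measurable_laguerre_measure1) measurable
      show "(\<integral>\<^sup>+x. ennreal ((2 * B * C * exp (\<Sum>j\<in>UNIV. c' j * x $ j)) powr p) \<partial>\<mu>) < \<infinity>"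
        by (rule exp_powr_finite[OF p c'])
      show "AE x in \<mu>. (\<lambda>n. h x * s n (x $ i) * monomial k x) \<longlonglongrightarrow> h x * exp (- (c * \<bar>x $ i\<bar>)) * monomial k x"
      proof (rule AE_I2)
        fix x assume "x \<in> space \<mu>"
        then have "x $ i > 0" by (simp add: orthant_def)
        moreover have "(\<lambda>n. s n (x $ i)) \<longlonglongrightarrow> exp (- (c * x $ i))"
          using exp_converges[of "- (c * x $ i)"] by (simp add: sums_def s_def scaleR_conv_of_real)
        ultimately show "(\<lambda>n. h x * s n (x $ i) * monomial k x) \<longlonglongrightarrow> h x * exp (- (c * \<bar>x $ i\<bar>)) * monomial k x"
          by (intro tendsto_intros) simp
      qed
      fix n x assume x: "x \<in> (orthant :: (real ^ 'd) set)"
      then have m: "monomial k x \<ge> 0" and xi: "x $ i > 0" by (auto simp: orthant_def monomial_nonneg)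
      have "exp (- (c * x $ i)) \<le> exp (c * x $ i)" using c xi by simp
      then have "\<bar>s n (x $ i) - exp (- (c * x $ i))\<bar> \<le> 2 * exp (c * x $ i)"
      proof -
        have "\<bar>s n (x $ i) - exp (- (c * x $ i))\<bar> \<le> \<bar>s n (x $ i)\<bar> + exp (- (c * x $ i))"
          using abs_triangle_ineq4[of "s n (x $ i)" "exp (- (c * x $ i))"] by simp
        then show ?thesis using sb[OF xi, of n] \<open>exp (- (c * x $ i)) \<le> exp (c * x $ i)\<close> by linarith
      qed
      then have "\<bar>h x\<bar> * \<bar>s n (x $ i) - exp (- (c * x $ i))\<bar> * \<bar>monomial k x\<bar> \<le> B * (2 * exp (c * x $ i)) * (C * exp (\<Sum>i\<in>UNIV. e * x $ i))"
        using C(2)[OF x] B B0 m by (intro mult_mono) auto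
      then show "\<bar>h x * s n (x $ i) * monomial k x - h x * exp (- (c * \<bar>x $ i\<bar>)) * monomial k x\<bar> \<le> 2 * B * C * exp (\<Sum>j\<in>UNIV. c' j * x $ j)"
        using xi by (simp add: se mult_ac flip: abs_mult left_diff_distrib right_diff_distrib)
    qed
  qed
  moreover have "\<bar>h x * exp (- (c * \<bar>x $ i\<bar>))\<bar> \<le> B" for x
    using mult_mono[OF B, of "exp (- (c * \<bar>x $ i\<bar>))" 1] c B0 by (simp add: abs_mult)
  ultimately show ?thesis unfolding stable_class_def by auto
qed

text \<open>A large rate is reached by N multiplications with a small rate c / N, each of which
  stays in the class.\<close>

lemma stable_class_exp:
  assumes p: "p > 0" and h: "h \<in> stable_class p" and c: "c \<ge> 0"
  shows "(\<lambda>x. h x * exp (- (c * \<bar>x $ i\<bar>))) \<in> stable_class p"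
proof -
  obtain N where N: "real N > max 1 (p * (2 * c))" using reals_Archimedean2 by blast
  define d where "d = c / real N"
  have d: "d \<ge> 0" "p * (2 * d) < 1" using c N p by (auto simp: d_def field_simps)
  have "(\<lambda>x. h x * exp (- (real n * d * \<bar>x $ i\<bar>))) \<in> stable_class p" for n
  proof (induction n)
    case (Suc n)
    from stable_class_exp_small[OF p this d, of i] show ?case
      by (simp add: mult.assoc distrib_right add.commute flip: exp_add)
  qed (use h in simp)
  from this[of N] show ?thesis using N by (simp add: d_def)
qed

lemma stable_class_one_minus_exp_power:
  assumes p: "p > 0" and h: "h \<in> stable_class p" and c: "c \<ge> 0"
  shows "(\<lambda>x. h x * (1 - exp (- (c * \<bar>x $ i\<bar>))) ^ N) \<in> stable_class p"
proof (induction N)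
  case (Suc N)
  from stable_class_diff[OF p this stable_class_exp[OF p this c, of i]] show ?case
    by (simp add: algebra_simps)
qed (use h in simp)

text \<open>On the hyperplane x_i = a the functions approximating the half-space indicator need not
  tend to it, so this set has to be null.\<close>

lemma AE_coordinate_neq: "AE x in \<mu>. x $ i \<noteq> a"
proof -
  have m: "(\<lambda>x::real ^ 'd. x $ i) \<in> borel_measurable \<mu>" by (rule measurable_laguerre_measure1) measurable
  have "(\<integral>\<^sup>+x. ennreal (\<Prod>j\<in>UNIV. if j = i then indicator {a} (x $ j) else 1) \<partial>\<mu>) =
    (\<Prod>j\<in>UNIV. \<integral>\<^sup>+y. ennreal (laguerre_weight (\<alpha> $ j) y * (if j = i then indicator {a} y else 1)) \<partial>lborel)"
    by (rule nn_integral_laguerre_prod) auto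
  also have "\<dots> = 0"
  proof -
    have "AE y in lborel. y \<noteq> a" by (rule AE_lborel_singleton)
    then have "AE y in lborel. ennreal (laguerre_weight (\<alpha> $ i) y * (if i = i then indicator {a} y else 1)) = 0"
      by eventually_elim auto
    then have "(\<integral>\<^sup>+y. ennreal (laguerre_weight (\<alpha> $ i) y * (if i = i then indicator {a} y else 1)) \<partial>lborel) = 0"
      by (subst nn_integral_0_iff_AE) auto
    then show ?thesis by (intro prod_zero bexI[of _ i]) auto
  qed
  finally have "(\<integral>\<^sup>+x. ennreal (\<Prod>j\<in>UNIV. if j = i then indicator {a} (x $ j) else 1) \<partial>\<mu>) = 0" .
  moreover have "(\<Prod>j\<in>UNIV. if j = i then indicator {a} (x $ j) else 1) = (indicator {a} (x $ i) :: real)" for x :: "real ^ 'd"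
    by simp
  ultimately have "(\<integral>\<^sup>+x. ennreal (indicator {a} (x $ i)) \<partial>\<mu>) = 0" by simp
  then have "AE x in \<mu>. ennreal (indicator {a} (x $ i)) = 0"
    using m by (subst (asm) nn_integral_0_iff_AE) auto
  then show ?thesis by eventually_elim (auto simp: indicator_def split: if_splits)
qed

text \<open>The exponent 2^n meets u^n in (2 u)^n. For u < 1/2 Bernoulli's inequality bounds the
  power below by 1 - (2 u)^n; for u > 1/2 it is at most exp (- (2 u)^n).\<close>

lemma one_minus_power_tendsto:
  fixes u :: real
  assumes u: "0 < u" "u < 1" "u \<noteq> 1 / 2"
  shows "(\<lambda>n. (1 - u ^ n) ^ (2 ^ n)) \<longlonglongrightarrow> (if u < 1 / 2 then 1 else 0)"
proof (cases "u < 1 / 2")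
  case True
  have "(\<lambda>n. 1 - (2 * u) ^ n) \<longlonglongrightarrow> 1 - 0"
    using True u by (intro tendsto_intros LIMSEQ_power_zero) auto
  moreover have "1 - (2 * u) ^ n \<le> (1 - u ^ n) ^ (2 ^ n)" for n
    using Bernoulli_inequality[of "- (u ^ n)" "2 ^ n"] u by (simp add: power_mult_distrib power_le_one)
  moreover have "(1 - u ^ n) ^ (2 ^ n) \<le> 1" for n
    using u by (intro power_le_one) (auto simp: power_le_one)
  ultimately have "(\<lambda>n. (1 - u ^ n) ^ (2 ^ n)) \<longlonglongrightarrow> 1"
    by - (rule tendsto_sandwich[of "\<lambda>n. 1 - (2 * u) ^ n" _ _ "\<lambda>_. 1"], auto)
  then show ?thesis using True by simp
next
  case False
  have "filterlim (\<lambda>n. (2 * u) ^ n) at_top sequentially"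
    using False u by (intro filterlim_at_infinity_imp_filterlim_at_top filterlim_realpow_sequentially_gt1) auto
  then have "(\<lambda>n. exp (- ((2 * u) ^ n))) \<longlonglongrightarrow> 0"
    by (intro filterlim_compose[OF exp_at_bot]) (simp add: filterlim_uminus_at_bot)
  moreover have "(1 - u ^ n) ^ (2 ^ n) \<le> exp (- ((2 * u) ^ n))" for n
  proof -
    have "(1 - u ^ n) ^ (2 ^ n) \<le> exp (- (u ^ n)) ^ (2 ^ n)"
      using u exp_ge_add_one_self[of "- (u ^ n)"] by (intro power_mono) (auto simp: power_le_one)
    also have "\<dots> = exp (- ((2 * u) ^ n))"
      by (simp add: power_mult_distrib flip: exp_of_nat_mult)
    finally show ?thesis .
  qed
  moreover have "0 \<le> (1 - u ^ n) ^ (2 ^ n)" for n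
    using u by (intro zero_le_power) (auto simp: power_le_one)
  ultimately have "(\<lambda>n. (1 - u ^ n) ^ (2 ^ n)) \<longlonglongrightarrow> 0"
    by - (rule tendsto_sandwich[of "\<lambda>_. 0" _ _ "\<lambda>n. exp (- ((2 * u) ^ n))"], auto)
  then show ?thesis using False by simp
qed

text \<open>The indicator of \<open>x\<^sub>i > a\<close> is the limit of \<open>(1 - u\<^sup>n)\<close> raised to the power \<open>2\<^sup>n\<close>, where \<open>u = exp (- c x\<^sub>i)\<close>
  and \<open>c\<close> is chosen such that \<open>u = 1 / 2\<close> for \<open>x\<^sub>i = a\<close>.\<close>

lemma stable_class_halfspace:
  assumes p: "p > 0" and h: "h \<in> stable_class p"
  shows "(\<lambda>x. h x * indicator {x. a < x $ i} x) \<in> stable_class p"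
proof -
  have hm[measurable]: "h \<in> borel_measurable borel" using h by (simp add: stable_class_def)
  obtain B where B: "\<And>x. \<bar>h x\<bar> \<le> B" using h by (auto simp: stable_class_def)
  have b2: "\<bar>h x * indicator {x. a < x $ i} x\<bar> \<le> B" for x
    using B[of x] order_trans[OF abs_ge_zero B] by (auto simp: indicator_def)
  have gm: "(\<lambda>x. h x * indicator {x. a < x $ i} x) \<in> borel_measurable borel" by measurable
  show ?thesis
  proof (cases "a > 0")
    case False
    show ?thesis
      by (rule stable_class_cong[OF h gm b2]) (use False in \<open>auto simp: orthant_def indicator_def dest!: spec[of _ i]\<close>)
  next
    case a: True
    define c where "c = ln 2 / a"
    have c: "c > 0" using a by (simp add: c_def)
    define f where "f n x = h x * (1 - exp (- ((real n * c) * \<bar>x $ i\<bar>))) ^ (2 ^ n)" for n x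
    show ?thesis
    proof (rule stable_class_limit[OF p _ _ b2 gm, of f])
      show "f n \<in> stable_class p" for n
        unfolding f_def using c by (intro stable_class_one_minus_exp_power p h) auto
      show "\<bar>f n x\<bar> \<le> B" for n x
      proof -
        have "\<bar>(1 - exp (- ((real n * c) * \<bar>x $ i\<bar>))) ^ (2 ^ n)\<bar> \<le> 1"
          unfolding power_abs using c by (intro power_le_one) auto
        then have "\<bar>f n x\<bar> \<le> B * 1"
          unfolding f_def abs_mult using B[of x] order_trans[OF abs_ge_zero B] by (intro mult_mono) auto
        then show ?thesis by simp
      qed
      show "AE x in \<mu>. (\<lambda>n. f n x) \<longlonglongrightarrow> h x * indicator {x. a < x $ i} x"
        using AE_coordinate_neq[of i a] AE_space
      proof eventually_elim
        case (elim x)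
        then have xi: "x $ i > 0" by (simp add: orthant_def)
        define u where "u = exp (- (c * x $ i))"
        have ca: "exp (- (c * a)) = 1 / 2" using a by (simp add: c_def exp_minus)
        have u: "0 < u" "u < 1" using c xi by (auto simp: u_def)
        have lt: "u < 1 / 2 \<longleftrightarrow> a < x $ i" and ne: "u \<noteq> 1 / 2"
          using c elim unfolding ca[symmetric] u_def by auto
        have "(\<lambda>n. h x * (1 - u ^ n) ^ (2 ^ n)) \<longlonglongrightarrow> h x * (if u < 1 / 2 then 1 else 0)"
          by (intro tendsto_intros one_minus_power_tendsto u ne)
        moreover have "f n x = h x * (1 - u ^ n) ^ (2 ^ n)" for n
          using xi by (simp add: f_def u_def mult.assoc flip: exp_of_nat_mult)
        moreover have "(if u < 1 / 2 then 1 else 0) = (indicator {x. a < x $ i} x :: real)"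
          using lt by (simp add: indicator_def)
        ultimately show ?case by simp
      qed
    qed
  qed
qed

text \<open>Keeping \<open>h\<close> arbitrary in the induction makes the sets closed under
  intersection, because \<open>h\<close> may already contain another indicator. The half-spaces
  therefore suffice as generators although they are not closed under intersection.\<close>

lemma stable_class_indicator:
  assumes p: "p > 0" and S: "S \<in> sets borel" and h: "h \<in> stable_class p"
  shows "(\<lambda>x. h x * indicator S x) \<in> stable_class p"
proof -
  have "S \<in> sigma_sets UNIV ((\<lambda>(a, i). {x :: real ^ 'd. a < x \<bullet> i}) ` (UNIV \<times> Basis))"
    using S unfolding borel_eq_halfspace_greater by (simp add: sets_measure_of)
  then show ?thesis
    using h
  proof (induction S arbitrary: h rule: sigma_sets.induct)
    case (Basic S)
    then obtain a i where S: "S = {x. a < x $ i}" by (auto simp: Basis_vec_def inner_axis)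
    show ?case unfolding S by (rule stable_class_halfspace[OF p Basic.prems])
  next
    case Empty
    show ?case using stable_class_scale[OF p Empty.prems, of 0] by simp
  next
    case (Compl S)
    from stable_class_diff[OF p Compl.prems Compl.IH[OF Compl.prems]] show ?case
      by (simp add: indicator_diff right_diff_distrib)
  next
    case (Union A)
    have Am[measurable]: "A n \<in> sets borel" for n
      using Union.hyps[of n] unfolding borel_eq_halfspace_greater by (simp add: sets_measure_of)
    have hm[measurable]: "h \<in> borel_measurable borel" using Union.prems by (simp add: stable_class_def)
    obtain B where B: "\<And>x. \<bar>h x\<bar> \<le> B" using Union.prems by (auto simp: stable_class_def)
    have bb: "\<bar>h x * indicator X x\<bar> \<le> B" for x X
      using B[of x] order_trans[OF abs_ge_zero B] by (auto simp: indicator_def)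
    have fin: "(\<lambda>x. h x * indicator (\<Union>n<N. A n) x) \<in> stable_class p" for N
    proof (induction N)
      case 0
      show ?case using stable_class_scale[OF p Union.prems, of 0] by simp
    next
      case (Suc N)
      \<comment> \<open>Inclusion and exclusion: in the last term the hypothesis for
        \<open>A N\<close> is applied to \<open>h\<close> times the indicator of the earlier
        sets.\<close>
      have "(\<lambda>x. h x * indicator (\<Union>n<N. A n) x + (h x * indicator (A N) x - (h x * indicator (\<Union>n<N. A n) x) * indicator (A N) x)) \<in> stable_class p"
        by (intro stable_class_add stable_class_diff p Suc Union.IH Union.prems)
      moreover have "h x * indicator (\<Union>n<N. A n) x + (h x * indicator (A N) x - (h x * indicator (\<Union>n<N. A n) x) * indicator (A N) x) = h x * indicator (\<Union>n<Suc N. A n) x" for x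
        by (auto simp: indicator_def less_Suc_eq)
      ultimately show ?case by simp
    qed
    show ?case
    proof (rule stable_class_limit[OF p fin bb bb])
      show "(\<lambda>x. h x * indicator (\<Union>(range A)) x) \<in> borel_measurable borel" by measurable
      show "AE x in \<mu>. (\<lambda>N. h x * indicator (\<Union>n<N. A n) x) \<longlonglongrightarrow> h x * indicator (\<Union>(range A)) x"
        by (intro AE_I2 tendsto_intros LIMSEQ_indicator_UN)
    qed
  qed
qed

text \<open>Boundedness is a premise inside the induction: it passes to summands and to the members
  of an increasing sequence because all functions involved are nonnegative.\<close>

lemma stable_class_bounded_nonneg:
  assumes p: "p > 0" and f: "f \<in> borel_measurable borel" "\<And>x. f x \<ge> 0" "\<And>x. f x \<le> B"
  shows "f \<in> stable_class p"
proof -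
  have "(\<exists>B. \<forall>x. f x \<le> B) \<longrightarrow> f \<in> stable_class p"
    using f(1,2)
  proof (induction f rule: borel_measurable_induct_real)
    case (set A)
    show ?case using stable_class_indicator[OF p set stable_class_one[OF p]] by simp
  next
    case (mult u c)
    show ?case
    proof (cases "c = 0")
      case True
      then show ?thesis using stable_class_scale[OF p stable_class_one[OF p], of 0] by simp
    next
      case False
      show ?thesis
      proof
        assume "\<exists>B. \<forall>x. c * u x \<le> B"
        then obtain B where "\<And>x. c * u x \<le> B" by blast
        then have "u x \<le> B / c" for x using False mult(1) by (simp add: field_simps)
        then show "(\<lambda>x. c * u x) \<in> stable_class p" using mult by (intro stable_class_scale p) blast
      qed
    qed
  next
    case (add u v)
    show ?case
    proof
      assume "\<exists>B. \<forall>x. v x + u x \<le> B"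
      then obtain B where B: "\<And>x. v x + u x \<le> B" by blast
      have "u x \<le> B" "v x \<le> B" for x using B[of x] add.hyps(2)[of x] add.hyps(4)[of x] by linarith+
      then show "(\<lambda>x. v x + u x) \<in> stable_class p" using add by (intro stable_class_add p) blast+
    qed
  next
    case (seq U)
    show ?case
    proof
      assume "\<exists>B. \<forall>x. f x \<le> B"
      then obtain B where B: "\<And>x. f x \<le> B" by blast
      have U: "U n x \<le> f x" for n x
        using seq.hyps(3) seq.hyps(4)[of x] by (intro incseq_le) (auto simp: incseq_def le_fun_def)
      have Ub: "U n \<in> stable_class p" for n
        using seq.IH[of n] U[of n] B order_trans by blast
      show "f \<in> stable_class p"
      proof (rule stable_class_limit[OF p, where f=U and B=B])
        show "U n \<in> stable_class p" for n by (rule Ub)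
        show "\<bar>U n x\<bar> \<le> B" for n x using seq.hyps(2)[of n x] U[of n x] B[of x] by auto
        show "\<bar>f x\<bar> \<le> B" for x using seq.hyps(2)[of 0 x] U[of 0 x] B[of x] by auto
        show "f \<in> borel_measurable borel" by (rule f(1))
      qed (use seq.hyps(4) in auto)
    qed
  qed
  then show ?thesis using f(3) by blast
qed

text \<open>Replaces a function known only on the orthant and almost everywhere by a Borel function
  on the whole space that is bounded at every point, as the class requires.\<close>

lemma bounded_modification:
  fixes f :: "real ^ 'd \<Rightarrow> real" and B :: real
  assumes f: "f \<in> borel_measurable \<mu>" and B: "AE x in \<mu>. \<bar>f x\<bar> \<le> B"
  obtains f' where "f' \<in> borel_measurable borel" "\<And>x. \<bar>f' x\<bar> \<le> B" "AE x in \<mu>. f' x = f x"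
proof
  have B0: "B \<ge> 0"
  proof (rule ccontr)
    assume "\<not> 0 \<le> B"
    then have "AE x in \<mu>. False" using B by (elim eventually_mono) auto
    then show False by simp
  qed
  define g where "g x = indicator orthant x * f x" for x
  have g: "g \<in> borel_measurable borel"
    using f unfolding measurable_cong_sets[OF sets_laguerre_measure refl] g_def[abs_def]
    by (subst (asm) borel_measurable_restrict_space_iff) auto
  define f' where "f' x = (if \<bar>g x\<bar> \<le> B then g x else 0)" for x
  show "f' \<in> borel_measurable borel" unfolding f'_def[abs_def] using g by measurable
  show "\<bar>f' x\<bar> \<le> B" for x using B0 by (simp add: f'_def)
  show "AE x in \<mu>. f' x = f x" using B AE_space by eventually_elim (simp add: f'_def g_def)
qed

lemma polys_dense:
  fixes f :: "real ^ 'd \<Rightarrow> real" and B :: real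
  assumes f: "f \<in> borel_measurable \<mu>" and B: "AE x in \<mu>. \<bar>f x\<bar> \<le> B" and p: "p > 0"
  obtains K c where "\<And>n. finite (K n)" "Lp_tendsto \<alpha> p (\<lambda>n. laguerre_comb \<alpha> (K n) (c n)) f"
proof -
  obtain f' where f': "f' \<in> borel_measurable borel" "\<And>x. \<bar>f' x\<bar> \<le> B" "AE x in \<mu>. f' x = f x"
    using bounded_modification[OF f B] by blast
  \<comment> \<open>The shift by \<open>B\<close> reduces a signed function to a nonnegative
    one.\<close>
  have "(\<lambda>x. f' x + B * 1) \<in> stable_class p"
  proof (rule stable_class_bounded_nonneg[OF p, where B="2 * B"])
    fix x
    show "0 \<le> f' x + B * 1" "f' x + B * 1 \<le> 2 * B" using f'(2)[of x] by linarith+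
  qed (use f'(1) in simp)
  from stable_class_diff[OF p this stable_class_scale[OF p stable_class_one[OF p], of B]]
  have "f' \<in> stable_class p" by simp
  then have "approximable p (\<lambda>x. f' x * monomial (\<lambda>_. 0) x)" by (auto simp: stable_class_def)
  then have a: "approximable p f'" by (simp add: monomial_def)
  have "\<exists>K c. finite K \<and> (\<integral>\<^sup>+x. ennreal (\<bar>laguerre_comb \<alpha> K c x - f x\<bar> powr p) \<partial>\<mu>) \<le> ennreal (1 / real (Suc n))" for n
  proof -
    obtain q where q: "q \<in> laguerre_polys" "(\<integral>\<^sup>+x. ennreal (\<bar>q x - f' x\<bar> powr p) \<partial>\<mu>) \<le> ennreal (1 / real (Suc n))"
    proof -
      have "1 / real (Suc n) > 0" by simp
      then show ?thesis using that a unfolding approximable_def by blast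
    qed
    obtain K c where K: "finite K" "\<And>x. x \<in> orthant \<Longrightarrow> q x = laguerre_comb \<alpha> K c x"
      using q(1) by (auto simp: laguerre_polys_def)
    have "(\<integral>\<^sup>+x. ennreal (\<bar>laguerre_comb \<alpha> K c x - f x\<bar> powr p) \<partial>\<mu>) = (\<integral>\<^sup>+x. ennreal (\<bar>q x - f' x\<bar> powr p) \<partial>\<mu>)"
    proof (rule nn_integral_cong_AE)
      show "AE x in \<mu>. ennreal (\<bar>laguerre_comb \<alpha> K c x - f x\<bar> powr p) = ennreal (\<bar>q x - f' x\<bar> powr p)"
        using f'(3) AE_space by eventually_elim (simp add: K)
    qed
    then show ?thesis using K(1) q(2) by (intro exI[of _ K] exI[of _ c] conjI) (simp_all only:)
  qed
  then have "\<exists>K. \<forall>n. \<exists>c. finite (K n) \<and> (\<integral>\<^sup>+x. ennreal (\<bar>laguerre_comb \<alpha> (K n) c x - f x\<bar> powr p) \<partial>\<mu>) \<le> ennreal (1 / real (Suc n))"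
    by (intro choice allI)
  then obtain K where "\<forall>n. \<exists>c. finite (K n) \<and> (\<integral>\<^sup>+x. ennreal (\<bar>laguerre_comb \<alpha> (K n) c x - f x\<bar> powr p) \<partial>\<mu>) \<le> ennreal (1 / real (Suc n))" ..
  from choice[OF this] obtain c where Kc: "\<And>n. finite (K n)" "\<And>n. (\<integral>\<^sup>+x. ennreal (\<bar>laguerre_comb \<alpha> (K n) (c n) x - f x\<bar> powr p) \<partial>\<mu>) \<le> ennreal (1 / real (Suc n))"
    by blast
  have "(\<lambda>n. ennreal (1 / real (Suc n))) \<longlonglongrightarrow> ennreal 0"
    using LIMSEQ_inverse_real_of_nat by (intro tendsto_ennrealI) (simp add: inverse_eq_divide)
  then have "Lp_tendsto \<alpha> p (\<lambda>n. laguerre_comb \<alpha> (K n) (c n)) f"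
    unfolding Lp_tendsto_def using Kc(2)
    by - (rule tendsto_sandwich[of "\<lambda>_. 0" _ _ "\<lambda>n. ennreal (1 / real (Suc n))"], auto)
  with Kc(1) that show ?thesis by blast
qed

end

section \<open>The semigroup law and the Bessel potential as an integral operator\<close>

lemma powr_tangent:
  fixes u m p :: real
  assumes u: "u \<ge> 0" and m: "m > 0" and p: "p \<ge> 1"
  shows "u powr p \<ge> m powr p + p * m powr (p - 1) * (u - m)"
proof (cases "u = 0")
  case True
  have "m powr p = m powr (p - 1) * m" using m powr_add[of m "p - 1" 1] by simp
  then have "m powr p + p * m powr (p - 1) * (u - m) = (1 - p) * (m powr p)"
    using True by (simp add: algebra_simps)
  also have "\<dots> \<le> 0" using p by (intro mult_nonpos_nonneg) auto
  finally show ?thesis using True by simp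
next
  case False
  have "u powr p - m powr p \<ge> (p * m powr (p - 1)) * (u - m)"
    by (rule convex_on_imp_above_tangent[OF powr_convex[OF p], of m])
       (use u m False in \<open>auto intro!: has_field_derivative_at_within has_real_derivative_powr simp: interior_open\<close>)
  then show ?thesis by simp
qed

text \<open>Stated without integrability: for a function that is not integrable the expectation is 0
  by convention and the inequality is trivial. Otherwise the tangent of u^p at the mean of |X| is
  integrated.\<close>

lemma (in prob_space) jensen_powr:
  assumes X[measurable]: "X \<in> borel_measurable M" and p: "p \<ge> 1"
  shows "ennreal (\<bar>expectation X\<bar> powr p) \<le> (\<integral>\<^sup>+x. ennreal (\<bar>X x\<bar> powr p) \<partial>M)"
proof (cases "(\<integral>\<^sup>+x. ennreal (\<bar>X x\<bar> powr p) \<partial>M) < \<infinity> \<and> integrable M X \<and> expectation (\<lambda>x. \<bar>X x\<bar>) > 0")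
  case True
  define m where "m = expectation (\<lambda>x. \<bar>X x\<bar>)"
  have m: "m > 0" using True by (simp add: m_def)
  have i: "integrable M (\<lambda>x. \<bar>X x\<bar> powr p)"
    using True by (intro integrableI_bounded) auto
  have "\<bar>expectation X\<bar> powr p \<le> m powr p"
    unfolding m_def using p by (intro powr_mono2 integral_abs_bound) auto
  also have "m powr p = expectation (\<lambda>x. m powr p + p * m powr (p - 1) * (\<bar>X x\<bar> - m))"
    using True by (simp add: m_def[symmetric] prob_space)
  also have "\<dots> \<le> expectation (\<lambda>x. \<bar>X x\<bar> powr p)"
    using True i powr_tangent[OF _ m p] by (intro integral_mono) auto
  finally have "ennreal (\<bar>expectation X\<bar> powr p) \<le> ennreal (expectation (\<lambda>x. \<bar>X x\<bar> powr p))" by (rule ennreal_leI)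
  then show ?thesis using i by (subst nn_integral_eq_integral) auto
next
  case False
  then consider "(\<integral>\<^sup>+x. ennreal (\<bar>X x\<bar> powr p) \<partial>M) = \<infinity>" | "\<not> integrable M X" | "expectation (\<lambda>x. \<bar>X x\<bar>) \<le> 0"
  proof -
    have "a = \<infinity>" if "\<not> a < \<infinity>" for a :: ennreal using that by (simp add: less_top[symmetric])
    then show ?thesis using False that by (meson not_less)
  qed
  then show ?thesis
  proof cases
    case 2
    then show ?thesis by (simp add: not_integrable_integral_eq)
  next
    case 3
    then have "expectation X = 0" using integral_abs_bound[of M X] by linarith
    then show ?thesis by simp
  qed simp
qed

context laguerre
begin

lemma pair_sigma_finite_lborel: "pair_sigma_finite (lborel :: real measure) \<mu>"
  by (intro pair_sigma_finite.intro sigma_finite_lborel sigma_finite_measure_axioms)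

lemma pair_sigma_finite_self: "pair_sigma_finite \<mu> \<mu>"
  by (intro pair_sigma_finite.intro sigma_finite_measure_axioms)

lemma kernel_nn_mass: "t > 0 \<Longrightarrow> x \<in> orthant \<Longrightarrow> (\<integral>\<^sup>+y. ennreal (laguerre_kernel \<alpha> t x y) \<partial>\<mu>) = 1"
  using kernel_mass[of t x] kernel_nonneg[of t x]
  by (subst nn_integral_eq_integral) (auto simp: has_bochner_integral_iff)

lemma const_measurable: "x \<in> orthant \<Longrightarrow> (\<lambda>_. x) \<in> measurable N \<mu>"
  by (rule measurable_const) simp

lemma kernel_mult_integrable:
  assumes t: "t > 0" and x: "x \<in> orthant" and f: "integrable \<mu> f"
  shows "integrable \<mu> (\<lambda>y. laguerre_kernel \<alpha> t x y * f y)"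
proof -
  note [measurable] = const_measurable[OF x]
  obtain C where C: "C \<ge> 0" "\<And>y. y \<in> orthant \<Longrightarrow> laguerre_kernel \<alpha> t x y \<le> C"
    using kernel_bounded[OF t x] by blast
  have [measurable]: "f \<in> borel_measurable \<mu>" using f by auto
  show ?thesis
  proof (rule Bochner_Integration.integrable_bound)
    show "integrable \<mu> (\<lambda>y. C * f y)" using f by simp
    show "AE y in \<mu>. norm (laguerre_kernel \<alpha> t x y * f y) \<le> norm (C * f y)"
      using C kernel_nonneg[OF t x] by (intro AE_I2) (auto simp: abs_mult intro!: mult_right_mono)
  qed measurable
qed

lemma bounded_integrable:
  fixes f :: "real ^ 'd \<Rightarrow> real" and B :: real
  assumes "f \<in> borel_measurable \<mu>" "AE x in \<mu>. \<bar>f x\<bar> \<le> B"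
  shows "integrable \<mu> f"
  using assms by (intro integrable_const_bound[where B=B]) auto

section \<open>Contraction, continuity and the semigroup law\<close>

lemma semigroup_bounded:
  assumes t: "t > 0" and x: "x \<in> orthant" and f: "f \<in> borel_measurable \<mu>" "AE x in \<mu>. \<bar>f x\<bar> \<le> B"
  shows "\<bar>laguerre_semigroup \<alpha> t f x\<bar> \<le> B"
proof -
  have "\<bar>laguerre_semigroup \<alpha> t f x\<bar> \<le> (LINT y|\<mu>. \<bar>laguerre_kernel \<alpha> t x y * f y\<bar>)"
    unfolding laguerre_semigroup_def by (rule integral_abs_bound)
  also have "\<dots> \<le> (LINT y|\<mu>. laguerre_kernel \<alpha> t x y * B)"
  proof (rule integral_mono_AE)
    show "integrable \<mu> (\<lambda>y. \<bar>laguerre_kernel \<alpha> t x y * f y\<bar>)"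
      by (intro integrable_abs kernel_mult_integrable[OF t x] bounded_integrable[OF f])
    show "integrable \<mu> (\<lambda>y. laguerre_kernel \<alpha> t x y * B)"
      using kernel_mass[OF t x] by (auto simp: has_bochner_integral_iff)
    show "AE y in \<mu>. \<bar>laguerre_kernel \<alpha> t x y * f y\<bar> \<le> laguerre_kernel \<alpha> t x y * B"
      using f(2) AE_space by eventually_elim (use kernel_nonneg[OF t x] in \<open>auto simp: abs_mult intro!: mult_left_mono\<close>)
  qed
  also have "\<dots> = B" using kernel_mass[OF t x] by (simp add: has_bochner_integral_iff)
  finally show ?thesis .
qed

lemma semigroup_measurable:
  assumes [measurable]: "f \<in> borel_measurable \<mu>" "g \<in> borel_measurable N" "h \<in> measurable N \<mu>"
  shows "(\<lambda>z. laguerre_semigroup \<alpha> (g z) f (h z)) \<in> borel_measurable N"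
  unfolding laguerre_semigroup_def by measurable

lemma semigroup_cong_AE:
  assumes "AE x in \<mu>. f x = g x" "f \<in> borel_measurable \<mu>" "g \<in> borel_measurable \<mu>" and x: "x \<in> orthant"
  shows "laguerre_semigroup \<alpha> t f x = laguerre_semigroup \<alpha> t g x"
proof -
  note [measurable] = const_measurable[OF x] assms(2,3)
  show ?thesis unfolding laguerre_semigroup_def
    using assms(1) by (intro integral_cong_AE) (measurable, auto elim: eventually_mono)
qed

text \<open>By symmetry the kernel has mass one in its first variable as well, so Tonelli's theorem
  gives the contraction.\<close>

lemma semigroup_L1:
  assumes t: "t > 0" and f[measurable]: "f \<in> borel_measurable \<mu>"
  shows "(\<integral>\<^sup>+x. ennreal \<bar>laguerre_semigroup \<alpha> t f x\<bar> \<partial>\<mu>) \<le> (\<integral>\<^sup>+x. ennreal \<bar>f x\<bar> \<partial>\<mu>)"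
proof -
  interpret pair_sigma_finite \<mu> \<mu> by (rule pair_sigma_finite_self)
  have "(\<integral>\<^sup>+x. ennreal \<bar>laguerre_semigroup \<alpha> t f x\<bar> \<partial>\<mu>) \<le> (\<integral>\<^sup>+x. \<integral>\<^sup>+y. ennreal (laguerre_kernel \<alpha> t x y) * ennreal \<bar>f y\<bar> \<partial>\<mu> \<partial>\<mu>)"
  proof (rule nn_integral_mono)
    fix x assume "x \<in> space \<mu>"
    then have x: "x \<in> orthant" by simp
    note [measurable] = const_measurable[OF x]
    have "ennreal \<bar>laguerre_semigroup \<alpha> t f x\<bar> \<le> (\<integral>\<^sup>+y. ennreal \<bar>laguerre_kernel \<alpha> t x y * f y\<bar> \<partial>\<mu>)"
      unfolding laguerre_semigroup_def using integral_norm_bound_ennreal[of \<mu> "\<lambda>y. laguerre_kernel \<alpha> t x y * f y"]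
      by (cases "integrable \<mu> (\<lambda>y. laguerre_kernel \<alpha> t x y * f y)") (auto simp: not_integrable_integral_eq)
    also have "\<dots> = (\<integral>\<^sup>+y. ennreal (laguerre_kernel \<alpha> t x y) * ennreal \<bar>f y\<bar> \<partial>\<mu>)"
      using kernel_nonneg[OF t x] by (intro nn_integral_cong) (simp add: abs_mult ennreal_mult')
    finally show "ennreal \<bar>laguerre_semigroup \<alpha> t f x\<bar> \<le> (\<integral>\<^sup>+y. ennreal (laguerre_kernel \<alpha> t x y) * ennreal \<bar>f y\<bar> \<partial>\<mu>)" .
  qed
  also have "\<dots> = (\<integral>\<^sup>+y. \<integral>\<^sup>+x. ennreal (laguerre_kernel \<alpha> t x y) * ennreal \<bar>f y\<bar> \<partial>\<mu> \<partial>\<mu>)"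
    using Fubini'[of "\<lambda>x y. ennreal (laguerre_kernel \<alpha> t x y) * ennreal \<bar>f y\<bar>"] by simp
  also have "\<dots> = (\<integral>\<^sup>+y. ennreal \<bar>f y\<bar> \<partial>\<mu>)"
  proof (rule nn_integral_cong)
    fix y assume "y \<in> space \<mu>"
    then have y: "y \<in> orthant" by simp
    note [measurable] = const_measurable[OF y]
    show "(\<integral>\<^sup>+x. ennreal (laguerre_kernel \<alpha> t x y) * ennreal \<bar>f y\<bar> \<partial>\<mu>) = ennreal \<bar>f y\<bar>"
      using kernel_nn_mass[OF t y] by (subst nn_integral_multc) (auto simp: kernel_commute[of t _ y])
  qed
  finally show ?thesis .
qed

text \<open>For fixed x the kernel is bounded in y; convergence in L^1 therefore gives convergence
  at every point of the orthant, not merely almost everywhere.\<close>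

lemma semigroup_tendsto:
  assumes t: "t > 0" and x: "x \<in> orthant" and f: "\<And>n. integrable \<mu> (f n)" "integrable \<mu> g"
    and l: "(\<lambda>n. \<integral>\<^sup>+y. ennreal \<bar>f n y - g y\<bar> \<partial>\<mu>) \<longlonglongrightarrow> 0"
  shows "(\<lambda>n. laguerre_semigroup \<alpha> t (f n) x) \<longlonglongrightarrow> laguerre_semigroup \<alpha> t g x"
proof -
  obtain C where C: "C \<ge> 0" "\<And>y. y \<in> orthant \<Longrightarrow> laguerre_kernel \<alpha> t x y \<le> C"
    using kernel_bounded[OF t x] by blast
  have "(\<lambda>n. laguerre_semigroup \<alpha> t (f n) x - laguerre_semigroup \<alpha> t g x) \<longlonglongrightarrow> 0"
  proof (rule Lim_null_comparison)
    show "eventually (\<lambda>n. norm (laguerre_semigroup \<alpha> t (f n) x - laguerre_semigroup \<alpha> t g x) \<le> C * (LINT y|\<mu>. \<bar>f n y - g y\<bar>)) sequentially"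
    proof (rule always_eventually, rule allI)
      fix n
      have "laguerre_semigroup \<alpha> t (f n) x - laguerre_semigroup \<alpha> t g x = (LINT y|\<mu>. laguerre_kernel \<alpha> t x y * (f n y - g y))"
        unfolding laguerre_semigroup_def using kernel_mult_integrable[OF t x] f by (simp add: right_diff_distrib)
      also have "\<bar>\<dots>\<bar> \<le> (LINT y|\<mu>. \<bar>laguerre_kernel \<alpha> t x y * (f n y - g y)\<bar>)"
        by (rule integral_abs_bound)
      also have "\<dots> \<le> (LINT y|\<mu>. C * \<bar>f n y - g y\<bar>)"
      proof (rule integral_mono)
        show "integrable \<mu> (\<lambda>y. \<bar>laguerre_kernel \<alpha> t x y * (f n y - g y)\<bar>)"
          using f by (intro integrable_abs kernel_mult_integrable[OF t x]) auto
        show "integrable \<mu> (\<lambda>y. C * \<bar>f n y - g y\<bar>)" using f by auto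
        show "\<bar>laguerre_kernel \<alpha> t x y * (f n y - g y)\<bar> \<le> C * \<bar>f n y - g y\<bar>" if "y \<in> space \<mu>" for y
          using C(2)[of y] kernel_nonneg[OF t x, of y] that by (auto simp: abs_mult intro!: mult_right_mono)
      qed
      finally show "norm (laguerre_semigroup \<alpha> t (f n) x - laguerre_semigroup \<alpha> t g x) \<le> C * (LINT y|\<mu>. \<bar>f n y - g y\<bar>)" by simp
    qed
    have "(\<lambda>n. ennreal (LINT y|\<mu>. \<bar>f n y - g y\<bar>)) \<longlonglongrightarrow> ennreal 0"
      using l f by (subst nn_integral_eq_integral[symmetric]) auto
    then have "(\<lambda>n. LINT y|\<mu>. \<bar>f n y - g y\<bar>) \<longlonglongrightarrow> 0"
      by (subst (asm) tendsto_ennreal_iff) auto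
    from tendsto_mult_right_zero[OF this]
    show "(\<lambda>n. C * (LINT y|\<mu>. \<bar>f n y - g y\<bar>)) \<longlonglongrightarrow> 0" .
  qed
  then show ?thesis by (simp add: LIM_zero_iff)
qed

lemma laguerre_poly_integrable: "integrable \<mu> (laguerre_poly \<alpha> k)"
proof -
  have m: "integrable lborel (\<lambda>y. laguerre_weight a y * y ^ j)" if "a > -1" for a j
  proof -
    have "has_bochner_integral lborel (\<lambda>y. 1 / Gamma (a + 1) * (indicator {0<..} y * (y powr (real j + a + 1 - 1) * exp (- (y / 1)))))
      (1 / Gamma (a + 1) * (Gamma (real j + a + 1) * 1 powr (real j + a + 1)))"
      using that by (intro has_bochner_integral_mult_right gamma_moment) auto
    moreover have "1 / Gamma (a + 1) * (indicator {0<..} y * (y powr (real j + a + 1 - 1) * exp (- (y / 1)))) = laguerre_weight a y * y ^ j" for y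
      by (cases "y > 0") (auto simp: laguerre_weight_def powr_add powr_realpow)
    ultimately show ?thesis by (simp add: has_bochner_integral_iff)
  qed
  have "integrable lborel (\<lambda>y. laguerre_weight (\<alpha> $ i) y * laguerre_sum (\<alpha> $ i) j y)" for i j
  proof -
    have "(\<lambda>y. laguerre_weight (\<alpha> $ i) y * laguerre_sum (\<alpha> $ i) j y) = (\<lambda>y. \<Sum>m\<le>j. real (j choose m) * (-1) ^ m / Gamma (real m + \<alpha> $ i + 1) * (laguerre_weight (\<alpha> $ i) y * y ^ m))"
      by (simp add: laguerre_sum_def sum_distrib_left mult_ac)
    then show ?thesis using m[OF alpha] by simp
  qed
  then have "has_bochner_integral \<mu> (\<lambda>x. \<Prod>i\<in>UNIV. laguerre_sum (\<alpha> $ i) (k $ i) (x $ i)) (\<Prod>i\<in>UNIV. LBINT y. laguerre_weight (\<alpha> $ i) y * laguerre_sum (\<alpha> $ i) (k $ i) y)"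
    by (intro has_bochner_integral_laguerre_prod has_bochner_integral_integrable) auto
  then have "integrable \<mu> (\<lambda>x. (\<Prod>i\<in>UNIV. Gamma (real (k $ i) + \<alpha> $ i + 1) / fact (k $ i)) * (\<Prod>i\<in>UNIV. laguerre_sum (\<alpha> $ i) (k $ i) (x $ i)))"
    by (intro integrable_mult_right) (auto simp: has_bochner_integral_iff)
  then show ?thesis
    by (subst Bochner_Integration.integrable_cong[OF refl laguerre_poly_eq]) auto
qed

lemma laguerre_comb_integrable: "integrable \<mu> (laguerre_comb \<alpha> K c)"
  unfolding laguerre_comb_def[abs_def] by (intro Bochner_Integration.integrable_sum integrable_mult_right laguerre_poly_integrable)

lemma semigroup_comb:
  assumes t: "t > 0" and x: "x \<in> orthant"
  shows "laguerre_semigroup \<alpha> t (laguerre_comb \<alpha> K c) x = laguerre_comb \<alpha> K (\<lambda>k. exp (- t) ^ (\<Sum>i\<in>UNIV. k $ i) * c k) x"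
proof -
  have "has_bochner_integral \<mu> (\<lambda>y. \<Sum>k\<in>K. c k * (laguerre_kernel \<alpha> t x y * laguerre_poly \<alpha> k y))
     (\<Sum>k\<in>K. c k * (exp (- t) ^ (\<Sum>i\<in>UNIV. k $ i) * laguerre_poly \<alpha> k x))"
    by (intro has_bochner_integral_sum has_bochner_integral_mult_right kernel_eigen t x)
  then show ?thesis
    by (simp add: laguerre_semigroup_def laguerre_comb_def sum_distrib_left mult_ac has_bochner_integral_iff)
qed

text \<open>Both sides agree on polynomials and, the kernel being bounded in \<open>y\<close>, depend continuously on \<open>f\<close> in \<open>L\<^sup>1\<close>.\<close>

lemma semigroup_semigroup:
  assumes t: "t > 0" "s > 0" and x: "x \<in> orthant" and f[measurable]: "f \<in> borel_measurable \<mu>" and B: "AE x in \<mu>. \<bar>f x\<bar> \<le> B"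
  shows "laguerre_semigroup \<alpha> s (laguerre_semigroup \<alpha> t f) x = laguerre_semigroup \<alpha> (s + t) f x"
proof -
  obtain K c where K: "\<And>n. finite (K n)" and l: "Lp_tendsto \<alpha> 1 (\<lambda>n. laguerre_comb \<alpha> (K n) (c n)) f"
    using polys_dense[OF f B, of 1] by auto
  define q where "q n = laguerre_comb \<alpha> (K n) (c n)" for n
  define q' where "q' n = laguerre_comb \<alpha> (K n) (\<lambda>k. exp (- t) ^ (\<Sum>i\<in>UNIV. k $ i) * c n k)" for n
  have [measurable]: "q n \<in> borel_measurable \<mu>" "q' n \<in> borel_measurable \<mu>" for n by (simp_all add: q_def q'_def)
  have qi: "integrable \<mu> (q n)" "integrable \<mu> (q' n)" for n by (simp_all add: q_def q'_def laguerre_comb_integrable)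
  have fi: "integrable \<mu> f" by (rule bounded_integrable[OF f B])
  have l1: "(\<lambda>n. \<integral>\<^sup>+y. ennreal \<bar>q n y - f y\<bar> \<partial>\<mu>) \<longlonglongrightarrow> 0"
    using l by (simp add: Lp_tendsto_def q_def)
  have Tm[measurable]: "laguerre_semigroup \<alpha> t f \<in> borel_measurable \<mu>"
    by (rule semigroup_measurable[of f "\<lambda>_. t" \<mu> "\<lambda>x. x"]) auto
  have Ti: "integrable \<mu> (laguerre_semigroup \<alpha> t f)"
    using semigroup_bounded[OF t(1) _ f B] by (intro bounded_integrable[of _ B] AE_I2) auto
  have qt: "laguerre_semigroup \<alpha> t (q n) y = q' n y" if "y \<in> orthant" for n y
    using semigroup_comb[OF t(1) that] by (simp add: q_def q'_def)
  have "(\<integral>\<^sup>+y. ennreal \<bar>q' n y - laguerre_semigroup \<alpha> t f y\<bar> \<partial>\<mu>) \<le> (\<integral>\<^sup>+y. ennreal \<bar>q n y - f y\<bar> \<partial>\<mu>)" for n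
  proof -
    have "(\<integral>\<^sup>+y. ennreal \<bar>q' n y - laguerre_semigroup \<alpha> t f y\<bar> \<partial>\<mu>) = (\<integral>\<^sup>+y. ennreal \<bar>laguerre_semigroup \<alpha> t (\<lambda>z. q n z - f z) y\<bar> \<partial>\<mu>)"
    proof (rule nn_integral_cong)
      fix y assume "y \<in> space \<mu>"
      then have y: "y \<in> orthant" by simp
      have "laguerre_semigroup \<alpha> t (\<lambda>z. q n z - f z) y = laguerre_semigroup \<alpha> t (q n) y - laguerre_semigroup \<alpha> t f y"
        unfolding laguerre_semigroup_def using kernel_mult_integrable[OF t(1) y] qi fi by (simp add: right_diff_distrib)
      then show "ennreal \<bar>q' n y - laguerre_semigroup \<alpha> t f y\<bar> = ennreal \<bar>laguerre_semigroup \<alpha> t (\<lambda>z. q n z - f z) y\<bar>"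
        using qt[OF y] by simp
    qed
    also have "\<dots> \<le> (\<integral>\<^sup>+y. ennreal \<bar>q n y - f y\<bar> \<partial>\<mu>)"
      using semigroup_L1[OF t(1), of "\<lambda>z. q n z - f z"] by simp
    finally show ?thesis .
  qed
  then have l2: "(\<lambda>n. \<integral>\<^sup>+y. ennreal \<bar>q' n y - laguerre_semigroup \<alpha> t f y\<bar> \<partial>\<mu>) \<longlonglongrightarrow> 0"
    using l1 by (intro tendsto_sandwich[OF _ _ tendsto_const l1]) auto
  have "(\<lambda>n. laguerre_semigroup \<alpha> s (q' n) x) \<longlonglongrightarrow> laguerre_semigroup \<alpha> s (laguerre_semigroup \<alpha> t f) x"
    by (rule semigroup_tendsto[OF t(2) x qi(2) Ti l2])
  moreover have "(\<lambda>n. laguerre_semigroup \<alpha> (s + t) (q n) x) \<longlonglongrightarrow> laguerre_semigroup \<alpha> (s + t) f x"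
    using t by (intro semigroup_tendsto[OF _ x qi(1) fi l1]) auto
  moreover have "laguerre_semigroup \<alpha> (s + t) (q n) x = laguerre_semigroup \<alpha> s (q' n) x" for n
  proof -
    have "exp (- (s + t)) = exp (- s) * exp (- t)" by (simp flip: exp_add)
    then show ?thesis
      unfolding q_def q'_def using t semigroup_comb[OF _ x, of "s + t"] semigroup_comb[OF t(2) x]
      by (simp add: power_mult_distrib mult.assoc)
  qed
  ultimately show ?thesis using LIMSEQ_unique by simp
qed

text \<open>The operator \<open>(I + L)\<^sup>-\<^sup>l\<^sup>/\<^sup>2\<close> as an average of the semigroup: integration over the pairs \<open>(s, y)\<close>
  is what makes the contractivity on \<open>L\<^sup>p\<close> an instance of Jensen's inequality.\<close>

definition bessel_kernel :: "real \<Rightarrow> real ^ 'd \<Rightarrow> real \<times> (real ^ 'd) \<Rightarrow> real" where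
  "bessel_kernel l x z = gamma_density (l / 2) (fst z) * laguerre_kernel \<alpha> (fst z) x (snd z)"

definition bessel_op :: "real \<Rightarrow> (real ^ 'd \<Rightarrow> real) \<Rightarrow> real ^ 'd \<Rightarrow> real" where
  "bessel_op l f x = (LINT z|(lborel \<Otimes>\<^sub>M \<mu>). bessel_kernel l x z * f (snd z))"

lemma bessel_kernel_measurable [measurable]:
  assumes [measurable]: "g \<in> measurable N \<mu>" and h: "h \<in> measurable N (lborel \<Otimes>\<^sub>M \<mu>)"
  shows "(\<lambda>z. bessel_kernel l (g z) (h z)) \<in> borel_measurable N"
proof -
  have [measurable]: "(\<lambda>z. fst (h z)) \<in> borel_measurable N" "(\<lambda>z. snd (h z)) \<in> measurable N \<mu>"
    using measurable_compose[OF h measurable_fst] measurable_compose[OF h measurable_snd] by auto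
  show ?thesis unfolding bessel_kernel_def by measurable
qed

lemma bessel_kernel_nonneg:
  assumes "l > 0" "x \<in> orthant" "snd z \<in> orthant"
  shows "bessel_kernel l x z \<ge> 0"
proof (cases "fst z > 0")
  case True
  then show ?thesis using assms kernel_nonneg gamma_density_nonneg[of "l / 2"] by (simp add: bessel_kernel_def)
qed (simp add: bessel_kernel_def)

lemma gamma_density_nn: "l > 0 \<Longrightarrow> (\<integral>\<^sup>+s. ennreal (gamma_density (l / 2) s) \<partial>lborel) = 1"
  using gamma_density_integral[of "l / 2"] gamma_density_nonneg[of "l / 2"]
  by (subst nn_integral_eq_integral) (auto simp: has_bochner_integral_iff)

lemma bessel_kernel_mass:
  assumes l: "l > 0" and x: "x \<in> orthant"
  shows "(\<integral>\<^sup>+z. ennreal (bessel_kernel l x z) \<partial>(lborel \<Otimes>\<^sub>M \<mu>)) = 1"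
proof -
  note [measurable] = const_measurable[OF x]
  have "(\<integral>\<^sup>+z. ennreal (bessel_kernel l x z) \<partial>(lborel \<Otimes>\<^sub>M \<mu>)) = (\<integral>\<^sup>+s. \<integral>\<^sup>+y. ennreal (bessel_kernel l x (s, y)) \<partial>\<mu> \<partial>lborel)"
    by (rule nn_integral_fst[symmetric]) measurable
  also have "\<dots> = (\<integral>\<^sup>+s. ennreal (gamma_density (l / 2) s) \<partial>lborel)"
  proof (rule nn_integral_cong)
    fix s :: real
    show "(\<integral>\<^sup>+y. ennreal (bessel_kernel l x (s, y)) \<partial>\<mu>) = ennreal (gamma_density (l / 2) s)"
    proof (cases "s > 0")
      case True
      have "(\<integral>\<^sup>+y. ennreal (bessel_kernel l x (s, y)) \<partial>\<mu>) = (\<integral>\<^sup>+y. ennreal (gamma_density (l / 2) s) * ennreal (laguerre_kernel \<alpha> s x y) \<partial>\<mu>)"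
        using l gamma_density_nonneg[of "l / 2"] by (intro nn_integral_cong) (simp add: bessel_kernel_def ennreal_mult')
      also have "\<dots> = ennreal (gamma_density (l / 2) s)"
        using kernel_nn_mass[OF True x] by (subst nn_integral_cmult) auto
      finally show ?thesis .
    qed (simp add: bessel_kernel_def)
  qed
  finally show ?thesis using gamma_density_nn[OF l] by simp
qed

lemma bessel_kernel_swap: "bessel_kernel l x (s, y) = bessel_kernel l y (s, x)"
  by (simp add: bessel_kernel_def kernel_commute)

lemma bessel_op_measurable [measurable]:
  assumes [measurable]: "f \<in> borel_measurable \<mu>"
  shows "bessel_op l f \<in> borel_measurable \<mu>"
proof -
  interpret pair_sigma_finite "lborel :: real measure" \<mu> by (rule pair_sigma_finite_lborel)
  interpret P: sigma_finite_measure "(lborel :: real measure) \<Otimes>\<^sub>M \<mu>"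
    by (intro sigma_finite_pair_measure sigma_finite_lborel sigma_finite_measure_axioms)
  show ?thesis unfolding bessel_op_def[abs_def] by measurable
qed

text \<open>The kernel is symmetric in x and y, so for fixed y it also has mass one over (s,
  x).\<close>

lemma bessel_kernel_tonelli:
  assumes l: "l > 0" and F[measurable]: "F \<in> borel_measurable \<mu>"
  shows "(\<integral>\<^sup>+x. \<integral>\<^sup>+z. ennreal (bessel_kernel l x z) * F (snd z) \<partial>(lborel \<Otimes>\<^sub>M \<mu>) \<partial>\<mu>) = (\<integral>\<^sup>+y. F y \<partial>\<mu>)"
proof -
  interpret L: pair_sigma_finite "lborel :: real measure" \<mu> by (rule pair_sigma_finite_lborel)
  interpret P: sigma_finite_measure "(lborel :: real measure) \<Otimes>\<^sub>M \<mu>"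
    by (intro sigma_finite_pair_measure sigma_finite_lborel sigma_finite_measure_axioms)
  interpret Q: pair_sigma_finite \<mu> "(lborel :: real measure) \<Otimes>\<^sub>M \<mu>" ..
  have "(\<integral>\<^sup>+x. \<integral>\<^sup>+z. ennreal (bessel_kernel l x z) * F (snd z) \<partial>(lborel \<Otimes>\<^sub>M \<mu>) \<partial>\<mu>)
      = (\<integral>\<^sup>+z. \<integral>\<^sup>+x. ennreal (bessel_kernel l x z) * F (snd z) \<partial>\<mu> \<partial>(lborel \<Otimes>\<^sub>M \<mu>))"
    using Q.Fubini'[of "\<lambda>x z. ennreal (bessel_kernel l x z) * F (snd z)"] by simp
  also have "\<dots> = (\<integral>\<^sup>+y. \<integral>\<^sup>+s. \<integral>\<^sup>+x. ennreal (bessel_kernel l x (s, y)) * F y \<partial>\<mu> \<partial>lborel \<partial>\<mu>)"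
    by (subst L.nn_integral_snd[symmetric]) (auto simp: split_beta')
  also have "\<dots> = (\<integral>\<^sup>+y. F y \<partial>\<mu>)"
  proof (rule nn_integral_cong)
    fix y assume "y \<in> space \<mu>"
    then have y: "y \<in> orthant" by simp
    note [measurable] = const_measurable[OF y]
    have "(\<integral>\<^sup>+s. \<integral>\<^sup>+x. ennreal (bessel_kernel l x (s, y)) * F y \<partial>\<mu> \<partial>lborel)
       = (\<integral>\<^sup>+s. (\<integral>\<^sup>+x. ennreal (bessel_kernel l y (s, x)) \<partial>\<mu>) * F y \<partial>lborel)"
      unfolding bessel_kernel_swap[of l _ _ y] by (intro nn_integral_cong nn_integral_multc) measurable
    also have "\<dots> = (\<integral>\<^sup>+s. (\<integral>\<^sup>+x. ennreal (bessel_kernel l y (s, x)) \<partial>\<mu>) \<partial>lborel) * F y"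
      by (rule nn_integral_multc) measurable
    also have "(\<integral>\<^sup>+s. (\<integral>\<^sup>+x. ennreal (bessel_kernel l y (s, x)) \<partial>\<mu>) \<partial>lborel) = (\<integral>\<^sup>+z. ennreal (bessel_kernel l y z) \<partial>(lborel \<Otimes>\<^sub>M \<mu>))"
      by (rule nn_integral_fst) measurable
    finally show "(\<integral>\<^sup>+s. \<integral>\<^sup>+x. ennreal (bessel_kernel l x (s, y)) * F y \<partial>\<mu> \<partial>lborel) = F y"
      using bessel_kernel_mass[OF l y] by simp
  qed
  finally show ?thesis .
qed

lemma bessel_op_Lp:
  assumes l: "l > 0" and f[measurable]: "f \<in> borel_measurable \<mu>" and p: "p \<ge> 1"
  shows "(\<integral>\<^sup>+x. ennreal (\<bar>bessel_op l f x\<bar> powr p) \<partial>\<mu>) \<le> (\<integral>\<^sup>+x. ennreal (\<bar>f x\<bar> powr p) \<partial>\<mu>)"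
proof -
  have "(\<integral>\<^sup>+x. ennreal (\<bar>bessel_op l f x\<bar> powr p) \<partial>\<mu>) \<le> (\<integral>\<^sup>+x. \<integral>\<^sup>+z. ennreal (bessel_kernel l x z) * ennreal (\<bar>f (snd z)\<bar> powr p) \<partial>(lborel \<Otimes>\<^sub>M \<mu>) \<partial>\<mu>)"
  proof (rule nn_integral_mono)
    fix x assume "x \<in> space \<mu>"
    then have x: "x \<in> orthant" by simp
    note [measurable] = const_measurable[OF x]
    define D where "D = density (lborel \<Otimes>\<^sub>M \<mu>) (\<lambda>z. ennreal (bessel_kernel l x z))"
    have "(\<integral>\<^sup>+z. 1 \<partial>D) = (\<integral>\<^sup>+z. ennreal (bessel_kernel l x z) * 1 \<partial>(lborel \<Otimes>\<^sub>M \<mu>))"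
      unfolding D_def by (rule nn_integral_density) measurable
    then have "emeasure D (space D) = 1"
      using bessel_kernel_mass[OF l x] by simp
    then interpret D: prob_space D by (rule prob_spaceI)
    have "(\<lambda>z. f (snd z)) \<in> borel_measurable ((lborel :: real measure) \<Otimes>\<^sub>M \<mu>)" by measurable
    then have m: "(\<lambda>z. f (snd z)) \<in> borel_measurable D" by (simp add: D_def)
    have np: "AE z in (lborel :: real measure) \<Otimes>\<^sub>M \<mu>. 0 \<le> bessel_kernel l x z"
      using bessel_kernel_nonneg[OF l x] by (intro AE_I2) (auto simp: space_pair_measure)
    have e: "bessel_op l f x = (LINT z|D. f (snd z))"
      unfolding D_def bessel_op_def using np by (subst integral_density) auto
    have "ennreal (\<bar>bessel_op l f x\<bar> powr p) \<le> (\<integral>\<^sup>+z. ennreal (\<bar>f (snd z)\<bar> powr p) \<partial>D)"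
      unfolding e by (rule D.jensen_powr[OF m p])
    also have "\<dots> = (\<integral>\<^sup>+z. ennreal (bessel_kernel l x z) * ennreal (\<bar>f (snd z)\<bar> powr p) \<partial>(lborel \<Otimes>\<^sub>M \<mu>))"
      unfolding D_def by (rule nn_integral_density) measurable
    finally show "ennreal (\<bar>bessel_op l f x\<bar> powr p) \<le> (\<integral>\<^sup>+z. ennreal (bessel_kernel l x z) * ennreal (\<bar>f (snd z)\<bar> powr p) \<partial>(lborel \<Otimes>\<^sub>M \<mu>))" .
  qed
  also have "\<dots> = (\<integral>\<^sup>+y. ennreal (\<bar>f y\<bar> powr p) \<partial>\<mu>)"
    using bessel_kernel_tonelli[OF l, of "\<lambda>y. ennreal (\<bar>f y\<bar> powr p)"] by simp
  finally show ?thesis .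
qed

end

context laguerre
begin

section \<open>Orbits and Lipschitz bounds\<close>

text \<open>The value 0 at nonpositive times is a default that keeps orbits bounded on the whole
  line; the averaging kernels vanish there.\<close>

definition orbit :: "(real ^ 'd \<Rightarrow> real) \<Rightarrow> real ^ 'd \<Rightarrow> real \<Rightarrow> real" where
  "orbit f x s = (if s > 0 then laguerre_semigroup \<alpha> s f x else 0)"

lemma orbit_measurable [measurable]:
  assumes f: "f \<in> borel_measurable \<mu>" and x: "x \<in> orthant"
  shows "orbit f x \<in> borel_measurable borel"
proof -
  have [measurable]: "(\<lambda>s. laguerre_semigroup \<alpha> s f x) \<in> borel_measurable borel"
    by (rule semigroup_measurable[OF f _ const_measurable[OF x]]) simp
  show ?thesis unfolding orbit_def[abs_def] by measurable
qed

lemma AE_bound_nonneg: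
  assumes "AE x in \<mu>. \<bar>f x\<bar> \<le> (B :: real)"
  shows "B \<ge> 0"
proof (rule ccontr)
  assume "\<not> B \<ge> 0"
  then have "AE x in \<mu>. False" using assms by (elim eventually_mono) auto
  then show False by simp
qed

lemma orbit_bounded:
  assumes "f \<in> borel_measurable \<mu>" "AE x in \<mu>. \<bar>f x\<bar> \<le> B" "x \<in> orthant"
  shows "\<bar>orbit f x s\<bar> \<le> B"
  using semigroup_bounded[OF _ assms(3,1,2), of s] AE_bound_nonneg[OF assms(2)] by (simp add: orbit_def)

lemma bessel_mult_integrable:
  assumes l: "l > 0" and x: "x \<in> orthant" and f[measurable]: "f \<in> borel_measurable \<mu>" and B: "AE x in \<mu>. \<bar>f x\<bar> \<le> B"
  shows "integrable (lborel \<Otimes>\<^sub>M \<mu>) (\<lambda>z. bessel_kernel l x z * f (snd z))"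
proof -
  interpret pair_sigma_finite "lborel :: real measure" \<mu> by (rule pair_sigma_finite_lborel)
  note [measurable] = const_measurable[OF x]
  have np: "bessel_kernel l x z \<ge> 0" if "z \<in> space (lborel \<Otimes>\<^sub>M \<mu>)" for z
    using bessel_kernel_nonneg[OF l x] that by (auto simp: space_pair_measure)
  have i: "integrable (lborel \<Otimes>\<^sub>M \<mu>) (bessel_kernel l x)"
  proof (rule integrableI_bounded)
    have "(\<integral>\<^sup>+z. ennreal (norm (bessel_kernel l x z)) \<partial>(lborel \<Otimes>\<^sub>M \<mu>)) = (\<integral>\<^sup>+z. ennreal (bessel_kernel l x z) \<partial>(lborel \<Otimes>\<^sub>M \<mu>))"
      using np by (intro nn_integral_cong) auto
    then show "(\<integral>\<^sup>+z. ennreal (norm (bessel_kernel l x z)) \<partial>(lborel \<Otimes>\<^sub>M \<mu>)) < \<infinity>"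
      using bessel_kernel_mass[OF l x] by simp
  qed measurable
  have b: "AE z in (lborel :: real measure) \<Otimes>\<^sub>M \<mu>. \<bar>f (snd z)\<bar> \<le> B"
  proof (rule AE_pair_measure)
    show "{z \<in> space (lborel \<Otimes>\<^sub>M \<mu>). \<bar>f (snd z)\<bar> \<le> B} \<in> sets ((lborel :: real measure) \<Otimes>\<^sub>M \<mu>)" by measurable
  qed (use B in auto)
  show ?thesis
  proof (rule Bochner_Integration.integrable_bound)
    show "integrable (lborel \<Otimes>\<^sub>M \<mu>) (\<lambda>z. bessel_kernel l x z * B)" using i by simp
    show "AE z in lborel \<Otimes>\<^sub>M \<mu>. norm (bessel_kernel l x z * f (snd z)) \<le> norm (bessel_kernel l x z * B)"
      using b by eventually_elim (use AE_bound_nonneg[OF B] in \<open>auto simp: abs_mult intro!: mult_left_mono\<close>)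
  qed measurable
qed

lemma bessel_op_eq:
  assumes l: "l > 0" and x: "x \<in> orthant" and f[measurable]: "f \<in> borel_measurable \<mu>" and B: "AE x in \<mu>. \<bar>f x\<bar> \<le> B"
  shows "bessel_op l f x = gamma_op (l / 2) (orbit f x) 0"
proof -
  interpret pair_sigma_finite "lborel :: real measure" \<mu> by (rule pair_sigma_finite_lborel)
  have "bessel_op l f x = (LINT s|lborel. LINT y|\<mu>. bessel_kernel l x (s, y) * f (snd (s, y)))"
    unfolding bessel_op_def by (rule integral_fst'[OF bessel_mult_integrable[OF l x f B], symmetric])
  also have "\<dots> = (LINT s|lborel. orbit f x s * gamma_density (l / 2) s)"
  proof (rule Bochner_Integration.integral_cong[OF refl])
    fix s :: real
    show "(LINT y|\<mu>. bessel_kernel l x (s, y) * f (snd (s, y))) = orbit f x s * gamma_density (l / 2) s"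
      by (cases "s > 0") (auto simp: bessel_kernel_def orbit_def laguerre_semigroup_def mult.assoc)
  qed
  finally show ?thesis by (simp add: gamma_op_def)
qed

lemma bessel_op_bounded:
  assumes l: "l > 0" and x: "x \<in> orthant" and f: "f \<in> borel_measurable \<mu>" and B: "AE x in \<mu>. \<bar>f x\<bar> \<le> B"
  shows "\<bar>bessel_op l f x\<bar> \<le> B"
  unfolding bessel_op_eq[OF assms] using l orbit_measurable[OF f x] orbit_bounded[OF f B x] by (intro gamma_op_bound) auto

text \<open>T_s passes through an average over the orbit and translates it, by Fubini's theorem and
  the semigroup law. With \<open>k\<close> the gamma density it describes the orbit of the
  potential; with \<open>k\<close> a stable kernel it moves the Lipschitz hypothesis along the orbit
  of f.\<close>

lemma semigroup_mix:
  assumes s: "s > 0" and x: "x \<in> orthant" and f[measurable]: "f \<in> borel_measurable \<mu>" and B: "AE x in \<mu>. \<bar>f x\<bar> \<le> B"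
    and k: "integrable lborel k" "\<And>r. r \<le> 0 \<Longrightarrow> k r = 0"
  shows "laguerre_semigroup \<alpha> s (\<lambda>y. LBINT r. orbit f y r * k r) x = (LBINT r. orbit f x (s + r) * k r)"
proof -
  interpret L: pair_sigma_finite "lborel :: real measure" \<mu> by (rule pair_sigma_finite_lborel)
  have [measurable]: "k \<in> borel_measurable borel" using k by auto
  note [measurable] = const_measurable[OF x]
  have B0: "B \<ge> 0" by (rule AE_bound_nonneg[OF B])
  have [measurable]: "(\<lambda>(r, y). laguerre_semigroup \<alpha> r f y) \<in> borel_measurable (lborel \<Otimes>\<^sub>M \<mu>)"
    unfolding split_beta' by (rule semigroup_measurable[OF f]) measurable
  have om[measurable]: "(\<lambda>z. orbit f (snd z) (fst z)) \<in> borel_measurable (lborel \<Otimes>\<^sub>M \<mu>)"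
    unfolding orbit_def by measurable
  have Ki: "integrable (lborel \<Otimes>\<^sub>M \<mu>) (\<lambda>z. k (fst z) * laguerre_kernel \<alpha> s x (snd z))"
  proof (rule integrableI_bounded)
    have "(\<integral>\<^sup>+z. ennreal (norm (k (fst z) * laguerre_kernel \<alpha> s x (snd z))) \<partial>(lborel \<Otimes>\<^sub>M \<mu>))
       = (\<integral>\<^sup>+r. \<integral>\<^sup>+y. ennreal (norm (k r * laguerre_kernel \<alpha> s x y)) \<partial>\<mu> \<partial>lborel)"
      by (subst nn_integral_fst[symmetric]) auto
    also have "\<dots> = (\<integral>\<^sup>+r. \<integral>\<^sup>+y. ennreal (norm (k r)) * ennreal (laguerre_kernel \<alpha> s x y) \<partial>\<mu> \<partial>lborel)"
      using kernel_nonneg[OF s x] by (intro nn_integral_cong) (auto simp: abs_mult ennreal_mult')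
    also have "\<dots> = (\<integral>\<^sup>+r. ennreal (norm (k r)) \<partial>lborel)"
      using kernel_nn_mass[OF s x] by (intro nn_integral_cong) (simp add: nn_integral_cmult)
    also have "\<dots> < \<infinity>" using k(1) by (simp add: integrable_iff_bounded)
    finally show "(\<integral>\<^sup>+z. ennreal (norm (k (fst z) * laguerre_kernel \<alpha> s x (snd z))) \<partial>(lborel \<Otimes>\<^sub>M \<mu>)) < \<infinity>" .
  qed measurable
  have I: "integrable (lborel \<Otimes>\<^sub>M \<mu>) (\<lambda>(r, y). laguerre_kernel \<alpha> s x y * (orbit f y r * k r))"
  proof (rule Bochner_Integration.integrable_bound)
    show "integrable (lborel \<Otimes>\<^sub>M \<mu>) (\<lambda>z. B * (k (fst z) * laguerre_kernel \<alpha> s x (snd z)))" using Ki by simp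
    show "AE z in lborel \<Otimes>\<^sub>M \<mu>. norm (case z of (r, y) \<Rightarrow> laguerre_kernel \<alpha> s x y * (orbit f y r * k r)) \<le> norm (B * (k (fst z) * laguerre_kernel \<alpha> s x (snd z)))"
    proof (rule AE_I2)
      fix z assume "z \<in> space ((lborel :: real measure) \<Otimes>\<^sub>M \<mu>)"
      then obtain r y where z: "z = (r, y)" "y \<in> orthant" by (auto simp: space_pair_measure)
      have "\<bar>orbit f y r\<bar> * (\<bar>k r\<bar> * \<bar>laguerre_kernel \<alpha> s x y\<bar>) \<le> \<bar>B\<bar> * (\<bar>k r\<bar> * \<bar>laguerre_kernel \<alpha> s x y\<bar>)"
        using orbit_bounded[OF f B z(2), of r] by (intro mult_right_mono) auto
      then show "norm (case z of (r, y) \<Rightarrow> laguerre_kernel \<alpha> s x y * (orbit f y r * k r)) \<le> norm (B * (k (fst z) * laguerre_kernel \<alpha> s x (snd z)))"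
        by (simp add: z abs_mult mult_ac)
    qed
  qed (use om in \<open>simp add: split_beta'\<close>)
  have "laguerre_semigroup \<alpha> s (\<lambda>y. LBINT r. orbit f y r * k r) x = (LINT y|\<mu>. LINT r|lborel. laguerre_kernel \<alpha> s x y * (orbit f y r * k r))"
    by (simp add: laguerre_semigroup_def)
  also have "\<dots> = (LBINT r. LINT y|\<mu>. laguerre_kernel \<alpha> s x y * (orbit f y r * k r))"
    using L.Fubini_integral[OF I] by simp
  also have "\<dots> = (LBINT r. orbit f x (s + r) * k r)"
  proof (rule Bochner_Integration.integral_cong[OF refl])
    fix r
    show "(LINT y|\<mu>. laguerre_kernel \<alpha> s x y * (orbit f y r * k r)) = orbit f x (s + r) * k r"
    proof (cases "r > 0")
      case True
      have "(LINT y|\<mu>. laguerre_kernel \<alpha> s x y * (orbit f y r * k r)) = laguerre_semigroup \<alpha> s (laguerre_semigroup \<alpha> r f) x * k r"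
        using True by (simp add: laguerre_semigroup_def orbit_def flip: mult.assoc)
      then show ?thesis
        using semigroup_semigroup[OF True s x f B] True s by (simp add: orbit_def)
    qed (use k in simp)
  qed
  finally show ?thesis .
qed

lemma orbit_bessel_op:
  assumes l: "l > 0" and x: "x \<in> orthant" and f: "f \<in> borel_measurable \<mu>" and B: "AE x in \<mu>. \<bar>f x\<bar> \<le> B" and s: "s > 0"
  shows "laguerre_semigroup \<alpha> s (bessel_op l f) x = gamma_op (l / 2) (orbit f x) s"
proof -
  have "laguerre_semigroup \<alpha> s (bessel_op l f) x = laguerre_semigroup \<alpha> s (\<lambda>y. LBINT r. orbit f y r * gamma_density (l / 2) r) x"
    unfolding laguerre_semigroup_def using bessel_op_eq[OF l _ f B]
    by (intro Bochner_Integration.integral_cong refl) (simp add: gamma_op_def)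
  also have "\<dots> = (LBINT r. orbit f x (s + r) * gamma_density (l / 2) r)"
    using l by (intro semigroup_mix[OF s x f B] gamma_density_integrable) auto
  finally show ?thesis by (simp add: gamma_op_def)
qed

lemma poisson_eq:
  assumes "x \<in> orthant"
  shows "poisson_laguerre \<alpha> t f x = stable_op 0 (orbit f x) t 0"
  unfolding poisson_laguerre_def set_lebesgue_integral_def stable_op_def
proof (rule Bochner_Integration.integral_cong[OF refl])
  fix s :: real
  show "indicat_real {0<..} s *\<^sub>R (laguerre_semigroup \<alpha> s f x * (t / (2 * sqrt pi) * (exp (- (t\<^sup>2) / (4 * s)) / s powr (3 / 2)))) = orbit f x (0 + s) * stable_kernel 0 t s"
    by (cases "s > 0") (simp_all add: orbit_def stable_kernel_0)
qed

text \<open>All derivatives fall on the stable kernel, so the formula holds at every point of the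
  orthant for every bounded f.\<close>

lemma poisson_higher_deriv:
  assumes x: "x \<in> orthant" and f: "f \<in> borel_measurable \<mu>" and B: "AE x in \<mu>. \<bar>f x\<bar> \<le> B" and t: "t > 0"
  shows "(deriv ^^ n) (\<lambda>s. poisson_laguerre \<alpha> s f x) t = stable_op n (orbit f x) t 0"
  using t
proof (induction n arbitrary: t)
  case 0
  then show ?case by (simp add: poisson_eq[OF x])
next
  case (Suc n)
  have "((\<lambda>t. stable_op n (orbit f x) t 0) has_real_derivative stable_op (Suc n) (orbit f x) t 0) (at t)"
    by (rule stable_op_deriv[OF Suc.prems orbit_measurable[OF f x] orbit_bounded[OF f B x]])
  then have "((deriv ^^ n) (\<lambda>s. poisson_laguerre \<alpha> s f x) has_real_derivative stable_op (Suc n) (orbit f x) t 0) (at t)"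
    by (rule has_field_derivative_transform_within_open[of _ _ _ "{0<..}"]) (use Suc in auto)
  then show ?case by (simp add: DERIV_imp_deriv)
qed

text \<open>The semigroup integrates f against a kernel, so changing f on a null set leaves every
  value on the orthant unchanged. This allows a potential that is determined only almost
  everywhere.\<close>

lemma poisson_cong_AE:
  assumes "AE x in \<mu>. f x = g x" "f \<in> borel_measurable \<mu>" "g \<in> borel_measurable \<mu>" "x \<in> orthant"
  shows "poisson_laguerre \<alpha> t f x = poisson_laguerre \<alpha> t g x"
  unfolding poisson_laguerre_def using semigroup_cong_AE[OF assms] by simp

section \<open>Essential supremum norms\<close>

lemma Linf_norm_le_iff:
  assumes [measurable]: "f \<in> borel_measurable \<mu>"
  shows "Linf_norm \<alpha> f \<le> ereal B \<longleftrightarrow> (AE x in \<mu>. \<bar>f x\<bar> \<le> B)"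
proof
  assume le: "Linf_norm \<alpha> f \<le> ereal B"
  have "AE x in \<mu>. ereal \<bar>f x\<bar> \<le> Linf_norm \<alpha> f" unfolding Linf_norm_def by (rule esssup_AE)
  then show "AE x in \<mu>. \<bar>f x\<bar> \<le> B"
  proof eventually_elim
    case (elim x)
    then have "ereal \<bar>f x\<bar> \<le> ereal B" using le by (rule order_trans)
    then show ?case by simp
  qed
next
  assume "AE x in \<mu>. \<bar>f x\<bar> \<le> B"
  then show "Linf_norm \<alpha> f \<le> ereal B" unfolding Linf_norm_def by (intro esssup_I) auto
qed

lemma Linf_norm_nonneg:
  assumes [measurable]: "f \<in> borel_measurable \<mu>"
  shows "Linf_norm \<alpha> f \<ge> 0"
proof (rule ccontr)
  assume "\<not> ?thesis"
  then have "Linf_norm \<alpha> f < 0" by simp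
  then obtain b where "Linf_norm \<alpha> f < ereal b" "ereal b < 0"
    using ereal_dense2 by blast
  then have "AE x in \<mu>. \<bar>f x\<bar> \<le> b" using Linf_norm_le_iff[OF assms, of b] by (simp add: less_imp_le)
  from AE_bound_nonneg[OF this] \<open>ereal b < 0\<close> show False by simp
qed

lemma Linf_bound:
  assumes "f \<in> Linf \<alpha>"
  shows "f \<in> borel_measurable \<mu>" "AE x in \<mu>. \<bar>f x\<bar> \<le> real_of_ereal (Linf_norm \<alpha> f)"
proof -
  show f: "f \<in> borel_measurable \<mu>" using assms by (simp add: Linf_def)
  have "ereal (real_of_ereal (Linf_norm \<alpha> f)) = Linf_norm \<alpha> f"
    using assms Linf_norm_nonneg[OF f] by (intro ereal_real') (auto simp: Linf_def)
  then show "AE x in \<mu>. \<bar>f x\<bar> \<le> real_of_ereal (Linf_norm \<alpha> f)"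
    by (subst Linf_norm_le_iff[OF f, symmetric]) simp
qed

section \<open>Agreement of the abstract potential with the integral operator\<close>

lemma bessel_mult_integrable_AE:
  assumes l: "l > 0" and h: "integrable \<mu> h"
  shows "AE x in \<mu>. integrable (lborel \<Otimes>\<^sub>M \<mu>) (\<lambda>z. bessel_kernel l x z * h (snd z))"
proof -
  interpret P: sigma_finite_measure "(lborel :: real measure) \<Otimes>\<^sub>M \<mu>"
    by (intro sigma_finite_pair_measure sigma_finite_lborel sigma_finite_measure_axioms)
  have [measurable]: "h \<in> borel_measurable \<mu>" using h by auto
  have "(\<integral>\<^sup>+x. \<integral>\<^sup>+z. ennreal (bessel_kernel l x z) * ennreal \<bar>h (snd z)\<bar> \<partial>(lborel \<Otimes>\<^sub>M \<mu>) \<partial>\<mu>) \<noteq> \<infinity>"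
    using bessel_kernel_tonelli[OF l, of "\<lambda>y. ennreal \<bar>h y\<bar>"] h by (simp add: integrable_iff_bounded)
  then have "AE x in \<mu>. (\<integral>\<^sup>+z. ennreal (bessel_kernel l x z) * ennreal \<bar>h (snd z)\<bar> \<partial>(lborel \<Otimes>\<^sub>M \<mu>)) \<noteq> \<infinity>"
    by (intro nn_integral_PInf_AE) measurable
  then show ?thesis
    using AE_space
  proof eventually_elim
    case (elim x)
    then have x: "x \<in> orthant" by simp
    note [measurable] = const_measurable[OF x]
    show ?case
    proof (rule integrableI_bounded)
      have "(\<integral>\<^sup>+z. ennreal (norm (bessel_kernel l x z * h (snd z))) \<partial>(lborel \<Otimes>\<^sub>M \<mu>)) = (\<integral>\<^sup>+z. ennreal (bessel_kernel l x z) * ennreal \<bar>h (snd z)\<bar> \<partial>(lborel \<Otimes>\<^sub>M \<mu>))"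
        using bessel_kernel_nonneg[OF l x] by (intro nn_integral_cong) (auto simp: space_pair_measure abs_mult ennreal_mult')
      then show "(\<integral>\<^sup>+z. ennreal (norm (bessel_kernel l x z * h (snd z))) \<partial>(lborel \<Otimes>\<^sub>M \<mu>)) < \<infinity>"
        using elim by (simp add: less_top)
    qed measurable
  qed
qed

text \<open>Laguerre polynomials may be unbounded, so joint integrability in (s, y) comes from
  Tonelli's theorem and only for almost every x. At such x the inner integral gives exp (- |k| s),
  and the Laplace transform of the gamma density gives the multiplier.\<close>

lemma bessel_kernel_eigen:
  assumes l: "l > 0"
  shows "AE x in \<mu>. has_bochner_integral (lborel \<Otimes>\<^sub>M \<mu>) (\<lambda>z. bessel_kernel l x z * laguerre_poly \<alpha> k (snd z)) (bessel_multiplier l k * laguerre_poly \<alpha> k x)"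
  using bessel_mult_integrable_AE[OF l laguerre_poly_integrable[of k]] AE_space
proof eventually_elim
  case (elim x)
  interpret pair_sigma_finite "lborel :: real measure" \<mu> by (rule pair_sigma_finite_lborel)
  have x: "x \<in> orthant" using elim by simp
  define d where "d = (\<Sum>i\<in>UNIV. k $ i)"
  have "(LINT z|(lborel \<Otimes>\<^sub>M \<mu>). bessel_kernel l x z * laguerre_poly \<alpha> k (snd z)) = (LINT s|lborel. LINT y|\<mu>. bessel_kernel l x (s, y) * laguerre_poly \<alpha> k (snd (s, y)))"
    by (rule integral_fst'[OF elim(1), symmetric])
  also have "\<dots> = (LINT s|lborel. gamma_density (l / 2) s * exp (- (real d * s)) * laguerre_poly \<alpha> k x)"
  proof (rule Bochner_Integration.integral_cong[OF refl])
    fix s :: real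
    show "(LINT y|\<mu>. bessel_kernel l x (s, y) * laguerre_poly \<alpha> k (snd (s, y))) = gamma_density (l / 2) s * exp (- (real d * s)) * laguerre_poly \<alpha> k x"
    proof (cases "s > 0")
      case True
      have "exp (- s) ^ d = exp (- (real d * s))" by (simp flip: exp_of_nat_mult)
      then show ?thesis using kernel_eigen[OF True x, of k]
        by (simp add: bessel_kernel_def mult.assoc has_bochner_integral_iff d_def[symmetric])
    qed (simp add: bessel_kernel_def)
  qed
  also have "\<dots> = bessel_multiplier l k * laguerre_poly \<alpha> k x"
    using gamma_density_laplace[of "l / 2" "real d", OF _ of_nat_0_le_iff] l by (simp add: has_bochner_integral_iff bessel_multiplier_def d_def)
  finally show ?case using elim(1) by (simp add: has_bochner_integral_iff)
qed

text \<open>Splitting the integral needs integrability of both parts: for the bounded f it holds at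
  every x, for the finitely many polynomials outside a common null set.\<close>

lemma bessel_op_comb_diff:
  assumes l: "l > 0" and f: "f \<in> borel_measurable \<mu>" and B: "AE x in \<mu>. \<bar>f x\<bar> \<le> B" and K: "finite K"
  shows "AE x in \<mu>. bessel_op l (\<lambda>y. laguerre_comb \<alpha> K c y - f y) x = laguerre_comb \<alpha> K (\<lambda>k. bessel_multiplier l k * c k) x - bessel_op l f x"
proof -
  have "AE x in \<mu>. \<forall>k\<in>K. has_bochner_integral (lborel \<Otimes>\<^sub>M \<mu>) (\<lambda>z. bessel_kernel l x z * laguerre_poly \<alpha> k (snd z)) (bessel_multiplier l k * laguerre_poly \<alpha> k x)"
    using K bessel_kernel_eigen[OF l] by (intro AE_finite_allI) auto
  then show ?thesis
    using AE_space
  proof eventually_elim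
    case (elim x)
    then have x: "x \<in> orthant" by simp
    have "has_bochner_integral (lborel \<Otimes>\<^sub>M \<mu>) (\<lambda>z. \<Sum>k\<in>K. c k * (bessel_kernel l x z * laguerre_poly \<alpha> k (snd z))) (\<Sum>k\<in>K. c k * (bessel_multiplier l k * laguerre_poly \<alpha> k x))"
      using elim(1) by (intro has_bochner_integral_sum has_bochner_integral_mult_right) auto
    then have 1: "has_bochner_integral (lborel \<Otimes>\<^sub>M \<mu>) (\<lambda>z. bessel_kernel l x z * laguerre_comb \<alpha> K c (snd z)) (laguerre_comb \<alpha> K (\<lambda>k. bessel_multiplier l k * c k) x)"
      by (simp add: laguerre_comb_def sum_distrib_left mult_ac)
    have 2: "has_bochner_integral (lborel \<Otimes>\<^sub>M \<mu>) (\<lambda>z. bessel_kernel l x z * f (snd z)) (bessel_op l f x)"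
      unfolding bessel_op_def by (intro has_bochner_integral_integrable bessel_mult_integrable[OF l x f B])
    from has_bochner_integral_diff[OF 1 2] show ?case
      by (simp add: bessel_op_def right_diff_distrib has_bochner_integral_iff)
  qed
qed

lemma bessel_op_tendsto:
  assumes l: "l > 0" and p: "p \<ge> 1" and f[measurable]: "f \<in> borel_measurable \<mu>" and B: "AE x in \<mu>. \<bar>f x\<bar> \<le> B" and K: "\<And>n. finite (K n)"
    and q: "Lp_tendsto \<alpha> p (\<lambda>n. laguerre_comb \<alpha> (K n) (c n)) f"
  shows "Lp_tendsto \<alpha> p (\<lambda>n. laguerre_comb \<alpha> (K n) (\<lambda>k. bessel_multiplier l k * c n k)) (bessel_op l f)"
  unfolding Lp_tendsto_def
proof (rule tendsto_sandwich[OF _ _ tendsto_const q[unfolded Lp_tendsto_def]])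
  show "eventually (\<lambda>n. (\<integral>\<^sup>+x. ennreal (\<bar>laguerre_comb \<alpha> (K n) (\<lambda>k. bessel_multiplier l k * c n k) x - bessel_op l f x\<bar> powr p) \<partial>\<mu>)
      \<le> (\<integral>\<^sup>+x. ennreal (\<bar>laguerre_comb \<alpha> (K n) (c n) x - f x\<bar> powr p) \<partial>\<mu>)) sequentially"
  proof (rule always_eventually, rule allI)
    fix n
    have "(\<integral>\<^sup>+x. ennreal (\<bar>laguerre_comb \<alpha> (K n) (\<lambda>k. bessel_multiplier l k * c n k) x - bessel_op l f x\<bar> powr p) \<partial>\<mu>)
       = (\<integral>\<^sup>+x. ennreal (\<bar>bessel_op l (\<lambda>y. laguerre_comb \<alpha> (K n) (c n) y - f y) x\<bar> powr p) \<partial>\<mu>)"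
      using bessel_op_comb_diff[OF l f B K, of n "c n"] by (intro nn_integral_cong_AE) (auto elim: eventually_mono)
    also have "\<dots> \<le> (\<integral>\<^sup>+x. ennreal (\<bar>laguerre_comb \<alpha> (K n) (c n) x - f x\<bar> powr p) \<partial>\<mu>)"
      by (rule bessel_op_Lp[OF l _ p]) measurable
    finally show "(\<integral>\<^sup>+x. ennreal (\<bar>laguerre_comb \<alpha> (K n) (\<lambda>k. bessel_multiplier l k * c n k) x - bessel_op l f x\<bar> powr p) \<partial>\<mu>)
      \<le> (\<integral>\<^sup>+x. ennreal (\<bar>laguerre_comb \<alpha> (K n) (c n) x - f x\<bar> powr p) \<partial>\<mu>)" .
  qed
qed simp

lemma bounded_Lp:
  assumes f[measurable]: "f \<in> borel_measurable \<mu>" and B: "AE x in \<mu>. \<bar>f x\<bar> \<le> B" and p: "p > 0"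
  shows "f \<in> Lp \<alpha> p"
proof -
  have "(\<integral>\<^sup>+x. ennreal (\<bar>f x\<bar> powr p) \<partial>\<mu>) \<le> (\<integral>\<^sup>+x. ennreal (B powr p) \<partial>\<mu>)"
    using B by (intro nn_integral_mono_AE) (auto elim!: eventually_mono intro!: ennreal_leI powr_mono2 simp: p less_imp_le)
  also have "\<dots> < \<infinity>" using emeasure_space_1 by simp
  finally show ?thesis using f by (simp add: Lp_def)
qed

lemma bessel_op_extension:
  assumes l: "l > 0" and p: "p > 1" and f: "f \<in> borel_measurable \<mu>" and B: "AE x in \<mu>. \<bar>f x\<bar> \<le> B"
  shows "bessel_extension \<alpha> l p f (bessel_op l f)"
proof -
  obtain K c where K: "\<And>n. finite (K n)" "Lp_tendsto \<alpha> p (\<lambda>n. laguerre_comb \<alpha> (K n) (c n)) f"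
    using polys_dense[OF f B, of p] p by auto
  have "f \<in> Lp \<alpha> p" using bounded_Lp[OF f B] p by simp
  moreover have "bessel_op l f \<in> Lp \<alpha> p"
    using bessel_op_bounded[OF l _ f B] p by (intro bounded_Lp[where B=B] bessel_op_measurable f AE_I2) auto
  ultimately show ?thesis
    unfolding bessel_extension_def using K bessel_op_tendsto[OF l _ f B K] p by (intro conjI exI[of _ K] exI[of _ c]) auto
qed

text \<open>The sequence that witnesses \<open>g\<close> is also mapped to a sequence tending to
  \<open>bessel_op l f\<close>, so the images have two limits in L^p.\<close>

lemma bessel_extension_unique:
  assumes l: "l > 0" and p: "p > 1" and f: "f \<in> borel_measurable \<mu>" and B: "AE x in \<mu>. \<bar>f x\<bar> \<le> B"
    and g: "bessel_extension \<alpha> l p f g"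
  shows "AE x in \<mu>. g x = bessel_op l f x"
proof -
  have gm[measurable]: "g \<in> borel_measurable \<mu>" using g by (simp add: bessel_extension_def Lp_def)
  note [measurable] = bessel_op_measurable[OF f]
  obtain K c where K: "\<And>n. finite (K n)" "Lp_tendsto \<alpha> p (\<lambda>n. laguerre_comb \<alpha> (K n) (c n)) f"
     "Lp_tendsto \<alpha> p (\<lambda>n. laguerre_comb \<alpha> (K n) (\<lambda>k. bessel_multiplier l k * c n k)) g"
    using g unfolding bessel_extension_def by blast
  define q where "q n = laguerre_comb \<alpha> (K n) (\<lambda>k. bessel_multiplier l k * c n k)" for n
  have [measurable]: "q n \<in> borel_measurable \<mu>" for n by (simp add: q_def)
  have 1: "(\<lambda>n. \<integral>\<^sup>+x. ennreal (\<bar>q n x - bessel_op l f x\<bar> powr p) \<partial>\<mu>) \<longlonglongrightarrow> 0"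
    using bessel_op_tendsto[OF l _ f B K(1,2)] p by (simp add: Lp_tendsto_def q_def)
  have 2: "(\<lambda>n. \<integral>\<^sup>+x. ennreal (\<bar>q n x - g x\<bar> powr p) \<partial>\<mu>) \<longlonglongrightarrow> 0"
    using K(3) by (simp add: Lp_tendsto_def q_def)
  have "(\<integral>\<^sup>+x. ennreal (\<bar>g x - bessel_op l f x\<bar> powr p) \<partial>\<mu>) \<le> ennreal (2 powr p) * ((\<integral>\<^sup>+x. ennreal (\<bar>q n x - g x\<bar> powr p) \<partial>\<mu>) + (\<integral>\<^sup>+x. ennreal (\<bar>q n x - bessel_op l f x\<bar> powr p) \<partial>\<mu>))" for n
  proof -
    have "(\<integral>\<^sup>+x. ennreal (\<bar>g x - bessel_op l f x\<bar> powr p) \<partial>\<mu>) = (\<integral>\<^sup>+x. ennreal (\<bar>(g x - q n x) + (q n x - bessel_op l f x)\<bar> powr p) \<partial>\<mu>)"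
      by simp
    also have "\<dots> \<le> ennreal (2 powr p) * ((\<integral>\<^sup>+x. ennreal (\<bar>g x - q n x\<bar> powr p) \<partial>\<mu>) + (\<integral>\<^sup>+x. ennreal (\<bar>q n x - bessel_op l f x\<bar> powr p) \<partial>\<mu>))"
      using p by (intro nn_integral_add_powr_le) auto
    finally show ?thesis by (simp add: abs_minus_commute)
  qed
  moreover have "(\<lambda>n. ennreal (2 powr p) * ((\<integral>\<^sup>+x. ennreal (\<bar>q n x - g x\<bar> powr p) \<partial>\<mu>) + (\<integral>\<^sup>+x. ennreal (\<bar>q n x - bessel_op l f x\<bar> powr p) \<partial>\<mu>))) \<longlonglongrightarrow> ennreal (2 powr p) * (0 + 0)"
    by (intro ennreal_tendsto_cmult tendsto_add 1 2) auto
  ultimately have "(\<integral>\<^sup>+x. ennreal (\<bar>g x - bessel_op l f x\<bar> powr p) \<partial>\<mu>) \<le> ennreal (2 powr p) * (0 + 0)"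
    by (intro tendsto_lowerbound[of _ _ sequentially]) (auto intro: always_eventually)
  then have "(\<integral>\<^sup>+x. ennreal (\<bar>g x - bessel_op l f x\<bar> powr p) \<partial>\<mu>) = 0" by simp
  then have "AE x in \<mu>. ennreal (\<bar>g x - bessel_op l f x\<bar> powr p) = 0"
    by (subst (asm) nn_integral_0_iff_AE) auto
  then show ?thesis
  proof eventually_elim
    case (elim x)
    then have "\<bar>g x - bessel_op l f x\<bar> powr p = 0" by (simp add: ennreal_eq_0_iff powr_def split: if_splits)
    then show ?case by simp
  qed
qed

text \<open>The integral operator is a witness for all exponents p > 1 at once, so the choice in
  \<open>bessel_potential\<close> has a value; the exponent 2 then identifies that value almost
  everywhere.\<close>

lemma bessel_potential_AE:
  assumes l: "l > 0" and f: "f \<in> borel_measurable \<mu>" and B: "AE x in \<mu>. \<bar>f x\<bar> \<le> B"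
  shows "bessel_potential \<alpha> l f \<in> borel_measurable \<mu>" "AE x in \<mu>. bessel_potential \<alpha> l f x = bessel_op l f x"
proof -
  have "\<exists>g. \<forall>p>1. f \<in> Lp \<alpha> p \<longrightarrow> bessel_extension \<alpha> l p f g"
    using bessel_op_extension[OF l _ f B] by blast
  from someI_ex[OF this] have "bessel_extension \<alpha> l 2 f (bessel_potential \<alpha> l f)"
    using bounded_Lp[OF f B, of 2] by (simp add: bessel_potential_def)
  then show "bessel_potential \<alpha> l f \<in> borel_measurable \<mu>" "AE x in \<mu>. bessel_potential \<alpha> l f x = bessel_op l f x"
    using bessel_extension_unique[OF l _ f B, of 2] by (auto simp: bessel_extension_def Lp_def)
qed

section \<open>Transfer of the Lipschitz bounds to the potential\<close>

lemma poisson_deriv_measurable: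
  assumes f[measurable]: "f \<in> borel_measurable \<mu>" and B: "AE x in \<mu>. \<bar>f x\<bar> \<le> B" and t: "t > 0"
  shows "(\<lambda>x. (deriv ^^ n) (\<lambda>s. poisson_laguerre \<alpha> s f x) t) \<in> borel_measurable \<mu>"
proof -
  have [measurable]: "(\<lambda>z. laguerre_semigroup \<alpha> (snd z) f (fst z)) \<in> borel_measurable (\<mu> \<Otimes>\<^sub>M lborel)"
    by (rule semigroup_measurable[OF f]) measurable
  have "(\<lambda>x. LBINT r. orbit f x r * stable_kernel n t r) \<in> borel_measurable \<mu>"
    unfolding orbit_def by (rule lborel.borel_measurable_lebesgue_integral) (simp add: split_beta')
  then show ?thesis
    by (subst measurable_cong[OF poisson_higher_deriv[OF _ f B t]]) (auto simp: stable_op_def)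
qed

text \<open>T_s applied to the n-th derivative of P_t f is that derivative along the orbit at s. As
  T_s is an integral operator and a contraction, the bound, given almost everywhere, holds
  afterwards at every point x and every s > 0.\<close>

lemma lip_bound_orbit:
  assumes f: "f \<in> borel_measurable \<mu>" and B: "AE x in \<mu>. \<bar>f x\<bar> \<le> B" and A: "lip_bound \<alpha> b f A"
    and x: "x \<in> orthant" and t: "t > 0" and s: "s > 0"
  shows "\<bar>stable_op (lip_order b) (orbit f x) t s\<bar> \<le> A * t powr (b - real (lip_order b))"
proof -
  define n where "n = lip_order b"
  define h where "h y = (deriv ^^ n) (\<lambda>s. poisson_laguerre \<alpha> s f y) t" for y
  have hm: "h \<in> borel_measurable \<mu>" unfolding h_def[abs_def] by (rule poisson_deriv_measurable[OF f B t])
  have "Linf_norm \<alpha> h \<le> ereal (A * t powr (b - real n))"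
    using A t by (simp add: lip_bound_def h_def[abs_def] n_def add.commute)
  then have hB: "AE y in \<mu>. \<bar>h y\<bar> \<le> A * t powr (b - real n)"
    using Linf_norm_le_iff[OF hm] by simp
  have "laguerre_semigroup \<alpha> s h x = laguerre_semigroup \<alpha> s (\<lambda>y. LBINT r. orbit f y r * stable_kernel n t r) x"
    unfolding laguerre_semigroup_def h_def using poisson_higher_deriv[OF _ f B t]
    by (intro Bochner_Integration.integral_cong refl) (simp add: stable_op_def)
  also have "\<dots> = (LBINT r. orbit f x (s + r) * stable_kernel n t r)"
    using t by (intro semigroup_mix[OF s x f B] stable_kernel_integrable) auto
  finally have "laguerre_semigroup \<alpha> s h x = stable_op n (orbit f x) t s" by (simp add: stable_op_def)
  then show ?thesis using semigroup_bounded[OF s x hm hB] by (simp add: n_def)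
qed

text \<open>Evaluation at t = 1. It provides the lower bound under which the infimum in
  \<open>lip_norm\<close> can be compared.\<close>

lemma lip_bound_nonneg:
  assumes f: "f \<in> borel_measurable \<mu>" and B: "AE x in \<mu>. \<bar>f x\<bar> \<le> B" and A: "lip_bound \<alpha> b f A"
  shows "A \<ge> 0"
proof -
  have "ereal 0 \<le> Linf_norm \<alpha> (\<lambda>x. (deriv ^^ lip_order b) (\<lambda>s. poisson_laguerre \<alpha> s f x) 1)"
    using Linf_norm_nonneg[OF poisson_deriv_measurable[OF f B]] by (simp add: zero_ereal_def)
  also have "\<dots> \<le> ereal (A * 1 powr (- real (lip_order b) + b))"
    using A zero_less_one unfolding lip_bound_def by blast
  finally show ?thesis by simp
qed

lemma lip_bound_bessel_potential:
  assumes b: "b > 0" and l: "l > 0"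
  shows "\<exists>C>0. \<forall>f A. f \<in> Linf \<alpha> \<longrightarrow> lip_bound \<alpha> b f A \<longrightarrow> lip_bound \<alpha> (b + l) (bessel_potential \<alpha> l f) (C * A)"
proof -
  define n where "n = lip_order b"
  define n' where "n' = lip_order (b + l)"
  have n': "b + l < real n'"
    unfolding n'_def lip_order_def by (rule LeastI_ex) (rule reals_Archimedean2)
  obtain C where C: "C \<ge> 0" and gain: "\<forall>w M A. w \<in> borel_measurable borel \<longrightarrow> (\<forall>r. \<bar>w r\<bar> \<le> M) \<longrightarrow>
     (\<forall>t>0. \<forall>s>0. \<bar>stable_op n w t s\<bar> \<le> A * t powr (b - real n)) \<longrightarrow>
     (\<forall>t>0. \<bar>stable_op n' (gamma_op (l / 2) w) t 0\<bar> \<le> C * A * t powr (b + l - real n'))"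
    using gamma_op_lipschitz_gain[OF l n' b, of n] by blast
  have "lip_bound \<alpha> (b + l) (bessel_potential \<alpha> l f) ((C + 1) * A)" if f: "f \<in> Linf \<alpha>" and A: "lip_bound \<alpha> b f A" for f A
    unfolding lip_bound_def
  proof (intro allI impI)
    fix t :: real assume t: "t > 0"
    define B where "B = real_of_ereal (Linf_norm \<alpha> f)"
    note fB = Linf_bound[OF f, folded B_def]
    define g where "g = bessel_potential \<alpha> l f"
    have gm: "g \<in> borel_measurable \<mu>" and ge: "AE x in \<mu>. g x = bessel_op l f x"
      using bessel_potential_AE[OF l fB] by (auto simp: g_def)
    have Jm: "bessel_op l f \<in> borel_measurable \<mu>" by (rule bessel_op_measurable[OF fB(1)])
    have JB: "AE x in \<mu>. \<bar>bessel_op l f x\<bar> \<le> B" using bessel_op_bounded[OF l _ fB] by (intro AE_I2) simp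
    have eq: "(deriv ^^ n') (\<lambda>s. poisson_laguerre \<alpha> s g x) t = stable_op n' (gamma_op (l / 2) (orbit f x)) t 0" if x: "x \<in> orthant" for x
    proof -
      have "(deriv ^^ n') (\<lambda>s. poisson_laguerre \<alpha> s g x) t = (deriv ^^ n') (\<lambda>s. poisson_laguerre \<alpha> s (bessel_op l f) x) t"
        by (simp add: poisson_cong_AE[OF ge gm Jm x])
      also have "\<dots> = stable_op n' (orbit (bessel_op l f) x) t 0"
        by (rule poisson_higher_deriv[OF x Jm JB t])
      \<comment> \<open>The two functions of r agree for r > 0, which is all that the kernel
        sees.\<close>
      also have "\<dots> = stable_op n' (gamma_op (l / 2) (orbit f x)) t 0"
        unfolding stable_op_def
      proof (rule Bochner_Integration.integral_cong[OF refl])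
        fix r :: real
        show "orbit (bessel_op l f) x (0 + r) * stable_kernel n' t r = gamma_op (l / 2) (orbit f x) (0 + r) * stable_kernel n' t r"
          by (cases "r > 0") (auto simp: orbit_def[of "bessel_op l f"] orbit_bessel_op[OF l x fB])
      qed
      finally show ?thesis .
    qed
    have gB: "AE x in \<mu>. \<bar>g x\<bar> \<le> B" using ge JB by eventually_elim simp
    have A0: "A \<ge> 0" by (rule lip_bound_nonneg[OF fB A])
    have "AE x in \<mu>. \<bar>(deriv ^^ n') (\<lambda>s. poisson_laguerre \<alpha> s g x) t\<bar> \<le> (C + 1) * A * t powr (- real n' + (b + l))"
    proof (rule AE_I2)
      fix x assume "x \<in> space \<mu>"
      then have x: "x \<in> orthant" by simp
      have "\<bar>stable_op n' (gamma_op (l / 2) (orbit f x)) t 0\<bar> \<le> C * A * t powr (b + l - real n')"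
        using gain[THEN spec[where x="orbit f x"], THEN spec[where x=B], THEN spec[where x=A]]
          orbit_measurable[OF fB(1) x] orbit_bounded[OF fB x] lip_bound_orbit[OF fB A x] t by (simp add: n_def)
      also have "\<dots> \<le> (C + 1) * A * t powr (b + l - real n')"
        using C A0 by (intro mult_right_mono) auto
      finally show "\<bar>(deriv ^^ n') (\<lambda>s. poisson_laguerre \<alpha> s g x) t\<bar> \<le> (C + 1) * A * t powr (- real n' + (b + l))"
        by (simp add: eq[OF x] add.commute)
    qed
    then show "Linf_norm \<alpha> (\<lambda>x. (deriv ^^ lip_order (b + l)) (\<lambda>s. poisson_laguerre \<alpha> s (bessel_potential \<alpha> l f) x) t)
       \<le> ereal ((C + 1) * A * t powr (- real (lip_order (b + l)) + (b + l)))"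
      unfolding n'_def[symmetric] g_def[symmetric] by (subst Linf_norm_le_iff[OF poisson_deriv_measurable[OF gm gB t]])
  qed
  \<comment> \<open>\<open>C\<close> may be 0; enlarging it by 1 makes the constant positive, so
    that one may divide by it when infima are compared.\<close>
  then show ?thesis using C by (intro exI[of _ "C + 1"]) auto
qed

lemma bessel_potential_Linf:
  assumes l: "l > 0" and f: "f \<in> Linf \<alpha>"
  shows "bessel_potential \<alpha> l f \<in> Linf \<alpha>" "real_of_ereal (Linf_norm \<alpha> (bessel_potential \<alpha> l f)) \<le> real_of_ereal (Linf_norm \<alpha> f)"
proof -
  define B where "B = real_of_ereal (Linf_norm \<alpha> f)"
  note fB = Linf_bound[OF f, folded B_def]
  note g = bessel_potential_AE[OF l fB]
  have JB: "AE x in \<mu>. \<bar>bessel_op l f x\<bar> \<le> B" using bessel_op_bounded[OF l _ fB] by (intro AE_I2) simp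
  have "AE x in \<mu>. \<bar>bessel_potential \<alpha> l f x\<bar> \<le> B" using g(2) JB by eventually_elim simp
  then have le: "Linf_norm \<alpha> (bessel_potential \<alpha> l f) \<le> ereal B" by (subst Linf_norm_le_iff[OF g(1)])
  then show "bessel_potential \<alpha> l f \<in> Linf \<alpha>" using g(1) by (auto simp: Linf_def)
  show "real_of_ereal (Linf_norm \<alpha> (bessel_potential \<alpha> l f)) \<le> real_of_ereal (Linf_norm \<alpha> f)"
    using real_of_ereal_positive_mono[OF Linf_norm_nonneg[OF g(1)] le] by (simp add: B_def)
qed

end

theorem theorem4p1:
  fixes \<alpha> :: "real ^ 'd" and \<beta> l :: real
  assumes "\<forall>i. \<alpha> $ i > - (1 / 2)" and "\<beta> > 0" and "l > 0"
  shows "\<exists>C. \<forall>f \<in> Lip \<alpha> \<beta>.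
           bessel_potential \<alpha> l f \<in> Lip \<alpha> (\<beta> + l) \<and>
           lip_norm \<alpha> (\<beta> + l) (bessel_potential \<alpha> l f) \<le> C * lip_norm \<alpha> \<beta> f"
proof -
  interpret laguerre \<alpha>
  proof
    fix i
    have "\<alpha> $ i > - (1 / 2)" using assms(1) by blast
    then show "\<alpha> $ i > -1" by linarith
  qed
  obtain C where C: "C > 0" and lip: "\<And>f A. f \<in> Linf \<alpha> \<Longrightarrow> lip_bound \<alpha> \<beta> f A \<Longrightarrow> lip_bound \<alpha> (\<beta> + l) (bessel_potential \<alpha> l f) (C * A)"
    using lip_bound_bessel_potential[OF assms(2,3)] by blast
  have "bessel_potential \<alpha> l f \<in> Lip \<alpha> (\<beta> + l) \<and>
           lip_norm \<alpha> (\<beta> + l) (bessel_potential \<alpha> l f) \<le> (C + 1) * lip_norm \<alpha> \<beta> f" if "f \<in> Lip \<alpha> \<beta>" for f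
  proof
    from that obtain A where f: "f \<in> Linf \<alpha>" and A: "lip_bound \<alpha> \<beta> f A" by (auto simp: Lip_def)
    define g where "g = bessel_potential \<alpha> l f"
    have g: "g \<in> Linf \<alpha>" and gn: "real_of_ereal (Linf_norm \<alpha> g) \<le> real_of_ereal (Linf_norm \<alpha> f)"
      using bessel_potential_Linf[OF assms(3) f] by (auto simp: g_def)
    then show "bessel_potential \<alpha> l f \<in> Lip \<alpha> (\<beta> + l)"
      using lip[OF f A] by (auto simp: Lip_def g_def)
    define S where "S = {A. lip_bound \<alpha> \<beta> f A}"
    define S' where "S' = {A. lip_bound \<alpha> (\<beta> + l) g A}"
    have bdd: "bdd_below S'"
      using lip_bound_nonneg[OF Linf_bound[OF g]] by (intro bdd_belowI[of _ 0]) (auto simp: S'_def)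
    \<comment> \<open>Multiplication by \<open>C\<close> maps the admissible constants of f into
      those of its potential; dividing by \<open>C\<close> turns the infimum on one side into a
      lower bound on the other.\<close>
    have "Inf S' / C \<le> A" if "A \<in> S" for A
    proof -
      have "C * A \<in> S'" using lip[OF f, of A] that by (simp add: S_def S'_def g_def)
      then have "Inf S' \<le> C * A" by (rule cInf_lower[OF _ bdd])
      then show ?thesis using C by (simp add: field_simps)
    qed
    then have "Inf S' / C \<le> Inf S" using A by (intro cInf_greatest) (auto simp: S_def)
    then have 1: "Inf S' \<le> C * Inf S" using C by (simp add: field_simps)
    have 2: "0 \<le> Inf S"
      using A lip_bound_nonneg[OF Linf_bound[OF f]] by (intro cInf_greatest) (auto simp: S_def)
    have 3: "0 \<le> real_of_ereal (Linf_norm \<alpha> f)"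
      using Linf_norm_nonneg[OF Linf_bound(1)[OF f]] by (rule real_of_ereal_pos)
    \<comment> \<open>The sup norms compare with the constant 1 and the infima with
      \<open>C\<close>; the sum \<open>C + 1\<close> serves both since all quantities are
      nonnegative.\<close>
    have "real_of_ereal (Linf_norm \<alpha> g) + Inf S' \<le> (C + 1) * (real_of_ereal (Linf_norm \<alpha> f) + Inf S)"
    proof -
      have "0 \<le> C * real_of_ereal (Linf_norm \<alpha> f)" using C 3 by (intro mult_nonneg_nonneg) auto
      then show ?thesis unfolding distrib_left distrib_right using 1 2 gn by linarith
    qed
    then show "lip_norm \<alpha> (\<beta> + l) (bessel_potential \<alpha> l f) \<le> (C + 1) * lip_norm \<alpha> \<beta> f"
      by (simp add: lip_norm_def S_def S'_def g_def)
  qed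
  then show ?thesis by blast
qed

end
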